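(* Let $0<p,q\le\infty$, $0<s<\sigma$ and $d>1$. Then $f\in L_p(\mathbb{R}^n)$ belongs to $\mathbf{B}^s_{p,q}(\mathbb{R}^n)$ if, and only if, it can be represented as $$f=\sum_{j=0}^\infty\sum_{m\in\mathbb{Z}^n}\lambda_{j,m}a_{j,m},\qquad (\ast)$$ where the $a_{j,m}$ are $(\sigma,p)$-atoms with $\operatorname{supp}a_{j,m}\subset dQ_{j,m}$ for $j\in\mathbb{N}_0$, $m\in\mathbb{Z}^n$, and $\lambda=\{\lambda_{j,m}\}\in b^s_{p,q}$, the convergence being in $L_p(\mathbb{R}^n)$. Furthermore, $\inf\|\lambda|b^s_{p,q}\|$, where the infimum is taken over all admissible representations $(\ast)$, is an equivalent quasi-norm on $\mathbf{B}^s_{p,q}(\mathbb{R}^n)$.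
   Context: Notation: $\mathbb{N}_0=\{0,1,2,\dots\}$. For $j\in\mathbb{N}_0$, $m\in\mathbb{Z}^n$, $Q_{j,m}$ is the cube in $\mathbb{R}^n$ with sides parallel to the axes, centre $2^{-j}m$ and side length $2^{-j+1}$; $dQ_{j,m}$ is the concentric cube with side length $d$ times that of $Q_{j,m}$. $[s]$ is the integer part of $s$. Sequence spaces: for $\lambda=\{\lambda_{j,m}\in\mathbb{C}: j\in\mathbb{N}_0,m\in\mathbb{Z}^n\}$, $\lambda\in b^s_{p,q}$ iff $$\|\lambda|b^s_{p,q}\|=\Big(\sum_{j=0}^\infty 2^{j(s-n/p)q}\Big(\sum_{m\in\mathbb{Z}^n}|\lambda_{j,m}|^p\Big)^{q/p}\Big)^{1/q}<\infty$$ (usual modification if $p=\infty$ and/or $q=\infty$). Smooth atoms: for $K\in\mathbb{N}_0$, $d>1$, a $K$-times continuously differentiable function $a:\mathbb{R}^n\to\mathbb{C}$ (continuous if $K=0$) is a $K$-atom located at $Q_{j,m}$ if $\operatorname{supp}a\subset dQ_{j,m}$ and $|D^\alpha a(x)|\le 2^{|\alpha|j}$ for $|\alpha|\le K$. Besov spaces: let $s>0$, $0<p,q\le\infty$, and fix $d>1$ and $K\in\mathbb{N}_0$ with $K\ge 1+[s]$. $\mathbf{B}^s_{p,q}(\mathbb{R}^n)$ is the set of all $f\in L_p(\mathbb{R}^n)$ which can be written $f=\sum_{j}\sum_m\lambda_{j,m}a_{j,m}$ (convergence in $L_p(\mathbb{R}^n)$) with $K$-atoms $a_{j,m}$ located at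 $Q_{j,m}$ and $\lambda\in b^s_{p,q}$; $\|f|\mathbf{B}^s_{p,q}(\mathbb{R}^n)\|$ is the infimum of $\|\lambda|b^s_{p,q}\|$ over all such representations. The spaces are independent of $d$ and $K$ up to equivalent quasi-norms. Write $\mathbf{B}^\sigma_p=\mathbf{B}^\sigma_{p,p}$. Non-smooth atoms: let $0<p\le\infty$, $\sigma>0$, $d>1$. $a\in\mathbf{B}^\sigma_p(\mathbb{R}^n)$ is a $(\sigma,p)$-atom (located at $Q_{j,m}$) if $\operatorname{supp}a\subset dQ_{j,m}$ and $\|a(2^{-j}\cdot)|\mathbf{B}^\sigma_p(\mathbb{R}^n)\|\le1$. *)

theory Defs
  imports "HOL-Analysis.Analysis" "HOL-Probability.Essential_Supremum"
begin

subsection \<open>Quasi-norms on sequences and functions\<close>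

text \<open>Exponents range over \<open>(0, \<infinity>]\<close> and are elements of \<^typ>\<open>ennreal\<close>.
  The next function is only used for finite \<open>r > 0\<close>.\<close>

definition epowr :: "ennreal \<Rightarrow> real \<Rightarrow> ennreal" where
  "epowr x r = (if x = \<infinity> then \<infinity> else ennreal (enn2real x powr r))"

definition ell_qnorm :: "ennreal \<Rightarrow> ('i \<Rightarrow> ennreal) \<Rightarrow> ennreal" where
  "ell_qnorm p x =
     (if p = \<infinity> then (SUP i. x i)
      else epowr (\<Sum>\<^sub>\<infinity>i. epowr (x i) (enn2real p)) (1 / enn2real p))"

definition Lp_qnorm :: "ennreal \<Rightarrow> ('a::euclidean_space \<Rightarrow> complex) \<Rightarrow> ennreal" where
  "Lp_qnorm p f =
     (if p = \<infinity> then esssup lebesgue (\<lambda>x. ennreal (norm (f x)))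
      else epowr (\<integral>\<^sup>+x. ennreal (norm (f x) powr enn2real p) \<partial>lebesgue) (1 / enn2real p))"

text \<open>Elements of \<open>L\<^sub>p\<close> are represented by functions; all notions below are invariant under
  changing functions in \<open>L\<^sub>p\<close> on null sets.\<close>

definition Lp_space :: "ennreal \<Rightarrow> ('a::euclidean_space \<Rightarrow> complex) set" where
  "Lp_space p = {f. f \<in> borel_measurable lebesgue \<and> Lp_qnorm p f < \<infinity>}"

text \<open>The sequence space norm \<open>(\<Sum>j. 2\<^bsup>j(s-n/p)q\<^esup> (\<Sum>m. |\<lambda>\<^sub>j\<^sub>,\<^sub>m|\<^sup>p)\<^bsup>q/p\<^esup>)\<^bsup>1/q\<^esup>\<close>,
  with suprema for infinite exponents. The quotient \<open>n/p\<close> is formed in \<^typ>\<open>ennreal\<close>, so it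
  is \<open>0\<close> for \<open>p = \<infinity>\<close>.\<close>

definition b_qnorm ::
  "real \<Rightarrow> ennreal \<Rightarrow> ennreal \<Rightarrow> (nat \<Rightarrow> int ^ 'n \<Rightarrow> complex) \<Rightarrow> ennreal" where
  "b_qnorm s p q lam =
     ell_qnorm q (\<lambda>j. ennreal (2 powr (real j * (s - enn2real (of_nat CARD('n) / p)))) *
                      ell_qnorm p (\<lambda>m. ennreal (norm (lam j m))))"

subsection \<open>Cubes and smooth atoms\<close>

text \<open>\<open>dQ\<^sub>j\<^sub>,\<^sub>m\<close>: the centre is \<open>2\<^bsup>-j\<^esup>m\<close> and half the side length is \<open>d 2\<^bsup>-j\<^esup>\<close>.\<close>

definition dcube :: "real \<Rightarrow> nat \<Rightarrow> int ^ 'n \<Rightarrow> (real ^ 'n) set" where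
  "dcube d j m = {x. \<forall>i. \<bar>x $ i - of_int (m $ i) / 2 ^ j\<bar> \<le> d / 2 ^ j}"

definition pderiv_at :: "'n \<Rightarrow> (real ^ 'n \<Rightarrow> complex) \<Rightarrow> real ^ 'n \<Rightarrow> complex" where
  "pderiv_at i f x = frechet_derivative f (at x) (axis i 1)"

text \<open>For \<open>f\<close> of class \<open>C\<^sup>K\<close> partial derivatives of order up to \<open>K\<close> commute, so the
  \<open>Dlist is f\<close> with \<open>length is \<le> K\<close> are exactly the \<open>D\<^sup>\<alpha> f\<close> with \<open>|\<alpha>| = length is\<close>:
  the component \<open>\<alpha>\<^sub>i\<close> is the number of occurrences of \<open>i\<close> in the list.\<close>

definition Dlist :: "'n list \<Rightarrow> (real ^ 'n \<Rightarrow> complex) \<Rightarrow> real ^ 'n \<Rightarrow> complex" where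
  "Dlist is f = foldr pderiv_at is f"

primrec C_k :: "nat \<Rightarrow> (real ^ 'n \<Rightarrow> complex) \<Rightarrow> bool" where
  "C_k 0 f \<longleftrightarrow> continuous_on UNIV f"
| "C_k (Suc k) f \<longleftrightarrow> f differentiable_on UNIV \<and> (\<forall>i. C_k k (pderiv_at i f))"

definition smooth_atom ::
  "nat \<Rightarrow> real \<Rightarrow> nat \<Rightarrow> int ^ 'n \<Rightarrow> (real ^ 'n \<Rightarrow> complex) \<Rightarrow> bool" where
  "smooth_atom K d j m a \<longleftrightarrow>
     C_k K a \<and> closure {x. a x \<noteq> 0} \<subseteq> dcube d j m \<and>
     (\<forall>is x. length is \<le> K \<longrightarrow> norm (Dlist is a x) \<le> 2 ^ (length is * j))"

subsection \<open>Atomic representations and Besov spaces\<close>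

text \<open>Convergence of \<open>\<Sum>j. \<Sum>m. u\<^sub>j\<^sub>,\<^sub>m\<close> to \<open>f\<close> in \<open>L\<^sub>p\<close>. For fixed \<open>j\<close> the supports of the
  terms \<open>u\<^sub>j\<^sub>,\<^sub>m\<close> are locally finite, so the inner sum is a pointwise sum which is finite
  (almost) everywhere; the outer sum converges in \<open>L\<^sub>p\<close>. If \<open>p < \<infinity>\<close> and the
  coefficients lie in \<open>b\<^sup>s\<^sub>p\<^sub>,\<^sub>q\<close> with \<open>s > 0\<close>, the inner sum converges unconditionally in
  \<open>L\<^sub>p\<close> as well, to the same limit; for \<open>p = \<infinity>\<close> norm convergence of the inner sum
  would exclude, e.g., constant functions.\<close>

definition Lp_sums ::
  "ennreal \<Rightarrow> (nat \<Rightarrow> int ^ 'n \<Rightarrow> real ^ 'n \<Rightarrow> complex) \<Rightarrow> (real ^ 'n \<Rightarrow> complex) \<Rightarrow> bool" where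
  "Lp_sums p u f \<longleftrightarrow>
     (\<lambda>J. Lp_qnorm p (\<lambda>x. f x - (\<Sum>j<J. \<Sum>\<^sub>\<infinity>m. u j m x))) \<longlonglongrightarrow> 0"

text \<open>\<open>A j m a\<close> states that \<open>a\<close> is an atom of the kind considered, located at \<open>Q\<^sub>j\<^sub>,\<^sub>m\<close>.\<close>

definition atomic_rep ::
  "real \<Rightarrow> ennreal \<Rightarrow> ennreal \<Rightarrow> (nat \<Rightarrow> int ^ 'n \<Rightarrow> (real ^ 'n \<Rightarrow> complex) \<Rightarrow> bool) \<Rightarrow>
   (real ^ 'n \<Rightarrow> complex) \<Rightarrow> (nat \<Rightarrow> int ^ 'n \<Rightarrow> complex) \<Rightarrow>
   (nat \<Rightarrow> int ^ 'n \<Rightarrow> real ^ 'n \<Rightarrow> complex) \<Rightarrow> bool" where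
  "atomic_rep s p q A f lam a \<longleftrightarrow>
     b_qnorm s p q lam < \<infinity> \<and> (\<forall>j m. A j m (a j m)) \<and>
     Lp_sums p (\<lambda>j m x. lam j m * a j m x) f"

definition atomic_qnorm ::
  "real \<Rightarrow> ennreal \<Rightarrow> ennreal \<Rightarrow> (nat \<Rightarrow> int ^ 'n \<Rightarrow> (real ^ 'n \<Rightarrow> complex) \<Rightarrow> bool) \<Rightarrow>
   (real ^ 'n \<Rightarrow> complex) \<Rightarrow> ennreal" where
  "atomic_qnorm s p q A f = Inf {b_qnorm s p q lam | lam. \<exists>a. atomic_rep s p q A f lam a}"

definition besov_space ::
  "nat \<Rightarrow> real \<Rightarrow> real \<Rightarrow> ennreal \<Rightarrow> ennreal \<Rightarrow> (real ^ 'n \<Rightarrow> complex) set" where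
  "besov_space K d s p q =
     {f \<in> Lp_space p. \<exists>lam a. atomic_rep s p q (smooth_atom K d) f lam a}"

definition besov_qnorm ::
  "nat \<Rightarrow> real \<Rightarrow> real \<Rightarrow> ennreal \<Rightarrow> ennreal \<Rightarrow> (real ^ 'n \<Rightarrow> complex) \<Rightarrow> ennreal" where
  "besov_qnorm K d s p q f = atomic_qnorm s p q (smooth_atom K d) f"

subsection \<open>Non-smooth atoms\<close>

text \<open>The support of an element of \<open>L\<^sub>p\<close>: the complement of the largest open set on which it
  vanishes almost everywhere.\<close>

definition ess_supp :: "('a::euclidean_space \<Rightarrow> complex) \<Rightarrow> 'a set" where
  "ess_supp f = - \<Union>{U. open U \<and> (AE x in lebesgue. x \<in> U \<longrightarrow> f x = 0)}"

text \<open>\<open>K\<close> and \<open>d'\<close> are the parameters used to define the Besov space of smoothness \<open>\<sigma>\<close>.\<close>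

definition nonsmooth_atom ::
  "nat \<Rightarrow> real \<Rightarrow> real \<Rightarrow> ennreal \<Rightarrow> real \<Rightarrow> nat \<Rightarrow> int ^ 'n \<Rightarrow> (real ^ 'n \<Rightarrow> complex) \<Rightarrow> bool" where
  "nonsmooth_atom K d' \<sigma> p d j m a \<longleftrightarrow>
     a \<in> besov_space K d' \<sigma> p p \<and> ess_supp a \<subseteq> dcube d j m \<and>
     besov_qnorm K d' \<sigma> p p (\<lambda>x. a (x /\<^sub>R 2 ^ j)) \<le> 1"

subsection \<open>Equivalent quasi-norms\<close>

definition quasi_norm_on ::
  "('a::euclidean_space \<Rightarrow> complex) set \<Rightarrow> (('a \<Rightarrow> complex) \<Rightarrow> ennreal) \<Rightarrow> bool" where
  "quasi_norm_on V N \<longleftrightarrow>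
     (\<forall>f\<in>V. N f < \<infinity>) \<and>
     (\<forall>f\<in>V. N f = 0 \<longleftrightarrow> (AE x in lebesgue. f x = 0)) \<and>
     (\<forall>f\<in>V. \<forall>c. N (\<lambda>x. c * f x) = ennreal (norm c) * N f) \<and>
     (\<exists>C::real. \<forall>f\<in>V. \<forall>g\<in>V. N (\<lambda>x. f x + g x) \<le> ennreal C * (N f + N g))"

definition equivalent_on ::
  "'b set \<Rightarrow> ('b \<Rightarrow> ennreal) \<Rightarrow> ('b \<Rightarrow> ennreal) \<Rightarrow> bool" where
  "equivalent_on V N N' \<longleftrightarrow>
     (\<exists>c C::real. 0 < c \<and> 0 < C \<and>
        (\<forall>f\<in>V. ennreal c * N f \<le> N' f \<and> N' f \<le> ennreal C * N f))"

end

theory Submission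
  imports Defs
begin

text \<open>
  Write \<open>a = n/p\<close>. The theorem compares two families of building blocks, and the comparison goes
  through a third one. A \<^emph>\<open>molecule\<close> of order \<open>\<sigma>\<close> at \<open>Q\<^sub>j\<^sub>,\<^sub>m\<close> is a function which is almost everywhere
  the sum of \<open>\<eta>\<^sub>r\<^sub>,\<^sub>l b\<^sub>r\<^sub>,\<^sub>l\<close>, where \<open>b\<^sub>r\<^sub>,\<^sub>l\<close> is a smooth atom at \<open>Q\<^sub>r\<^sub>,\<^sub>l\<close>, only cubes near \<open>Q\<^sub>j\<^sub>,\<^sub>m\<close> with \<open>r \<ge> j\<close>
  occur, and the \<open>\<ell>\<^sub>p\<close> norm of \<open>(\<eta>\<^sub>r\<^sub>,\<^sub>l)\<^sub>l\<close> is at most a constant times \<open>2\<^bsup>-(r-j)(\<sigma>-a)\<^esup>\<close>.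

  The central step (\<open>molecular_synthesis\<close>) is that \<open>f = \<Sum> \<lambda>\<^sub>j\<^sub>,\<^sub>m u\<^sub>j\<^sub>,\<^sub>m\<close> with molecules \<open>u\<^sub>j\<^sub>,\<^sub>m\<close> of order
  \<open>\<sigma> > s\<close> and \<open>\<lambda> \<in> b\<^sup>s\<^sub>p\<^sub>,\<^sub>q\<close> can be rewritten with smooth atoms: expand every molecule and collect
  what sits at the same cube \<open>Q\<^sub>r\<^sub>,\<^sub>l\<close>. The new coefficient is \<open>\<Sum>\<^sub>j\<^sub>,\<^sub>m |\<lambda>\<^sub>j\<^sub>,\<^sub>m| |\<eta>\<^sup>j\<^sup>,\<^sup>m\<^sub>r\<^sub>,\<^sub>l|\<close>. For each \<open>j\<close> only
  boundedly many \<open>m\<close> contribute, so on the scale \<open>2\<^bsup>r(s-a)\<^esup>\<close> passing from level \<open>j\<close> to level \<open>r\<close> costs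
  the factor \<open>2\<^bsup>-(r-j)(\<sigma>-s)\<^esup>\<close>, and convolution with a geometric sequence is bounded on \<open>\<ell>\<^sub>q\<close>
  (\<open>synthesis_bound\<close>).

  Both kinds of atoms are molecules. For a \<open>(\<sigma>,p)\<close>-atom one takes a nearly optimal smooth
  representation of its dilate and multiplies it by a cutoff function, which does not change the
  atom but discards all distant cubes (\<open>nonsmooth_atom_molecule\<close>). A smooth \<open>M\<close>-atom is a molecule
  of order \<open>M\<close> made of atoms which are as smooth as desired and supported in the cubes \<open>Q\<^sub>r\<^sub>,\<^sub>l\<close>
  themselves (\<open>smooth_atom_decomposition\<close>): with a mollifying operator \<open>T\<close>, the smoothing operator
  \<open>I - (I - T)\<^sup>M\<close> at scale \<open>2\<^bsup>-k\<^esup>\<close> approximates a \<open>C\<^sup>M\<close> function up to \<open>O(2\<^bsup>-kM\<^esup>)\<close>, and the differences of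
  consecutive approximations are cut into pieces by a partition of unity. As \<open>K\<^sub>s > s\<close> and
  \<open>K\<^sub>\<sigma> > \<sigma> > s\<close>, this makes the parameters \<open>K\<close> and \<open>d\<close> of smooth representations interchangeable.
  Finally, a smooth \<open>K\<^sub>\<sigma>\<close>-atom supported in \<open>Q\<^sub>j\<^sub>,\<^sub>m\<close> is a \<open>(\<sigma>,p)\<close>-atom, being its own representation
  (\<open>smooth_atom_imp_nonsmooth_atom\<close>). Hence each kind of representation can be turned into the
  other with control of the coefficients, which gives the characterization and the equivalence.

  Two devices keep the exponents \<open>p, q \<in> (0,\<infinity>]\<close> uniform. Triangle inequalities are replaced by
  the bound of a sum by the supremum of its geometrically weighted terms (\<open>Lqnorm_suminf\<close>), which
  holds for every exponent. And since \<open>s > 0\<close>, the tails of a series of atoms have a majorant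
  tending to \<open>0\<close> in \<open>L\<^sub>p\<close>, so that convergence in \<open>L\<^sub>p\<close> means absolute convergence almost everywhere
  (\<open>Lp_sums_iff_AE\<close>); all rearrangements are then made pointwise.

  Of the quasi-norm axioms, the quasi-triangle inequality and definiteness are inherited from the
  smooth atomic quasi-norm by equivalence; homogeneity holds with constant \<open>1\<close> and is proved
  directly on representations.
\<close>

section \<open>Functions with bounded partial derivatives\<close>

text \<open>The recursion of \<open>C_k\<close> takes derivatives from the inside, so that \<open>Ck_le_Suc\<close> below permits
inductions over the order which carry the bound along.\<close>

definition Ck_le :: "nat \<Rightarrow> real \<Rightarrow> (real ^ 'n \<Rightarrow> complex) \<Rightarrow> bool" where
  "Ck_le k B f \<longleftrightarrow> C_k k f \<and> (\<forall>is x. length is \<le> k \<longrightarrow> norm (Dlist is f x) \<le> B)"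

lemma Dlist_Nil [simp]: "Dlist [] f = f"
  by (simp add: Dlist_def)

lemma Dlist_Cons [simp]: "Dlist (i # is) f = pderiv_at i (Dlist is f)"
  by (simp add: Dlist_def)

lemma Dlist_append: "Dlist (xs @ ys) f = Dlist xs (Dlist ys f)"
  by (simp add: Dlist_def)

lemma Ck_le_0: "Ck_le 0 B f \<longleftrightarrow> continuous_on UNIV f \<and> (\<forall>x. norm (f x) \<le> B)"
  by (auto simp: Ck_le_def)

lemma Ck_le_Suc:
  "Ck_le (Suc k) B f \<longleftrightarrow>
     f differentiable_on UNIV \<and> (\<forall>x. norm (f x) \<le> B) \<and> (\<forall>i. Ck_le k B (pderiv_at i f))"
proof
  assume f: "Ck_le (Suc k) B f"
  have "norm (f x) \<le> B" for x
    using f unfolding Ck_le_def by (metis Dlist_Nil le0 list.size(3))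
  moreover have "norm (Dlist is (pderiv_at i f) x) \<le> B" if "length is \<le> k" for i "is" x
    using f that unfolding Ck_le_def
    by (metis Dlist_append Dlist_Cons Dlist_Nil length_append_singleton not_less_eq_eq)
  ultimately show "f differentiable_on UNIV \<and> (\<forall>x. norm (f x) \<le> B) \<and>
      (\<forall>i. Ck_le k B (pderiv_at i f))"
    using f by (auto simp: Ck_le_def)
next
  assume f: "f differentiable_on UNIV \<and> (\<forall>x. norm (f x) \<le> B) \<and> (\<forall>i. Ck_le k B (pderiv_at i f))"
  have "norm (Dlist is f x) \<le> B" if "length is \<le> Suc k" for "is" x
  proof (cases "is" rule: rev_cases)
    case Nil then show ?thesis using f by simp
  next
    case (snoc js i) then show ?thesis using f that by (simp add: Dlist_append Ck_le_def)
  qed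
  then show "Ck_le (Suc k) B f" using f by (auto simp: Ck_le_def)
qed

lemma C_k_SucD: "C_k (Suc k) f \<Longrightarrow> C_k k f"
  by (induction k arbitrary: f) (auto intro: differentiable_imp_continuous_on)

lemma C_k_mono: "C_k k f \<Longrightarrow> l \<le> k \<Longrightarrow> C_k l f"
  by (induction k) (auto simp: le_Suc_eq simp del: C_k.simps dest: C_k_SucD)

lemma C_k_continuous: "C_k k f \<Longrightarrow> continuous_on UNIV f"
  using C_k_mono[of k f 0] by simp

lemma Ck_le_mono: "Ck_le k B f \<Longrightarrow> l \<le> k \<Longrightarrow> B \<le> B' \<Longrightarrow> Ck_le l B' f"
  unfolding Ck_le_def by (meson C_k_mono order_trans)

lemma Ck_le_bound: "Ck_le k B f \<Longrightarrow> norm (f x) \<le> B"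
  unfolding Ck_le_def by (metis Dlist_Nil le0 list.size(3))

lemma Ck_le_nonneg: "Ck_le k B f \<Longrightarrow> 0 \<le> B"
  using Ck_le_bound[of k B f] by (meson norm_ge_zero order_trans)

lemma Ck_le_continuous: "Ck_le k B f \<Longrightarrow> continuous_on UNIV f"
  unfolding Ck_le_def using C_k_continuous by blast

lemma C_k_Dlist: "C_k (k + length is) f \<Longrightarrow> C_k k (Dlist is f)"
proof (induction "is" arbitrary: f rule: rev_induct)
  case Nil then show ?case by simp
next
  case (snoc i "is") then show ?case by (simp add: Dlist_append)
qed

lemma Ck_le_Dlist: "Ck_le (k + length is) B f \<Longrightarrow> Ck_le k B (Dlist is f)"
  unfolding Ck_le_def by (auto simp: C_k_Dlist Dlist_append[symmetric])

lemma pderiv_at_eqI: "(f has_derivative f') (at x) \<Longrightarrow> pderiv_at i f x = f' (axis i 1)"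
  unfolding pderiv_at_def by (simp add: frechet_derivative_at[symmetric])

lemma has_frechet: "f differentiable_on UNIV \<Longrightarrow> (f has_derivative frechet_derivative f (at x)) (at x)"
  by (simp add: differentiable_on_def frechet_derivative_works)

lemma pderiv_add:
  assumes "f differentiable_on UNIV" "g differentiable_on UNIV"
  shows "pderiv_at i (\<lambda>x. f x + g x) = (\<lambda>x. pderiv_at i f x + pderiv_at i g x)"
  by (rule ext, subst pderiv_at_eqI[OF has_derivative_add[OF assms[THEN has_frechet]]])
     (simp add: pderiv_at_def)

lemma pderiv_mult:
  assumes "f differentiable_on UNIV" "g differentiable_on UNIV"
  shows "pderiv_at i (\<lambda>x. f x * g x) = (\<lambda>x. f x * pderiv_at i g x + pderiv_at i f x * g x)"
  by (rule ext, subst pderiv_at_eqI[OF has_derivative_mult[OF assms[THEN has_frechet]]])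
     (simp add: pderiv_at_def)

lemma pderiv_const: "pderiv_at i (\<lambda>x. c) = (\<lambda>x. 0)"
  by (rule ext, subst pderiv_at_eqI[OF has_derivative_const]) simp

lemma Ck_le_const: "norm c \<le> B \<Longrightarrow> Ck_le k B (\<lambda>x. c)"
proof (induction k arbitrary: c)
  case 0 then show ?case by (simp add: Ck_le_0)
next
  case (Suc k)
  have "0 \<le> B" using Suc.prems norm_ge_zero order_trans by blast
  then show ?case using Suc by (simp add: Ck_le_Suc pderiv_const)
qed

lemma Ck_le_add: "Ck_le k A f \<Longrightarrow> Ck_le k B g \<Longrightarrow> Ck_le k (A + B) (\<lambda>x. f x + g x)"
proof (induction k arbitrary: f g)
  case 0 then show ?case by (auto simp: Ck_le_0 intro!: continuous_intros norm_triangle_mono)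
next
  case (Suc k) then show ?case
    by (auto simp: Ck_le_Suc pderiv_add intro!: differentiable_on_add norm_triangle_mono)
qed

text \<open>The factor \<open>2\<^sup>k\<close> counts the terms of the Leibniz rule.\<close>

lemma Ck_le_mult: "Ck_le k A f \<Longrightarrow> Ck_le k B g \<Longrightarrow> Ck_le k (2 ^ k * A * B) (\<lambda>x. f x * g x)"
proof (induction k arbitrary: f g)
  case 0 then show ?case
    by (auto simp: Ck_le_0 norm_mult intro!: continuous_intros mult_mono' )
next
  case (Suc k)
  have 0: "0 \<le> A" "0 \<le> B" using Suc.prems Ck_le_nonneg by blast+
  have f: "Ck_le k A f" "Ck_le k B g" using Suc.prems by (auto elim: Ck_le_mono)
  have d: "f differentiable_on UNIV" "g differentiable_on UNIV" using Suc.prems by (auto simp: Ck_le_Suc)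
  have "Ck_le k (2 ^ k * A * B + 2 ^ k * A * B) (\<lambda>x. f x * pderiv_at i g x + pderiv_at i f x * g x)" for i
    using Suc.prems f by (intro Ck_le_add Suc.IH) (auto simp: Ck_le_Suc)
  then have "Ck_le k (2 ^ Suc k * A * B) (pderiv_at i (\<lambda>x. f x * g x))" for i
    by (simp add: pderiv_mult[OF d] algebra_simps)
  moreover have "norm (f x * g x) \<le> 2 ^ Suc k * A * B" for x
  proof -
    have "norm (f x * g x) \<le> 1 * (A * B)"
      using Suc.prems 0 by (auto simp: norm_mult intro!: mult_mono Ck_le_bound)
    also have "\<dots> \<le> 2 ^ Suc k * (A * B)" by (intro mult_right_mono) (use 0 in \<open>auto simp del: power_Suc\<close>)
    finally show ?thesis by (simp add: mult.assoc)
  qed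
  ultimately show ?case using d by (simp add: Ck_le_Suc differentiable_on_mult)
qed

lemma Ck_le_cmult: "Ck_le k B f \<Longrightarrow> Ck_le k (norm c * B) (\<lambda>x. c * f x)"
proof (induction k arbitrary: f)
  case 0 then show ?case
    by (auto simp: Ck_le_0 norm_mult intro!: continuous_intros mult_left_mono)
next
  case (Suc k)
  then have "f differentiable_on UNIV" by (simp add: Ck_le_Suc)
  then have "pderiv_at i (\<lambda>x. c * f x) = (\<lambda>x. c * pderiv_at i f x)" for i
    by (simp add: pderiv_mult pderiv_const)
  then show ?case using Suc
    by (auto simp: Ck_le_Suc norm_mult intro!: mult_left_mono differentiable_on_mult)
qed

lemma Ck_le_diff: "Ck_le k A f \<Longrightarrow> Ck_le k B g \<Longrightarrow> Ck_le k (A + B) (\<lambda>x. f x - g x)"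
  using Ck_le_add[of k A f B "\<lambda>x. - g x"] Ck_le_cmult[of k B g "-1"] by simp

lemma Ck_le_sum:
  assumes "finite I" "\<And>i. i \<in> I \<Longrightarrow> Ck_le k (B i) (f i)"
  shows "Ck_le k (\<Sum>i\<in>I. B i) (\<lambda>x. \<Sum>i\<in>I. f i x)"
  using assms by (induction I) (auto intro: Ck_le_add Ck_le_const)

lemma differentiable_dilate:
  fixes f :: "real ^ 'n \<Rightarrow> complex"
  assumes "f differentiable_on UNIV"
  shows "(\<lambda>x. f (c *\<^sub>R x)) differentiable_on UNIV"
    and "pderiv_at i (\<lambda>x. f (c *\<^sub>R x)) = (\<lambda>x. of_real c * pderiv_at i f (c *\<^sub>R x))"
proof -
  have *: "((\<lambda>x. f (c *\<^sub>R x)) has_derivative (\<lambda>v. frechet_derivative f (at (c *\<^sub>R x)) (c *\<^sub>R v))) (at x)" for x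
    by (rule has_derivative_compose[OF _ has_frechet[OF assms]]) (auto intro!: derivative_eq_intros)
  then show "(\<lambda>x. f (c *\<^sub>R x)) differentiable_on UNIV"
    by (meson differentiableI differentiable_at_imp_differentiable_on)
  have "linear (frechet_derivative f (at y))" for y
    using has_frechet[OF assms] has_derivative_linear by blast
  then show "pderiv_at i (\<lambda>x. f (c *\<^sub>R x)) = (\<lambda>x. of_real c * pderiv_at i f (c *\<^sub>R x))"
    by (auto simp: pderiv_at_eqI[OF *] pderiv_at_def linear_scale scaleR_conv_of_real[where 'a=complex])
qed

lemma C_k_cmult: "C_k k f \<Longrightarrow> C_k k (\<lambda>x. c * f x)"
proof (induction k arbitrary: f)
  case 0 then show ?case by (auto intro!: continuous_intros)
next
  case (Suc k) then show ?case
    by (auto simp: pderiv_mult pderiv_const intro!: differentiable_on_mult)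
qed

lemma C_k_dilate: "C_k k f \<Longrightarrow> C_k k (\<lambda>x. f (c *\<^sub>R x))"
proof (induction k arbitrary: f)
  case 0 then show ?case
    by (auto intro!: continuous_on_compose2[of UNIV f] continuous_intros)
next
  case (Suc k) then show ?case
    by (auto simp: differentiable_dilate intro!: C_k_cmult)
qed

lemma Dlist_cmult:
  "C_k k f \<Longrightarrow> length is \<le> k \<Longrightarrow> Dlist is (\<lambda>x. c * f x) = (\<lambda>x. c * Dlist is f x)"
proof (induction "is")
  case (Cons i "is")
  have "C_k 1 (Dlist is f)"
    by (rule C_k_Dlist[OF C_k_mono]) (use Cons.prems in auto)
  then show ?case using Cons by (simp add: pderiv_mult pderiv_const)
qed simp

lemma Dlist_add:
  "C_k k f \<Longrightarrow> C_k k g \<Longrightarrow> length is \<le> k \<Longrightarrow>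
    Dlist is (\<lambda>x. f x + g x) = (\<lambda>x. Dlist is f x + Dlist is g x)"
proof (induction "is")
  case (Cons i "is")
  have "C_k 1 (Dlist is f)" "C_k 1 (Dlist is g)"
    by (rule C_k_Dlist[OF C_k_mono]; use Cons.prems in simp)+
  then show ?case using Cons by (simp add: pderiv_add)
qed simp

lemma Dlist_diff:
  "C_k k f \<Longrightarrow> C_k k g \<Longrightarrow> length is \<le> k \<Longrightarrow>
    Dlist is (\<lambda>x. f x - g x) = (\<lambda>x. Dlist is f x - Dlist is g x)"
  using Dlist_add[of k f "\<lambda>x. -1 * g x" "is"] C_k_cmult[of k g "-1"] Dlist_cmult[of k g "is" "-1"] by simp

lemma Dlist_dilate:
  "C_k k f \<Longrightarrow> length is \<le> k \<Longrightarrow>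
    Dlist is (\<lambda>x. f (c *\<^sub>R x)) = (\<lambda>x. of_real c ^ length is * Dlist is f (c *\<^sub>R x))"
proof (induction "is")
  case (Cons i "is")
  have "C_k 1 (Dlist is f)"
    by (rule C_k_Dlist[OF C_k_mono]) (use Cons.prems in auto)
  then have d: "Dlist is f differentiable_on UNIV" by simp
  have "Dlist (i # is) (\<lambda>x. f (c *\<^sub>R x)) = pderiv_at i (\<lambda>x. of_real c ^ length is * Dlist is f (c *\<^sub>R x))"
    using Cons by simp
  also have "\<dots> = (\<lambda>x. of_real c ^ length is * (of_real c * pderiv_at i (Dlist is f) (c *\<^sub>R x)))"
    using d by (simp add: pderiv_mult pderiv_const differentiable_dilate)
  finally show ?case by (simp add: mult.assoc mult.left_commute)
qed simp

lemma Ck_le_dilate: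
  assumes "Ck_le k B f" "\<bar>c\<bar> \<le> 1"
  shows "Ck_le k B (\<lambda>x. f (c *\<^sub>R x))"
  unfolding Ck_le_def
proof (intro conjI allI impI)
  show "C_k k (\<lambda>x. f (c *\<^sub>R x))" using assms by (simp add: Ck_le_def C_k_dilate)
  fix "is" x assume l: "length (is :: 'a list) \<le> k"
  have "norm (Dlist is (\<lambda>x. f (c *\<^sub>R x)) x) = \<bar>c\<bar> ^ length is * norm (Dlist is f (c *\<^sub>R x))"
    using assms l by (subst Dlist_dilate[where k=k]) (auto simp: Ck_le_def norm_mult norm_power)
  also have "\<dots> \<le> 1 * B"
    using assms l by (intro mult_mono) (auto simp: Ck_le_def power_le_one)
  finally show "norm (Dlist is (\<lambda>x. f (c *\<^sub>R x)) x) \<le> B" by simp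
qed

lemma Ck_le_dilate_ge:
  assumes "Ck_le k B f" "1 \<le> c"
  shows "Ck_le k (c ^ k * B) (\<lambda>x. f (c *\<^sub>R x))"
  unfolding Ck_le_def
proof (intro conjI allI impI)
  show "C_k k (\<lambda>x. f (c *\<^sub>R x))" using assms by (simp add: Ck_le_def C_k_dilate)
  fix "is" x assume l: "length (is :: 'a list) \<le> k"
  have "norm (Dlist is (\<lambda>x. f (c *\<^sub>R x)) x) = c ^ length is * norm (Dlist is f (c *\<^sub>R x))"
    using assms l by (subst Dlist_dilate[where k=k]) (auto simp: Ck_le_def norm_mult norm_power)
  also have "\<dots> \<le> c ^ k * B"
    using assms l by (intro mult_mono) (auto simp: Ck_le_def power_increasing)
  finally show "norm (Dlist is (\<lambda>x. f (c *\<^sub>R x)) x) \<le> c ^ k * B" .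
qed

text \<open>The bounds \<open>2\<^bsup>|\<alpha>|j\<^esup>\<close> are those of a function with all derivatives bounded by \<open>1\<close>, dilated by \<open>2\<^sup>j\<close>.
Hence everything about atoms can be proved at level \<open>0\<close> and dilated.\<close>

lemma smooth_atom_iff_Ck_le:
  "smooth_atom K d j m a \<longleftrightarrow>
     Ck_le K 1 (\<lambda>x. a (x /\<^sub>R 2 ^ j)) \<and> (\<forall>x. a x \<noteq> 0 \<longrightarrow> x \<in> dcube d j m)"
proof -
  have cl: "closed (dcube d j m)" for d j and m :: "int ^ 'n"
  proof -
    have "dcube d j m = (\<Inter>i. {x. \<bar>x $ i - of_int (m $ i) / 2 ^ j\<bar> \<le> d / 2 ^ j})"
      by (auto simp: dcube_def)
    then show ?thesis by (auto intro!: closed_INT closed_Collect_le continuous_intros)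
  qed
  have supp: "closure {x. a x \<noteq> 0} \<subseteq> dcube d j m \<longleftrightarrow> (\<forall>x. a x \<noteq> 0 \<longrightarrow> x \<in> dcube d j m)"
  proof
    assume "closure {x. a x \<noteq> 0} \<subseteq> dcube d j m"
    then have "{x. a x \<noteq> 0} \<subseteq> dcube d j m" by (rule order_trans[OF closure_subset])
    then show "\<forall>x. a x \<noteq> 0 \<longrightarrow> x \<in> dcube d j m" by auto
  qed (intro closure_minimal cl, auto)
  have C: "C_k K (\<lambda>x. a (x /\<^sub>R 2 ^ j)) \<longleftrightarrow> C_k K a"
  proof
    assume "C_k K (\<lambda>x. a (x /\<^sub>R 2 ^ j))"
    from C_k_dilate[OF this, of "2 ^ j"] show "C_k K a" by simp
  qed (use C_k_dilate[of K a "inverse (2 ^ j)"] in simp)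
  have D: "norm (Dlist is (\<lambda>x. a (x /\<^sub>R 2 ^ j)) x) = norm (Dlist is a (x /\<^sub>R 2 ^ j)) / 2 ^ (length is * j)"
    if "C_k K a" "length is \<le> K" for "is" x
    by (simp add: Dlist_dilate[OF that] norm_mult norm_power norm_inverse power_inverse
          power_mult[symmetric] divide_inverse mult.commute)
  show ?thesis
  proof
    assume A: "smooth_atom K d j m a"
    then show "Ck_le K 1 (\<lambda>x. a (x /\<^sub>R 2 ^ j)) \<and> (\<forall>x. a x \<noteq> 0 \<longrightarrow> x \<in> dcube d j m)"
      using supp by (auto simp: smooth_atom_def Ck_le_def C D)
  next
    assume A: "Ck_le K 1 (\<lambda>x. a (x /\<^sub>R 2 ^ j)) \<and> (\<forall>x. a x \<noteq> 0 \<longrightarrow> x \<in> dcube d j m)"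
    have "norm (Dlist is a x) \<le> 2 ^ (length is * j)" if "length is \<le> K" for "is" x
    proof -
      have "norm (Dlist is (\<lambda>x. a (x /\<^sub>R 2 ^ j)) (2 ^ j *\<^sub>R x)) \<le> 1"
        using A that by (simp add: Ck_le_def)
      then show ?thesis using A that by (subst (asm) D) (auto simp: C Ck_le_def)
    qed
    then show "smooth_atom K d j m a"
      using A supp by (auto simp: smooth_atom_def Ck_le_def C)
  qed
qed

section \<open>Mollification\<close>

text \<open>The square of the positive part is just smooth enough to have a Lipschitz gradient; this makes the
first-order Taylor remainder quadratic and lets convolutions be differentiated by a direct
estimate. Higher smoothness is obtained by repeating the convolution.\<close>

definition bump :: "real ^ 'n \<Rightarrow> real" where
  "bump x = (max 0 (1 - x \<bullet> x))\<^sup>2"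

definition bump_mass :: "'n::finite itself \<Rightarrow> real" where
  "bump_mass _ = (\<integral>x. bump (x :: real ^ 'n) \<partial>lborel)"

definition mollifier :: "real ^ 'n \<Rightarrow> real" where
  "mollifier x = bump x / bump_mass TYPE('n)"

definition mollifier_grad :: "real ^ 'n \<Rightarrow> real ^ 'n \<Rightarrow> real" where
  "mollifier_grad v x = -4 * max 0 (1 - x \<bullet> x) * (x \<bullet> v) / bump_mass TYPE('n)"

text \<open>The kernel is evaluated at \<open>x - y\<close>, so that derivatives fall on the kernel; \<open>convolution_flip\<close> moves them
to the function.\<close>

definition convolution :: "(real ^ 'n \<Rightarrow> real) \<Rightarrow> (real ^ 'n \<Rightarrow> complex) \<Rightarrow> real ^ 'n \<Rightarrow> complex" where
  "convolution g f x = (\<integral>y. g (x - y) *\<^sub>R f y \<partial>lborel)"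

definition borel_le :: "real \<Rightarrow> (real ^ 'n \<Rightarrow> complex) \<Rightarrow> bool" where
  "borel_le B f \<longleftrightarrow> f \<in> borel_measurable borel \<and> (\<forall>x. norm (f x) \<le> B)"

definition kernel_le :: "real \<Rightarrow> real \<Rightarrow> (real ^ 'n \<Rightarrow> real) \<Rightarrow> bool" where
  "kernel_le r G g \<longleftrightarrow> g \<in> borel_measurable borel \<and> (\<forall>x. \<bar>g x\<bar> \<le> G) \<and> (\<forall>x. norm x > r \<longrightarrow> g x = 0)"

lemma borel_le_nonneg: "borel_le B f \<Longrightarrow> 0 \<le> B"
  unfolding borel_le_def by (meson norm_ge_zero order_trans)

lemma kernel_le_nonneg: "kernel_le r G g \<Longrightarrow> 0 \<le> G"
  unfolding kernel_le_def by (meson abs_ge_zero order_trans)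

lemma Ck_le_borel_le: "Ck_le k B f \<Longrightarrow> borel_le B f"
  unfolding borel_le_def using Ck_le_bound Ck_le_continuous by (blast intro: borel_measurable_continuous_onI)

lemma convolution_measurable:
  assumes "kernel_le r G g" "borel_le B f"
  shows "(\<lambda>y. g (x - y) *\<^sub>R f y) \<in> borel_measurable borel"
proof -
  have [measurable]: "g \<in> borel_measurable borel" "f \<in> borel_measurable borel"
    using assms by (auto simp: kernel_le_def borel_le_def)
  show ?thesis by measurable
qed

lemma convolution_bound_integrand:
  assumes "kernel_le r G g" "borel_le B f"
  shows "norm (g (x - y) *\<^sub>R f y) \<le> G * B * indicator (cball x r) y"
  using assms borel_le_nonneg[OF assms(2)] kernel_le_nonneg[OF assms(1)]
  by (auto simp: kernel_le_def borel_le_def dist_norm indicator_def intro!: mult_mono)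

lemma integrable_cball_indicator: "integrable lborel (\<lambda>y. c * indicator (cball (x :: real ^ 'n) r) y :: real)"
proof -
  have "emeasure lborel (cball x r) < top"
    using emeasure_bounded_finite[OF bounded_cball, of x r] by (simp only: infinity_ennreal_def)
  then show ?thesis by (intro integrable_mult_right integrable_real_indicator) auto
qed

lemma convolution_integrable:
  assumes "kernel_le r G g" "borel_le B f"
  shows "integrable lborel (\<lambda>y. g (x - y) *\<^sub>R f y)"
proof (rule Bochner_Integration.integrable_bound[OF integrable_cball_indicator])
  show "AE y in lborel. norm (g (x - y) *\<^sub>R f y) \<le> norm (G * B * indicator (cball x r) y :: real)"
    by (intro AE_I2 order_trans[OF convolution_bound_integrand[OF assms]]) simp
qed (use convolution_measurable[OF assms] in simp)

lemma convolution_norm_le: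
  assumes "kernel_le r G g" "borel_le B f"
  shows "norm (convolution g f x) \<le> G * B * measure lborel (cball x r)"
proof -
  have "norm (convolution g f x) \<le> (\<integral>y. G * B * indicator (cball x r) y \<partial>lborel)"
    unfolding convolution_def
    by (rule order_trans[OF integral_norm_bound integral_mono])
       (intro integrable_norm convolution_integrable[OF assms] integrable_cball_indicator convolution_bound_integrand[OF assms])+
  then show ?thesis by simp
qed

lemma sets_lborel_cball: "cball (x :: real ^ 'n) r \<in> sets lborel"
  by simp

lemma measure_cball_translate: "measure lborel (cball (x :: real ^ 'n) r) = measure lborel (cball (0 :: real ^ 'n) r)"
proof -
  have "cball x r = (+) x ` cball 0 r" using cball_translation[of x 0 r] by (simp only: add_0_right)
  then have "measure lebesgue (cball x r) = measure lebesgue (cball (0 :: real ^ 'n) r)"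
    by (simp only: measure_translation)
  then show ?thesis by (simp only: measure_completion[OF sets_lborel_cball])
qed

lemma integral_reflect:
  fixes h :: "real ^ 'n \<Rightarrow> complex"
  assumes [measurable]: "h \<in> borel_measurable borel"
  shows "(\<integral>y. h (x - y) \<partial>lborel) = (\<integral>y. h y \<partial>lborel)"
proof -
  have "(\<integral>y. h y \<partial>lborel) = (\<integral>y. h y \<partial>(density (distr lborel borel (\<lambda>y. x + (-1) *\<^sub>R y)) (\<lambda>_. ennreal (\<bar>-1 :: real\<bar> ^ DIM(real ^ 'n)))))"
    by (subst lborel_affine[of "-1" x]) auto
  also have "\<dots> = (\<integral>y. h y \<partial>distr lborel borel (\<lambda>y. x - y))"
    by (simp add: density_1)
  also have "\<dots> = (\<integral>y. h (x - y) \<partial>lborel)"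
    by (rule integral_distr) auto
  finally show ?thesis by simp
qed

lemma convolution_flip:
  assumes "kernel_le r G g" "borel_le B f"
  shows "convolution g f x = (\<integral>y. g y *\<^sub>R f (x - y) \<partial>lborel)"
proof -
  have [measurable]: "g \<in> borel_measurable borel" "f \<in> borel_measurable borel"
    using assms by (auto simp: kernel_le_def borel_le_def)
  show ?thesis
    unfolding convolution_def by (subst integral_reflect[symmetric, where x=x]) auto
qed

lemma convolution_flip_integrable:
  assumes "kernel_le r G g" "borel_le B f"
  shows "integrable lborel (\<lambda>y. g y *\<^sub>R f (x - y))"
proof -
  have "borel_le B (\<lambda>y. f (x - y))"
    using assms(2) by (auto simp: borel_le_def intro: measurable_compose[rotated])
  moreover have "kernel_le r G (\<lambda>y. g (- y))"
    using assms(1) by (auto simp: kernel_le_def intro: measurable_compose[rotated])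
  ultimately show ?thesis using convolution_integrable[of r G "\<lambda>y. g (- y)" B "\<lambda>y. f (x - y)" 0] by simp
qed

lemma convolution_continuous:
  fixes f :: "real ^ 'n \<Rightarrow> complex"
  assumes g: "kernel_le r G g" and f: "borel_le B f" and c: "continuous_on UNIV f"
  shows "continuous_on UNIV (convolution g f)"
proof -
  have [measurable]: "g \<in> borel_measurable borel" "f \<in> borel_measurable borel"
    using g f by (auto simp: kernel_le_def borel_le_def)
  show ?thesis
    unfolding continuous_on_sequentially comp_def convolution_flip[OF g f]
  proof (intro allI ballI impI, elim conjE)
    fix u :: "nat \<Rightarrow> real ^ 'n" and x
    assume u: "u \<longlonglongrightarrow> x"
    show "(\<lambda>n. \<integral>y. g y *\<^sub>R f (u n - y) \<partial>lborel) \<longlonglongrightarrow> (\<integral>y. g y *\<^sub>R f (x - y) \<partial>lborel)"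
    proof (rule integral_dominated_convergence[where w="\<lambda>y. G * B * indicator (cball 0 r) y"])
      show "AE y in lborel. (\<lambda>n. g y *\<^sub>R f (u n - y)) \<longlonglongrightarrow> g y *\<^sub>R f (x - y)"
        using c by (intro AE_I2 tendsto_intros continuous_on_tendsto_compose[OF c] u) auto
      show "AE y in lborel. norm (g y *\<^sub>R f (u n - y)) \<le> G * B * indicator (cball 0 r) y" for n
        using g f borel_le_nonneg[OF f] kernel_le_nonneg[OF g]
        by (auto simp: kernel_le_def borel_le_def dist_norm indicator_def intro!: mult_mono)
      show "integrable lborel (\<lambda>y :: real ^ 'n. G * B * indicator (cball 0 r) y)"
        by (rule integrable_cball_indicator)
    qed measurable
  qed
qed

lemma bump_continuous: "continuous_on UNIV bump"
  unfolding bump_def by (intro continuous_intros)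

lemma bump_measurable [measurable]: "bump \<in> borel_measurable borel"
  by (rule borel_measurable_continuous_onI[OF bump_continuous])

lemma bump_nonneg: "0 \<le> bump x" by (simp add: bump_def)

lemma bump_le_1: "bump x \<le> 1"
  unfolding bump_def by (intro power_le_one) auto

lemma inner_ge_1: "norm (x :: real ^ 'n) > 1 \<Longrightarrow> x \<bullet> x \<ge> 1"
  by (simp add: dot_square_norm)

lemma bump_support: "norm x > 1 \<Longrightarrow> bump x = 0"
  using inner_ge_1[of x] by (simp add: bump_def max_def)

lemma bump_integrable: "integrable lborel (bump :: real ^ 'n \<Rightarrow> real)"
  by (rule Bochner_Integration.integrable_bound[OF integrable_cball_indicator[of 1 0 1]])
     (auto simp: indicator_def dist_norm bump_nonneg bump_le_1 bump_support intro!: AE_I2)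

lemma bump_mass_pos: "bump_mass TYPE('n::finite) > 0"
proof -
  have "bump_mass TYPE('n) \<noteq> 0"
  proof
    assume "bump_mass TYPE('n) = 0"
    then have "AE x in lborel. bump (x :: real ^ 'n) = 0"
      unfolding bump_mass_def
      using integral_nonneg_eq_0_iff_AE[OF bump_integrable[where 'n='n]] by (auto simp: bump_nonneg)
    then have "AE x in lborel. x \<notin> ball (0 :: real ^ 'n) 1"
    proof eventually_elim
      case (elim x)
      then show ?case
      proof (rule contrapos_pn)
        assume "x \<in> ball 0 1"
        then have "norm x < 1" by simp
        then have "x \<bullet> x < 1" by (simp add: dot_square_norm power_less_one_iff)
        then show "bump x \<noteq> 0" by (simp add: bump_def max_def)
      qed
    qed
    then have "ball (0 :: real ^ 'n) 1 \<in> null_sets lborel"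
      using AE_iff_null_sets[of "ball (0 :: real ^ 'n) 1" lborel] by simp
    then have "negligible (ball (0 :: real ^ 'n) 1)"
      by (simp add: negligible_iff_null_sets null_sets_completionI)
    then show False using open_not_negligible[of "ball (0 :: real ^ 'n) 1"] by auto
  qed
  moreover have "bump_mass TYPE('n) \<ge> 0"
    unfolding bump_mass_def by (rule Bochner_Integration.integral_nonneg) (rule bump_nonneg)
  ultimately show ?thesis by linarith
qed

lemma mollifier_nonneg: "0 \<le> mollifier (x :: real ^ 'n)"
  unfolding mollifier_def using bump_mass_pos[where 'n='n] bump_nonneg by (intro divide_nonneg_nonneg) auto

lemma kernel_le_mollifier: "kernel_le 1 (1 / bump_mass TYPE('n)) (mollifier :: real ^ 'n \<Rightarrow> real)"
  unfolding kernel_le_def mollifier_def using bump_mass_pos[where 'n='n]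
  by (auto simp: bump_nonneg bump_le_1 bump_support divide_right_mono intro!: borel_measurable_divide)

lemma integral_mollifier: "(\<integral>x. mollifier (x :: real ^ 'n) \<partial>lborel) = 1"
  unfolding mollifier_def using bump_mass_pos[where 'n='n]
  by (simp add: bump_mass_def)

lemma integrable_mollifier: "integrable lborel (mollifier :: real ^ 'n \<Rightarrow> real)"
  unfolding mollifier_def[abs_def] by (intro integrable_divide bump_integrable)

lemma kernel_le_mollifier_grad:
  "kernel_le 1 (4 * norm v / bump_mass TYPE('n)) (mollifier_grad (v :: real ^ 'n))"
proof -
  have "\<bar>max 0 (1 - x \<bullet> x) * (x \<bullet> v)\<bar> \<le> norm v" for x :: "real ^ 'n"
  proof (cases "norm x > 1")
    case True then show ?thesis using inner_ge_1[of x] by (simp add: max_def)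
  next
    case False
    have "\<bar>max 0 (1 - x \<bullet> x)\<bar> * \<bar>x \<bullet> v\<bar> \<le> 1 * (norm x * norm v)"
      by (intro mult_mono Cauchy_Schwarz_ineq2) (auto simp: max_def)
    also have "\<dots> \<le> norm v" using False by (simp add: mult_left_le_one_le)
    finally show ?thesis by (simp add: abs_mult)
  qed
  then have "\<bar>mollifier_grad v x\<bar> \<le> 4 * norm v / bump_mass TYPE('n)" for x
    using bump_mass_pos[where 'n='n] by (simp add: mollifier_grad_def abs_mult divide_right_mono mult.assoc)
  moreover have "mollifier_grad v x = 0" if "norm x > 1" for x
    using inner_ge_1[OF that] by (simp add: mollifier_grad_def max_def)
  moreover have "mollifier_grad v \<in> borel_measurable borel"
    unfolding mollifier_grad_def by (intro borel_measurable_continuous_onI continuous_intros) (use bump_mass_pos[where 'n='n] in auto)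
  ultimately show ?thesis by (simp add: kernel_le_def)
qed

text \<open>The derivative of \<open>u \<mapsto> (max 0 u)\<^sup>2\<close> is \<open>2 max 0 u\<close>, which has Lipschitz constant \<open>2\<close>.\<close>

lemma pos_part_square_remainder:
  fixes u w :: real
  shows "\<bar>(max 0 w)\<^sup>2 - (max 0 u)\<^sup>2 - 2 * max 0 u * (w - u)\<bar> \<le> (w - u)\<^sup>2"
proof -
  consider "0 \<le> u" "0 \<le> w" | "u < 0" "0 \<le> w" | "0 \<le> u" "w < 0" | "u < 0" "w < 0" by linarith
  then show ?thesis
  proof cases
    case 1
    then have "(max 0 w)\<^sup>2 - (max 0 u)\<^sup>2 - 2 * max 0 u * (w - u) = (w - u)\<^sup>2"
      by (simp add: max_def power2_eq_square algebra_simps)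
    then show ?thesis by simp
  next
    case 2
    then have "w\<^sup>2 \<le> (w - u)\<^sup>2" by (intro power_mono) auto
    then show ?thesis using 2 by (simp add: max_def)
  next
    case 3
    have "(max 0 w)\<^sup>2 - (max 0 u)\<^sup>2 - 2 * max 0 u * (w - u) = u\<^sup>2 + 2 * (u * (- w))"
      using 3 by (simp add: max_def power2_eq_square algebra_simps)
    moreover have "(w - u)\<^sup>2 = u\<^sup>2 + 2 * (u * (- w)) + w\<^sup>2" by (simp add: power2_eq_square algebra_simps)
    moreover have "0 \<le> u * (- w)" using 3 by (intro mult_nonneg_nonneg) auto
    moreover have "0 \<le> u\<^sup>2" "0 \<le> w\<^sup>2" by auto
    ultimately show ?thesis unfolding abs_le_iff by linarith
  next
    case 4 then show ?thesis by (simp add: max_def)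
  qed
qed

text \<open>With \<open>u = 1 - |x|\<^sup>2\<close> and \<open>w = 1 - |x+v|\<^sup>2\<close> one has \<open>w - u = -2 x \<bullet> v - |v|\<^sup>2\<close>, which is at most
\<open>5 |v|\<close> in absolute value when \<open>|x| \<le> 2\<close> and \<open>|v| \<le> 1\<close>; hence the constant \<open>27 = 5\<^sup>2 + 2\<close>. For \<open>|x| > 2\<close>
both \<open>x\<close> and \<open>x + v\<close> are outside the support.\<close>

lemma mollifier_remainder:
  fixes x v :: "real ^ 'n"
  assumes v: "norm v \<le> 1"
  shows "\<bar>mollifier (x + v) - mollifier x - mollifier_grad v x\<bar>
           \<le> 27 / bump_mass TYPE('n) * (norm v)\<^sup>2 * indicator (cball 0 2) x"
proof -
  define u where "u = 1 - x \<bullet> x"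
  define w where "w = 1 - (x + v) \<bullet> (x + v)"
  have wu: "w - u = - 2 * (x \<bullet> v) - (norm v)\<^sup>2"
    by (simp add: u_def w_def inner_add_left inner_add_right inner_commute power2_norm_eq_inner)
  have "\<bar>bump (x + v) - bump x + 4 * max 0 u * (x \<bullet> v)\<bar> \<le> 27 * (norm v)\<^sup>2 * indicator (cball 0 2) x"
  proof (cases "norm x \<le> 2")
    case True
    have "bump (x + v) - bump x + 4 * max 0 u * (x \<bullet> v)
        = ((max 0 w)\<^sup>2 - (max 0 u)\<^sup>2 - 2 * max 0 u * (w - u)) - 2 * max 0 u * (norm v)\<^sup>2"
      unfolding wu bump_def u_def[symmetric] w_def[symmetric] by (simp add: algebra_simps)
    also have "\<bar>\<dots>\<bar> \<le> (w - u)\<^sup>2 + \<bar>2 * max 0 u * (norm v)\<^sup>2\<bar>"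
      using pos_part_square_remainder[of w u] by linarith
    also have "\<bar>2 * max 0 u * (norm v)\<^sup>2\<bar> \<le> 2 * (norm v)\<^sup>2"
      by (simp add: abs_mult u_def max_def mult_left_le_one_le)
    also have "(w - u)\<^sup>2 \<le> (5 * norm v)\<^sup>2"
    proof -
      have "\<bar>x \<bullet> v\<bar> \<le> 2 * norm v"
        using Cauchy_Schwarz_ineq2[of x v] mult_right_mono[OF True, of "norm v"] by simp
      moreover have "(norm v)\<^sup>2 \<le> norm v"
        using v by (simp add: power2_eq_square mult_left_le_one_le)
      moreover have "0 \<le> (norm v)\<^sup>2" by simp
      ultimately have "\<bar>w - u\<bar> \<le> 5 * norm v" unfolding wu by linarith
      then show ?thesis by (metis abs_ge_zero power2_abs power_mono)
    qed
    finally show ?thesis using True by (simp add: power_mult_distrib)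
  next
    case False
    then have "norm x > 1" by simp
    moreover have "norm (x + v) > 1"
      using False v norm_triangle_ineq4[of "x + v" v] by simp
    ultimately show ?thesis
      using inner_ge_1[of x] by (simp add: bump_support u_def max_def)
  qed
  then have "\<bar>bump (x + v) - bump x + 4 * max 0 u * (x \<bullet> v)\<bar> / bump_mass TYPE('n)
      \<le> 27 * (norm v)\<^sup>2 * indicator (cball 0 2) x / bump_mass TYPE('n)"
    using bump_mass_pos[where 'n='n] by (intro divide_right_mono) auto
  moreover have "mollifier (x + v) - mollifier x - mollifier_grad v x
      = (bump (x + v) - bump x + 4 * max 0 u * (x \<bullet> v)) / bump_mass TYPE('n)"
    by (simp add: mollifier_def mollifier_grad_def u_def diff_divide_distrib add_divide_distrib)
  ultimately show ?thesis using bump_mass_pos[where 'n='n] by (simp add: abs_divide)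
qed

abbreviation mollify :: "(real ^ 'n \<Rightarrow> complex) \<Rightarrow> real ^ 'n \<Rightarrow> complex" where
  "mollify \<equiv> convolution mollifier"

lemma mollify_norm_le:
  fixes f :: "real ^ 'n \<Rightarrow> complex"
  assumes f: "borel_le B f"
  shows "norm (mollify f x) \<le> B"
proof -
  note K = kernel_le_mollifier[where 'n='n]
  have "norm (mollify f x) \<le> (\<integral>y. norm (mollifier y *\<^sub>R f (x - y)) \<partial>lborel)"
    unfolding convolution_flip[OF K f] by (rule Bochner_Integration.integral_norm_bound)
  also have "\<dots> \<le> (\<integral>y. mollifier (y :: real ^ 'n) * B \<partial>lborel)"
  proof (rule Bochner_Integration.integral_mono)
    show "norm (mollifier y *\<^sub>R f (x - y)) \<le> mollifier y * B" for y
      using f by (auto simp: mollifier_nonneg borel_le_def intro!: mult_left_mono)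
  qed (intro integrable_norm convolution_flip_integrable[OF K f] integrable_mult_left integrable_mollifier)+
  also have "\<dots> = B" using integral_mollifier[where 'n='n] by simp
  finally show ?thesis .
qed

text \<open>The kernel's quadratic remainder, integrated against a bounded function over a ball of radius \<open>2\<close>,
is still quadratic in \<open>v\<close>. Indicator functions are included; the partition of unity is built from
them.\<close>

lemma mollify_has_derivative:
  fixes f :: "real ^ 'n \<Rightarrow> complex"
  assumes f: "borel_le B f"
  shows "(mollify f has_derivative (\<lambda>v. convolution (mollifier_grad v) f x)) (at x)"
proof -
  note K = kernel_le_mollifier[where 'n='n] and K' = kernel_le_mollifier_grad[where 'n='n]
  define C where "C = 27 / bump_mass TYPE('n) * B * measure lborel (cball (0 :: real ^ 'n) 2)"
  have "linear (\<lambda>v. convolution (mollifier_grad v) f x)"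
  proof
    show "convolution (mollifier_grad (v + w)) f x = convolution (mollifier_grad v) f x + convolution (mollifier_grad w) f x" for v w
    proof -
      have "mollifier_grad (v + w) (x - y) *\<^sub>R f y = mollifier_grad v (x - y) *\<^sub>R f y + mollifier_grad w (x - y) *\<^sub>R f y" for y
        by (simp add: mollifier_grad_def inner_add_right scaleR_add_left[symmetric] add_divide_distrib[symmetric] algebra_simps)
      then show ?thesis unfolding convolution_def
        by (simp add: Bochner_Integration.integral_add[OF convolution_integrable[OF K' f] convolution_integrable[OF K' f]])
    qed
    show "convolution (mollifier_grad (r *\<^sub>R v)) f x = r *\<^sub>R convolution (mollifier_grad v) f x" for r v
    proof -
      have "mollifier_grad (r *\<^sub>R v) (x - y) *\<^sub>R f y = r *\<^sub>R (mollifier_grad v (x - y) *\<^sub>R f y)" for y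
        by (simp add: mollifier_grad_def mult.left_commute mult.commute)
      then show ?thesis unfolding convolution_def by (simp only: integral_scaleR_right)
    qed
  qed
  then have bl: "bounded_linear (\<lambda>v. convolution (mollifier_grad v) f x)"
    by (simp add: linear_conv_bounded_linear)
  have C: "0 \<le> C" unfolding C_def using bump_mass_pos[where 'n='n] borel_le_nonneg[OF f] by simp
  have rem: "norm (mollify f (x + v) - mollify f x - convolution (mollifier_grad v) f x) \<le> C * (norm v)\<^sup>2"
    if v: "norm v \<le> 1" for v
  proof -
    define R where "R z = mollifier (z + v) - mollifier z - mollifier_grad v z" for z :: "real ^ 'n"
    define G where "G = 27 / bump_mass TYPE('n) * (norm v)\<^sup>2"
    have bd: "\<bar>R z\<bar> \<le> G * indicator (cball 0 2) z" for z
      using mollifier_remainder[OF v, of z] by (simp add: R_def G_def)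
    have G: "0 \<le> G" using bump_mass_pos[where 'n='n] by (simp add: G_def)
    have [measurable]: "mollifier \<in> borel_measurable (borel :: (real ^ 'n) measure)"
       "mollifier_grad v \<in> borel_measurable borel"
      using K K'[of v] by (auto simp: kernel_le_def)
    have kR: "kernel_le 2 G R"
      unfolding kernel_le_def
    proof (intro conjI allI impI)
      show "R \<in> borel_measurable borel" unfolding R_def by measurable
      show "\<bar>R z\<bar> \<le> G" for z using bd[of z] G by (cases "norm z \<le> 2") (auto simp: indicator_def)
      show "R z = 0" if "2 < norm z" for z using bd[of z] that by (simp add: indicator_def)
    qed
    have "mollify f (x + v) - mollify f x - convolution (mollifier_grad v) f x = convolution R f x"
    proof -
      have "R (x - y) *\<^sub>R f y = mollifier (x + v - y) *\<^sub>R f y - mollifier (x - y) *\<^sub>R f y - mollifier_grad v (x - y) *\<^sub>R f y" for y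
        by (simp add: R_def scaleR_diff_left algebra_simps)
      then show ?thesis unfolding convolution_def
        using convolution_integrable[OF K f] convolution_integrable[OF K'[of v] f] by simp
    qed
    then show ?thesis
      using convolution_norm_le[OF kR f, of x]
      by (simp add: C_def G_def measure_cball_translate[of x 2] mult.assoc mult.left_commute mult.commute)
  qed
  show ?thesis
    unfolding has_derivative_at
  proof (intro conjI bl)
    show "(\<lambda>v. norm (mollify f (x + v) - mollify f x - convolution (mollifier_grad v) f x) / norm v) \<midarrow>0\<rightarrow> 0"
    proof (rule tendsto_sandwich[where f="\<lambda>_. 0" and h="\<lambda>v. C * norm v"])
      have "\<forall>\<^sub>F v in at (0 :: real ^ 'n). norm v < 1"
        unfolding eventually_at by (intro exI[of _ 1]) auto
      then show "\<forall>\<^sub>F v in at 0. norm (mollify f (x + v) - mollify f x - convolution (mollifier_grad v) f x) / norm v \<le> C * norm v"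
      proof eventually_elim
        case (elim v)
        then show ?case using rem[of v] C
          by (cases "v = 0") (auto simp: divide_simps power2_eq_square mult.assoc)
      qed
      show "(\<lambda>v::real ^ 'n. C * norm v) \<midarrow>0\<rightarrow> 0"
        by (intro tendsto_mult_right_zero tendsto_norm_zero tendsto_ident_at)
    qed (rule always_eventually, simp, rule tendsto_const)
  qed
qed

definition mollify_const :: "'n::finite itself \<Rightarrow> real" where
  "mollify_const _ = max 1 (4 / bump_mass TYPE('n) * measure lborel (cball (0 :: real ^ 'n) 1))"

lemma mollify_const_ge_1: "1 \<le> mollify_const TYPE('n::finite)"
  by (simp add: mollify_const_def)

lemma mollify_differentiable: "borel_le B f \<Longrightarrow> mollify f differentiable_on UNIV"
  using mollify_has_derivative by (meson differentiableI differentiable_at_imp_differentiable_on)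

lemma pderiv_mollify: "borel_le B f \<Longrightarrow> pderiv_at i (mollify f) = convolution (mollifier_grad (axis i 1)) f"
  using pderiv_at_eqI[OF mollify_has_derivative] by blast

lemma Ck_le_0_mollify: "borel_le B f \<Longrightarrow> Ck_le 0 B (mollify f)"
  unfolding Ck_le_0 using mollify_differentiable mollify_norm_le by (auto intro: differentiable_imp_continuous_on)

text \<open>Along one sequence of increments the derivative becomes a sequential limit, as needed for
dominated convergence.\<close>

lemma pderiv_LIMSEQ:
  fixes F :: "real ^ 'n \<Rightarrow> complex"
  assumes "F differentiable_on UNIV"
  shows "(\<lambda>n. real (Suc n) *\<^sub>R (F (x + inverse (real (Suc n)) *\<^sub>R axis i 1) - F x)) \<longlonglongrightarrow> pderiv_at i F x"
proof -
  define D where "D = frechet_derivative F (at x)"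
  have D: "(F has_derivative D) (at x)" unfolding D_def by (rule has_frechet[OF assms])
  have lin: "linear D" using D has_derivative_linear by blast
  define h where "h n = inverse (real (Suc n)) *\<^sub>R (axis i 1 :: real ^ 'n)" for n
  have nh: "norm (h n) = inverse (real (Suc n))" for n by (simp add: h_def norm_axis_1)
  have "h \<longlonglongrightarrow> 0"
    unfolding h_def by (rule tendsto_eq_intros LIMSEQ_inverse_real_of_nat tendsto_const)+ simp
  moreover have "h n \<noteq> 0" for n using nh[of n] by force
  moreover have "(\<lambda>v. norm (F (x + v) - F x - D v) / norm v) \<midarrow>0\<rightarrow> 0"
    using D by (simp add: has_derivative_at)
  ultimately have "(\<lambda>n. norm (F (x + h n) - F x - D (h n)) / norm (h n)) \<longlonglongrightarrow> 0"
    unfolding tendsto_at_iff_sequentially comp_def by simp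
  moreover have "norm (F (x + h n) - F x - D (h n)) / norm (h n)
      = norm (real (Suc n) *\<^sub>R (F (x + h n) - F x) - D (axis i 1))" for n
  proof -
    have "real (Suc n) *\<^sub>R (F (x + h n) - F x) - D (axis i 1)
        = real (Suc n) *\<^sub>R (F (x + h n) - F x - D (h n))"
      by (simp add: h_def linear_scale[OF lin] scaleR_diff_right del: of_nat_Suc)
    then show ?thesis unfolding nh by (simp add: divide_inverse mult.commute del: of_nat_Suc)
  qed
  ultimately have "(\<lambda>n. real (Suc n) *\<^sub>R (F (x + h n) - F x) - D (axis i 1)) \<longlonglongrightarrow> 0"
    using tendsto_norm_zero_iff by fastforce
  then show ?thesis
    unfolding h_def pderiv_at_def D_def[symmetric] by (simp add: LIM_zero_iff)
qed

lemma lipschitz_of_pderiv: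
  fixes f :: "real ^ 'n \<Rightarrow> complex" and B :: real
  assumes f: "f differentiable_on UNIV" and B: "\<And>i x. norm (pderiv_at i f x) \<le> B"
  shows "norm (f x - f y) \<le> CARD('n) * B * norm (x - y)"
proof (rule differentiable_bound[OF convex_UNIV])
  fix x :: "real ^ 'n"
  show "(f has_derivative frechet_derivative f (at x)) (at x within UNIV)"
    using has_frechet[OF f] by simp
  then have lin: "linear (frechet_derivative f (at x))" using has_derivative_linear by blast
  show "onorm (frechet_derivative f (at x)) \<le> CARD('n) * B"
  proof (rule onorm_le)
    fix v :: "real ^ 'n"
    have "frechet_derivative f (at x) v = frechet_derivative f (at x) (\<Sum>i\<in>UNIV. v $ i *\<^sub>R axis i 1)"
      using basis_expansion[of v] by (simp add: scalar_mult_eq_scaleR)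
    also have "\<dots> = (\<Sum>i\<in>UNIV. v $ i *\<^sub>R pderiv_at i f x)"
      by (simp add: linear_sum[OF lin] linear_scale[OF lin] pderiv_at_def)
    also have "norm \<dots> \<le> (\<Sum>i\<in>(UNIV :: 'n set). norm v * B)"
      by (intro order_trans[OF norm_sum sum_mono]) (auto intro!: mult_mono B component_le_norm_cart)
    finally show "norm (frechet_derivative f (at x) v) \<le> CARD('n) * B * norm v"
      by (simp add: mult.commute mult.left_commute)
  qed
qed auto

text \<open>Here the derivative falls on the function: its difference quotients are dominated because a
function with bounded partial derivatives is Lipschitz.\<close>

lemma pderiv_mollify_commute:
  fixes f :: "real ^ 'n \<Rightarrow> complex"
  assumes f: "Ck_le 1 B f"
  shows "pderiv_at i (mollify f) = mollify (pderiv_at i f)"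
proof
  fix x
  note K = kernel_le_mollifier[where 'n='n]
  have d: "f differentiable_on UNIV" and D: "Ck_le 0 B (pderiv_at i f)" for i
    using f by (simp_all add: Ck_le_Suc)
  have bf: "borel_le B f" and bD: "borel_le B (pderiv_at i f)" using Ck_le_borel_le f D by blast+
  have [measurable]: "f \<in> borel_measurable borel" "pderiv_at i f \<in> borel_measurable borel"
    using bf bD by (auto simp: borel_le_def)
  have [measurable]: "mollifier \<in> borel_measurable (borel :: (real ^ 'n) measure)"
    using K by (auto simp: kernel_le_def)
  have B: "0 \<le> B" using borel_le_nonneg[OF bf] .
  define h where "h n = inverse (real (Suc n)) *\<^sub>R (axis i 1 :: real ^ 'n)" for n
  let ?s = "\<lambda>n y. real (Suc n) *\<^sub>R (f (x - y + h n) - f (x - y))"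
  have 1: "real (Suc n) *\<^sub>R (mollify f (x + h n) - mollify f x) = (\<integral>y. mollifier y *\<^sub>R ?s n y \<partial>lborel)" for n
  proof -
    have "(\<integral>y. mollifier y *\<^sub>R ?s n y \<partial>lborel)
        = (\<integral>y. real (Suc n) *\<^sub>R (mollifier y *\<^sub>R f (x + h n - y) - mollifier y *\<^sub>R f (x - y)) \<partial>lborel)"
      by (simp add: algebra_simps)
    also have "\<dots> = real (Suc n) *\<^sub>R (mollify f (x + h n) - mollify f x)"
      using convolution_flip_integrable[OF K bf] convolution_flip[OF K bf] by simp
    finally show ?thesis ..
  qed
  have "(\<lambda>n. \<integral>y. mollifier y *\<^sub>R ?s n y \<partial>lborel) \<longlonglongrightarrow> (\<integral>y. mollifier y *\<^sub>R pderiv_at i f (x - y) \<partial>lborel)"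
  proof (rule integral_dominated_convergence[where w="\<lambda>y. mollifier y * (CARD('n) * B)"])
    show "integrable lborel (\<lambda>y :: real ^ 'n. mollifier y * (CARD('n) * B))"
      by (intro integrable_mult_left integrable_mollifier)
    show "AE y in lborel. (\<lambda>n. mollifier y *\<^sub>R ?s n y) \<longlonglongrightarrow> mollifier y *\<^sub>R pderiv_at i f (x - y)"
      unfolding h_def by (intro AE_I2 tendsto_scaleR tendsto_const pderiv_LIMSEQ d)
    show "AE y in lborel. norm (mollifier y *\<^sub>R ?s n y) \<le> mollifier y * (CARD('n) * B)" for n
    proof (rule AE_I2)
      fix y :: "real ^ 'n"
      have "norm (f (x - y + h n) - f (x - y)) \<le> CARD('n) * B * norm (x - y + h n - (x - y))"
        by (rule lipschitz_of_pderiv[OF d]) (rule Ck_le_bound[OF D])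
      also have "norm (x - y + h n - (x - y)) = inverse (real (Suc n))"
        by (simp add: h_def norm_axis_1)
      finally have "real (Suc n) * norm (f (x - y + h n) - f (x - y)) \<le> real (Suc n) * (CARD('n) * B * inverse (real (Suc n)))"
        by (rule mult_left_mono) simp
      also have "\<dots> = CARD('n) * B" by (simp del: of_nat_Suc)
      finally have "norm (?s n y) \<le> CARD('n) * B"
        unfolding norm_scaleR by simp
      then show "norm (mollifier y *\<^sub>R ?s n y) \<le> mollifier y * (CARD('n) * B)"
        unfolding norm_scaleR[of "mollifier y"] using mollifier_nonneg[of y]
        by (simp add: mult_left_mono)
    qed
  qed measurable
  then have "(\<lambda>n. real (Suc n) *\<^sub>R (mollify f (x + h n) - mollify f x)) \<longlonglongrightarrow> mollify (pderiv_at i f) x"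
    unfolding 1 convolution_flip[OF K bD] .
  moreover have "(\<lambda>n. real (Suc n) *\<^sub>R (mollify f (x + h n) - mollify f x)) \<longlonglongrightarrow> pderiv_at i (mollify f) x"
    unfolding h_def by (intro pderiv_LIMSEQ mollify_differentiable[OF bf])
  ultimately show "pderiv_at i (mollify f) x = mollify (pderiv_at i f) x"
    using LIMSEQ_unique by blast
qed

text \<open>All derivatives but the last are passed to the function, the last one to the kernel. The constant
does not depend on the order.\<close>

lemma Ck_le_mollify_gain:
  fixes f :: "real ^ 'n \<Rightarrow> complex"
  shows "Ck_le k B f \<Longrightarrow> Ck_le (Suc k) (mollify_const TYPE('n) * B) (mollify f)"
proof (induction k arbitrary: f)
  case 0
  have bf: "borel_le B f" using Ck_le_borel_le 0 by blast
  have B: "0 \<le> B" using borel_le_nonneg[OF bf] .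
  note C = mollify_const_ge_1[where 'n='n]
  have "norm (mollify f x) \<le> mollify_const TYPE('n) * B" for x
    using mollify_norm_le[OF bf, of x] mult_right_mono[OF C B] by simp
  moreover have "Ck_le 0 (mollify_const TYPE('n) * B) (pderiv_at i (mollify f))" for i
  proof -
    note K' = kernel_le_mollifier_grad[of "axis i 1 :: real ^ 'n"]
    have "norm (convolution (mollifier_grad (axis i 1)) f x) \<le> mollify_const TYPE('n) * B" for x
    proof -
      have "norm (convolution (mollifier_grad (axis i 1)) f x)
          \<le> 4 / bump_mass TYPE('n) * B * measure lborel (cball x 1)"
        using convolution_norm_le[OF K' bf, of x] by (simp add: norm_axis_1)
      also have "\<dots> = (4 / bump_mass TYPE('n) * measure lborel (cball (0 :: real ^ 'n) 1)) * B"
        by (simp add: measure_cball_translate[of x 1])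
      also have "\<dots> \<le> mollify_const TYPE('n) * B"
        by (intro mult_right_mono B) (simp add: mollify_const_def)
      finally show ?thesis .
    qed
    then show ?thesis
      unfolding pderiv_mollify[OF bf] Ck_le_0
      using convolution_continuous[OF K' bf] Ck_le_continuous[OF 0] by blast
  qed
  ultimately show ?case by (simp add: Ck_le_Suc mollify_differentiable[OF bf])
next
  case (Suc k)
  have bf: "borel_le B f" using Ck_le_borel_le Suc.prems by blast
  have B: "0 \<le> B" using borel_le_nonneg[OF bf] .
  note C = mollify_const_ge_1[where 'n='n]
  have "norm (mollify f x) \<le> mollify_const TYPE('n) * B" for x
    using mollify_norm_le[OF bf, of x] mult_right_mono[OF C B] by simp
  moreover have "Ck_le 1 B f" using Suc.prems by (rule Ck_le_mono) auto
  then have "Ck_le (Suc k) (mollify_const TYPE('n) * B) (pderiv_at i (mollify f))" for i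
    using Suc by (simp add: pderiv_mollify_commute Ck_le_Suc[of k B] Ck_le_Suc[of "Suc k" B])
  ultimately show ?case using mollify_differentiable[OF bf] by (subst Ck_le_Suc) blast
qed

lemma Dlist_mollify: "Ck_le k B f \<Longrightarrow> length is \<le> k \<Longrightarrow> Dlist is (mollify f) = mollify (Dlist is f)"
proof (induction "is")
  case (Cons i "is")
  have "Ck_le (1 + length is) B f"
    by (rule Ck_le_mono[OF Cons.prems(1)]) (use Cons.prems in auto)
  then have "Ck_le 1 B (Dlist is f)" by (rule Ck_le_Dlist)
  then show ?case using Cons by (simp add: pderiv_mollify_commute)
qed simp

lemma Ck_le_Dlist': "Ck_le k B f \<Longrightarrow> length is \<le> k \<Longrightarrow> Ck_le (k - length is) B (Dlist is f)"
  using Ck_le_Dlist[of "k - length is" "is"] by simp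

lemma Ck_le_mollify: "Ck_le k B f \<Longrightarrow> Ck_le k B (mollify f)"
proof -
  assume f: "Ck_le k B f"
  have "C_k k (mollify f)" using C_k_SucD Ck_le_mollify_gain[OF f] by (auto simp: Ck_le_def)
  moreover have "norm (Dlist is (mollify f) x) \<le> B" if "length is \<le> k" for "is" x
    unfolding Dlist_mollify[OF f that] by (rule mollify_norm_le[OF Ck_le_borel_le[OF Ck_le_Dlist'[OF f that]]])
  ultimately show ?thesis by (simp add: Ck_le_def)
qed

lemma mollify_diff:
  fixes f g :: "real ^ 'n \<Rightarrow> complex"
  assumes "borel_le A f" "borel_le B g"
  shows "mollify (\<lambda>x. f x - g x) = (\<lambda>x. mollify f x - mollify g x)"
proof
  note K = kernel_le_mollifier[where 'n='n]
  show "mollify (\<lambda>x. f x - g x) x = mollify f x - mollify g x" for x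
    unfolding convolution_def scaleR_diff_right
    by (rule Bochner_Integration.integral_diff[OF convolution_integrable[OF K assms(1)] convolution_integrable[OF K assms(2)]])
qed

lemma mollify_sum:
  fixes f :: "'i \<Rightarrow> real ^ 'n \<Rightarrow> complex"
  assumes "\<And>i. i \<in> F \<Longrightarrow> borel_le (B i) (f i)"
  shows "mollify (\<lambda>x. \<Sum>i\<in>F. f i x) x = (\<Sum>i\<in>F. mollify (f i) x)"
  unfolding convolution_def scaleR_sum_right
  by (rule Bochner_Integration.integral_sum[OF convolution_integrable[OF kernel_le_mollifier assms]])

lemma mollify_cong:
  assumes "\<And>y. norm (x - y) \<le> 1 \<Longrightarrow> f y = g y"
  shows "mollify f x = mollify g x"
proof -
  have "mollifier (x - y) *\<^sub>R f y = mollifier (x - y) *\<^sub>R g y" for y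
    using assms[of y] kernel_le_mollifier[where 'n='a] by (cases "norm (x - y) \<le> 1") (auto simp: kernel_le_def)
  then show ?thesis
    unfolding convolution_def by (intro Bochner_Integration.integral_cong refl)
qed

lemma mollify_const_fun: "mollify (\<lambda>y. c) x = c"
proof -
  have "borel_le (norm c) (\<lambda>y :: real ^ 'a. c)" by (simp add: borel_le_def)
  from convolution_flip[OF kernel_le_mollifier this] have "mollify (\<lambda>y. c) x = (\<integral>y. mollifier (y :: real ^ 'a) *\<^sub>R c \<partial>lborel)" .
  also have "\<dots> = c" using integrable_mollifier[where 'n='a] integral_mollifier[where 'n='a] by simp
  finally show ?thesis .
qed

lemma mollify_support:
  assumes "mollify f x \<noteq> 0"
  shows "\<exists>y. norm (x - y) \<le> 1 \<and> f y \<noteq> 0"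
proof (rule ccontr)
  assume "\<not> ?thesis"
  then have "mollify f x = mollify (\<lambda>_. 0) x" by (intro mollify_cong) auto
  then show False using assms mollify_const_fun[of 0 x] by simp
qed

text \<open>The kernel has mass one and lives in the unit ball, so only the Lipschitz constant of \<open>f\<close> enters.\<close>

lemma mollify_error:
  fixes f :: "real ^ 'n \<Rightarrow> complex" and A B :: real
  assumes f: "Ck_le 1 A f" and B: "\<And>i x. norm (pderiv_at i f x) \<le> B"
  shows "norm (f x - mollify f x) \<le> CARD('n) * B"
proof -
  have "0 \<le> B" using B[of undefined undefined] norm_ge_zero order_trans by blast
  have "f differentiable_on UNIV" using f by (simp add: Ck_le_Suc)
  then have lip: "norm (f x - f y) \<le> CARD('n) * B" if "norm (x - y) \<le> 1" for y
  proof -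
    have "norm (f x - f y) \<le> CARD('n) * B * norm (x - y)"
      by (rule lipschitz_of_pderiv[OF \<open>f differentiable_on UNIV\<close> B])
    also have "\<dots> \<le> CARD('n) * B * 1"
      by (rule mult_left_mono[OF that]) (use \<open>0 \<le> B\<close> in simp)
    finally show ?thesis by simp
  qed
  define g where "g y = (if norm (x - y) \<le> 1 then f x - f y else 0)" for y
  have c: "Ck_le 0 A f" using f by (rule Ck_le_mono) auto
  have m: "borel_le A f" "borel_le (norm (f x)) (\<lambda>_ :: real ^ 'n. f x)" using Ck_le_borel_le[OF f] by (auto simp: borel_le_def)
  have [measurable]: "f \<in> borel_measurable borel" using m by (simp add: borel_le_def)
  have "borel_le (CARD('n) * B) g"
    unfolding borel_le_def g_def using lip \<open>0 \<le> B\<close> by (auto simp: )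
  then have "norm (mollify g x) \<le> CARD('n) * B" by (rule mollify_norm_le)
  also have "mollify g x = mollify (\<lambda>y. f x - f y) x" by (rule mollify_cong) (simp add: g_def)
  also have "\<dots> = f x - mollify f x"
    by (simp add: mollify_diff[OF m(2,1)] mollify_const_fun)
  finally show ?thesis .
qed

section \<open>Iterated mollification and its error\<close>

definition smoothing :: "nat \<Rightarrow> (real ^ 'n \<Rightarrow> complex) \<Rightarrow> real ^ 'n \<Rightarrow> complex" where
  "smoothing K = mollify ^^ K"

text \<open>This is \<open>I - T\<close> for \<open>T\<close> the \<open>K\<close>-fold mollification.\<close>

definition smoothing_err :: "nat \<Rightarrow> (real ^ 'n \<Rightarrow> complex) \<Rightarrow> real ^ 'n \<Rightarrow> complex" where
  "smoothing_err K f x = f x - smoothing K f x"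

lemma smoothing_0 [simp]: "smoothing 0 f = f" by (simp add: smoothing_def)
lemma smoothing_Suc [simp]: "smoothing (Suc K) f = mollify (smoothing K f)" by (simp add: smoothing_def)

lemma Ck_le_smoothing: "Ck_le k B f \<Longrightarrow> Ck_le k B (smoothing K f)"
  by (induction K) (auto intro: Ck_le_mollify)

lemma Ck_le_smoothing_gain:
  fixes f :: "real ^ 'n \<Rightarrow> complex"
  shows "Ck_le k B f \<Longrightarrow> Ck_le (k + K) (mollify_const TYPE('n) ^ K * B) (smoothing K f)"
  by (induction K) (auto simp: mult.assoc dest: Ck_le_mollify_gain)

lemma Dlist_smoothing:
  "Ck_le k B f \<Longrightarrow> length is \<le> k \<Longrightarrow> Dlist is (smoothing K f) = smoothing K (Dlist is f)"
proof (induction K)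
  case (Suc K)
  then show ?case using Dlist_mollify[OF Ck_le_smoothing[OF Suc.prems(1)]] by simp
qed simp

lemma smoothing_error:
  fixes f :: "real ^ 'n \<Rightarrow> complex" and A B :: real
  assumes f: "Ck_le 1 A f" and B: "\<And>i x. norm (pderiv_at i f x) \<le> B"
  shows "norm (f x - smoothing K f x) \<le> K * (CARD('n) * B)"
proof (induction K)
  case (Suc K)
  have D: "borel_le B (pderiv_at i f)" for i
  proof -
    have "Ck_le 0 A (pderiv_at i f)" using f by (simp add: Ck_le_Suc)
    then show ?thesis using Ck_le_borel_le B by (auto simp: borel_le_def)
  qed
  have "norm (pderiv_at i (smoothing K f) x) \<le> B" for i x
  proof -
    have "Ck_le 0 B (pderiv_at i f)" using f B by (simp add: Ck_le_Suc Ck_le_0)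
    then have "Ck_le 0 B (smoothing K (pderiv_at i f))" by (rule Ck_le_smoothing)
    moreover have "pderiv_at i (smoothing K f) = smoothing K (pderiv_at i f)"
      using Dlist_smoothing[OF f, of "[i]"] by simp
    ultimately show ?thesis by (simp add: Ck_le_0)
  qed
  then have "norm (smoothing K f x - mollify (smoothing K f) x) \<le> CARD('n) * B"
    by (intro mollify_error[OF Ck_le_smoothing[OF f]])
  then have "norm ((f x - smoothing K f x) + (smoothing K f x - mollify (smoothing K f) x)) \<le> K * (CARD('n) * B) + CARD('n) * B"
    using Suc by (intro norm_triangle_mono)
  then show ?case by (simp add: algebra_simps)
qed simp

lemma smoothing_support:
  "smoothing K f x \<noteq> 0 \<Longrightarrow> \<exists>y. norm (x - y) \<le> K \<and> f y \<noteq> 0"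
proof (induction K arbitrary: x)
  case 0 then show ?case by (auto intro!: exI[of _ x])
next
  case (Suc K)
  then obtain y where y: "norm (x - y) \<le> 1" "smoothing K f y \<noteq> 0" using mollify_support by fastforce
  then obtain z where "norm (y - z) \<le> K" "f z \<noteq> 0" using Suc.IH by blast
  moreover have "norm (x - z) \<le> norm (x - y) + norm (y - z)"
    using norm_triangle_ineq[of "x - y" "y - z"] by simp
  ultimately show ?case using y by (intro exI[of _ z]) auto
qed

lemma Ck_le_smoothing_err: "Ck_le k B f \<Longrightarrow> Ck_le k (2 * B) (smoothing_err K f)"
  unfolding smoothing_err_def[abs_def] using Ck_le_diff[OF _ Ck_le_smoothing] by (metis mult_2)

lemma Dlist_smoothing_err:
  "Ck_le k B f \<Longrightarrow> length is \<le> k \<Longrightarrow> Dlist is (smoothing_err K f) = smoothing_err K (Dlist is f)"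
  unfolding smoothing_err_def[abs_def]
  using Dlist_diff[of k f "smoothing K f" "is"] Ck_le_smoothing[of k B f K] Dlist_smoothing[of k B f "is" K]
  by (simp add: Ck_le_def)

lemma Ck_le_smoothing_err_iter: "Ck_le k B f \<Longrightarrow> Ck_le k (2 ^ r * B) ((smoothing_err K ^^ r) f)"
  by (induction r) (auto simp: mult.assoc dest: Ck_le_smoothing_err)

lemma Dlist_smoothing_err_iter:
  "Ck_le k B f \<Longrightarrow> length is \<le> k \<Longrightarrow> Dlist is ((smoothing_err K ^^ r) f) = (smoothing_err K ^^ r) (Dlist is f)"
proof (induction r)
  case (Suc r)
  then show ?case using Dlist_smoothing_err[OF Ck_le_smoothing_err_iter[OF Suc.prems(1)]] by simp
qed simp

text \<open>The function \<open>f\<close> has derivatives of size \<open>t\<^bsup>|\<alpha>|\<^esup>\<close>, as a fixed function dilated by \<open>t\<close> has. Each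
application of \<open>I - T\<close> gains a factor \<open>t\<close>, because \<open>(I - T) g\<close> is controlled by one more derivative
of \<open>g\<close>, until the order \<open>M\<close> is exhausted; after that \<open>I - T\<close> is merely bounded. Iterating \<open>M\<close> times
brings every derivative of order at most \<open>M\<close> down to \<open>t\<^sup>M\<close>.\<close>

lemma smoothing_err_iter_bound:
 fixes f :: "real ^ 'n \<Rightarrow> complex" and t :: real
  assumes t: "0 \<le> t" "t \<le> 1"
    and f: "C_k M f" "\<And>is x. length is \<le> M \<Longrightarrow> norm (Dlist is f x) \<le> t ^ length is"
    and l: "length is \<le> M"
  shows "norm (Dlist is ((smoothing_err K ^^ r) f) x) \<le> (K * CARD('n) + 2) ^ r * t ^ min M (length is + r)"
  using l
proof (induction r arbitrary: "is" x)
  case 0 then show ?case using f by simp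
next
  case (Suc r)
  define g where "g = (smoothing_err K ^^ r) f"
  define B :: real where "B = (K * CARD('n) + 2) ^ r"
  have B: "0 \<le> B" by (simp add: B_def)
  have "Ck_le M 1 f"
    unfolding Ck_le_def using f(1) order_trans[OF f(2) power_le_one[OF t]] by blast
  then have g: "Ck_le M (2 ^ r * 1) g" unfolding g_def by (rule Ck_le_smoothing_err_iter)
  have IH: "norm (Dlist is g x) \<le> B * t ^ min M (length is + r)" if "length is \<le> M" for "is" x
    using Suc.IH[OF that] by (simp add: g_def B_def)
  have D: "Dlist is ((smoothing_err K ^^ Suc r) f) x = Dlist is g x - smoothing K (Dlist is g) x"
    using Dlist_smoothing_err[OF g Suc.prems, of K] by (simp add: g_def smoothing_err_def)
  have "norm (Dlist is g x - smoothing K (Dlist is g) x) \<le> (K * CARD('n) + 2) * (B * t ^ min M (length is + Suc r))"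
  proof (cases "length is < M")
    case True
    have "Ck_le (M - length is) (2 ^ r * 1) (Dlist is g)" using True by (intro Ck_le_Dlist'[OF g]) auto
    then have "Ck_le 1 (2 ^ r * 1) (Dlist is g)" by (rule Ck_le_mono) (use True in auto)
    moreover have "norm (pderiv_at i (Dlist is g) x) \<le> B * t ^ min M (length is + Suc r)" for i x
      using IH[of "i # is" x] True by simp
    ultimately have "norm (Dlist is g x - smoothing K (Dlist is g) x) \<le> K * (CARD('n) * (B * t ^ min M (length is + Suc r)))"
      by (rule smoothing_error)
    also have "\<dots> \<le> (K * CARD('n) + 2) * (B * t ^ min M (length is + Suc r))"
      using B t by (simp add: distrib_right)
    finally show ?thesis .
  next
    case False
    then have [simp]: "length is = M" using Suc.prems by simp
    have "Ck_le 0 (B * t ^ M) (Dlist is g)"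
      unfolding Ck_le_0 using IH[of "is"] Ck_le_continuous[OF Ck_le_Dlist'[OF g, of "is"]] by simp
    then have "Ck_le 0 (B * t ^ M) (Dlist is g)" "Ck_le 0 (B * t ^ M) (smoothing K (Dlist is g))"
      by (auto intro: Ck_le_smoothing)
    then have "norm (Dlist is g x - smoothing K (Dlist is g) x) \<le> B * t ^ M + B * t ^ M"
      by (intro order_trans[OF norm_triangle_ineq4] add_mono) (auto simp: Ck_le_0)
    also have "\<dots> \<le> (K * CARD('n) + 2) * (B * t ^ M)"
      using B t by (simp add: distrib_right)
    finally show ?thesis by simp
  qed
  then show ?case unfolding D B_def by (simp only: power_Suc of_nat_mult mult.assoc)
qed

lemma smoothing_err_iter_support:
  "(smoothing_err K ^^ r) f x \<noteq> 0 \<Longrightarrow> \<exists>y. norm (x - y) \<le> r * K \<and> f y \<noteq> 0"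
proof (induction r arbitrary: x)
  case 0 then show ?case by (auto intro!: exI[of _ x])
next
  case (Suc r)
  let ?g = "(smoothing_err K ^^ r) f"
  have "(smoothing_err K ^^ Suc r) f x = ?g x - smoothing K ?g x"
    by (simp add: smoothing_err_def[of K ?g])
  then have "?g x \<noteq> 0 \<or> smoothing K ?g x \<noteq> 0" using Suc.prems by auto
  then obtain y where y: "norm (x - y) \<le> K" "?g y \<noteq> 0"
  proof (cases "?g x = 0")
    case True
    then show ?thesis using smoothing_support[of K ?g x] \<open>_ \<or> _\<close> that by blast
  next
    case False then show ?thesis using that[of x] by simp
  qed
  then obtain z where "norm (y - z) \<le> r * K" "f z \<noteq> 0" using Suc.IH by blast
  moreover have "norm (x - z) \<le> norm (x - y) + norm (y - z)"
    using norm_triangle_ineq[of "x - y" "y - z"] by simp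
  ultimately show ?case using y by (intro exI[of _ z]) (auto simp: algebra_simps)
qed

text \<open>This is \<open>I - (I - T)\<^sup>M\<close>: by \<open>smoothing_err_iter_bound\<close> it approximates to order \<open>M\<close>, and by
\<open>high_smoothing_sum\<close> it has \<open>T\<close> as a factor and therefore gains \<open>K\<close> derivatives.\<close>

definition high_smoothing :: "nat \<Rightarrow> nat \<Rightarrow> (real ^ 'n \<Rightarrow> complex) \<Rightarrow> real ^ 'n \<Rightarrow> complex" where
  "high_smoothing K M f x = f x - (smoothing_err K ^^ M) f x"

lemma high_smoothing_sum: "high_smoothing K M f x = (\<Sum>r<M. smoothing K ((smoothing_err K ^^ r) f) x)"
proof (induction M)
  case (Suc M)
  have "high_smoothing K (Suc M) f x = high_smoothing K M f x + smoothing K ((smoothing_err K ^^ M) f) x"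
    by (simp add: high_smoothing_def smoothing_err_def)
  then show ?case using Suc by simp
qed (simp add: high_smoothing_def)

lemma Ck_le_high_smoothing:
  fixes f :: "real ^ 'n \<Rightarrow> complex"
  assumes f: "Ck_le k B f"
  shows "Ck_le (k + K) ((\<Sum>r<M. mollify_const TYPE('n) ^ K * 2 ^ r) * B) (high_smoothing K M f)"
proof -
  have "Ck_le (k + K) (\<Sum>r<M. mollify_const TYPE('n) ^ K * (2 ^ r * B)) (\<lambda>x. \<Sum>r<M. smoothing K ((smoothing_err K ^^ r) f) x)"
    by (intro Ck_le_sum Ck_le_smoothing_gain Ck_le_smoothing_err_iter f) auto
  then show ?thesis by (simp add: high_smoothing_sum[abs_def] sum_distrib_right mult.assoc)
qed

lemma Dlist_high_smoothing:
  "Ck_le k B f \<Longrightarrow> length is \<le> k \<Longrightarrow> Dlist is (high_smoothing K M f) = high_smoothing K M (Dlist is f)"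
  unfolding high_smoothing_def[abs_def]
  using Dlist_diff[of k f "(smoothing_err K ^^ M) f" "is"] Ck_le_smoothing_err_iter[of k B f M K] Dlist_smoothing_err_iter[of k B f "is" M K]
  by (simp add: Ck_le_def)

lemma high_smoothing_support:
  "high_smoothing K M f x \<noteq> 0 \<Longrightarrow> \<exists>y. norm (x - y) \<le> M * K \<and> f y \<noteq> 0"
  by (cases "f x = 0")
     (use smoothing_err_iter_support[where K=K and r=M and f=f and x=x] in \<open>auto simp: high_smoothing_def intro!: exI[of _ x]\<close>)

section \<open>Lattice points and cubes\<close>

definition rvec :: "int ^ 'n \<Rightarrow> real ^ 'n" where
  "rvec m = (\<chi> i. of_int (m $ i))"

text \<open>The index set of all cubes of one level whose centre is within \<open>D\<close> of a given point, in units of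
the side length of that level; compare \<open>mem_dcube_iff\<close>.\<close>

definition near :: "real \<Rightarrow> real ^ 'n \<Rightarrow> (int ^ 'n) set" where
  "near D y = {m. \<forall>i. \<bar>y $ i - of_int (m $ i)\<bar> \<le> D}"

lemma rvec_nth [simp]: "rvec m $ i = of_int (m $ i)"
  by (simp add: rvec_def)

text \<open>For a fixed finer cube, the coarser cubes it is close to are again determined up to a bounded
number.\<close>

lemma near_rescale:
  assumes "l \<in> near (D * 2 ^ i) (2 ^ i *\<^sub>R rvec m)"
  shows "m \<in> near D ((1 / 2 ^ i) *\<^sub>R rvec l)"
proof -
  have "\<bar>of_int (l $ k) / 2 ^ i - of_int (m $ k)\<bar> \<le> D" for k
  proof -
    have "\<bar>2 ^ i * of_int (m $ k) - of_int (l $ k)\<bar> \<le> D * 2 ^ i" using assms by (simp add: near_def)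
    moreover have "\<bar>2 ^ i * of_int (m $ k) - of_int (l $ k)\<bar> = 2 ^ i * \<bar>of_int (l $ k) / 2 ^ i - of_int (m $ k) :: real\<bar>"
      by (subst abs_minus_commute) (simp add: abs_mult_pos' right_diff_distrib)
    ultimately have "2 ^ i * \<bar>of_int (l $ k) / 2 ^ i - of_int (m $ k)\<bar> \<le> 2 ^ i * D" by (simp add: mult.commute)
    then show ?thesis by (rule mult_left_le_imp_le) simp
  qed
  then show ?thesis by (simp add: near_def)
qed

lemma mem_dcube_iff: "x \<in> dcube d j m \<longleftrightarrow> m \<in> near d (2 ^ j *\<^sub>R x)"
proof -
  have "\<bar>x $ i - of_int (m $ i) / 2 ^ j\<bar> \<le> d / 2 ^ j \<longleftrightarrow> \<bar>2 ^ j * x $ i - of_int (m $ i)\<bar> \<le> d" for i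
  proof -
    have "\<bar>2 ^ j * x $ i - of_int (m $ i)\<bar> = 2 ^ j * \<bar>x $ i - of_int (m $ i) / 2 ^ j\<bar>"
      by (simp add: abs_mult_pos' right_diff_distrib)
    then show ?thesis by (simp add: field_simps)
  qed
  then show ?thesis by (simp add: dcube_def near_def)
qed

lemma card_int_interval: 
  assumes "0 \<le> D" shows "real (card {\<lceil>y - D\<rceil>..\<lfloor>y + D\<rfloor>}) \<le> 2 * D + 1"
proof -
  have "real (nat (\<lfloor>y + D\<rfloor> - \<lceil>y - D\<rceil> + 1)) \<le> 2 * D + 1"
  proof (cases "0 \<le> \<lfloor>y + D\<rfloor> - \<lceil>y - D\<rceil> + 1")
    case True
    have "real_of_int \<lfloor>y + D\<rfloor> \<le> y + D" "y - D \<le> real_of_int \<lceil>y - D\<rceil>" by auto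
    then have "real_of_int (\<lfloor>y + D\<rfloor> - \<lceil>y - D\<rceil> + 1) \<le> 2 * D + 1"
      unfolding of_int_add of_int_diff of_int_1 by linarith
    then show ?thesis using True by simp
  qed (use assms in simp)
  then show ?thesis by simp
qed

lemma near_subset_image:
  "near D (y :: real ^ 'n) \<subseteq> (\<lambda>g. \<chi> i. g i) ` (PiE UNIV (\<lambda>i. {\<lceil>y $ i - D\<rceil>..\<lfloor>y $ i + D\<rfloor>}))"
proof
  fix m assume m: "m \<in> near D y"
  have "(\<lambda>i. m $ i) \<in> PiE UNIV (\<lambda>i. {\<lceil>y $ i - D\<rceil>..\<lfloor>y $ i + D\<rfloor>})"
  proof -
    have "\<lceil>y $ i - D\<rceil> \<le> m $ i \<and> m $ i \<le> \<lfloor>y $ i + D\<rfloor>" for i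
    proof -
      have "\<bar>y $ i - of_int (m $ i)\<bar> \<le> D" using m by (simp add: near_def)
      then show ?thesis by (auto simp: le_floor_iff ceiling_le_iff)
    qed
    then show ?thesis by auto
  qed
  then show "m \<in> (\<lambda>g. \<chi> i. g i) ` (PiE UNIV (\<lambda>i. {\<lceil>y $ i - D\<rceil>..\<lfloor>y $ i + D\<rfloor>}))"
    by (intro image_eqI[of _ _ "\<lambda>i. m $ i"]) (auto simp: vec_eq_iff)
qed

lemma finite_near [simp]: "finite (near D (y :: real ^ 'n))"
  by (rule finite_subset[OF near_subset_image]) (auto intro!: finite_PiE)

lemma card_near:
  assumes "0 \<le> D" shows "real (card (near D (y :: real ^ 'n))) \<le> (2 * D + 1) ^ CARD('n)"
proof -
  have "card (near D y) \<le> card (PiE (UNIV :: 'n set) (\<lambda>i. {\<lceil>y $ i - D\<rceil>..\<lfloor>y $ i + D\<rfloor>}))"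
    by (rule order_trans[OF card_mono[OF _ near_subset_image] card_image_le]) (auto intro!: finite_PiE)
  then have "real (card (near D y)) \<le> (\<Prod>i\<in>(UNIV :: 'n set). real (card {\<lceil>y $ i - D\<rceil>..\<lfloor>y $ i + D\<rfloor>}))"
    by (simp add: card_PiE of_nat_prod[symmetric] del: of_nat_prod)
  also have "\<dots> \<le> (\<Prod>i\<in>(UNIV :: 'n set). 2 * D + 1)"
    by (intro prod_mono) (use card_int_interval[OF assms] in auto)
  finally show ?thesis by simp
qed

section \<open>A smooth partition of unity\<close>

text \<open>Half-open, so that the cells of one mesh partition the space.\<close>

definition cell :: "real \<Rightarrow> int ^ 'n \<Rightarrow> real ^ 'n \<Rightarrow> complex" where
  "cell N l y = (if \<forall>i. N * (of_int (l $ i) - 1 / 2) \<le> y $ i \<and> y $ i < N * (of_int (l $ i) + 1 / 2) then 1 else 0)"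

text \<open>The indicator functions of the cells of a lattice with mesh \<open>2 (K+1)\<close>, mollified \<open>K + 1\<close> times at
unit scale and rescaled to mesh \<open>1\<close>. Mollification spreads the support by \<open>K + 1\<close>, which after
rescaling is \<open>1/2\<close>, so the parts are supported in the closed cubes \<open>Q\<^sub>0\<^sub>,\<^sub>l\<close>.\<close>

definition unity_part :: "nat \<Rightarrow> int ^ 'n \<Rightarrow> real ^ 'n \<Rightarrow> complex" where
  "unity_part K l x = smoothing (Suc K) (cell (2 * real (Suc K)) l) ((2 * real (Suc K)) *\<^sub>R x)"

definition unity_part_const :: "nat \<Rightarrow> 'n::finite itself \<Rightarrow> real" where
  "unity_part_const K _ = (2 * real (Suc K)) ^ K * mollify_const TYPE('n) ^ K"

lemma cell_borel_le: "borel_le 1 (cell N l)"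
proof -
  have "{y. \<forall>i. N * (of_int (l $ i) - 1 / 2) \<le> y $ i \<and> y $ i < N * (of_int (l $ i) + 1 / 2)} \<in> sets borel"
    by measurable
  then show ?thesis unfolding borel_le_def cell_def[abs_def] by (auto intro!: measurable_If)
qed

lemma smoothing_cell_borel_le: "borel_le 1 (smoothing r (cell N l))"
  by (induction r) (auto intro: cell_borel_le Ck_le_borel_le Ck_le_0_mollify)

text \<open>Mollification is linear and preserves constants, so it preserves partitions of unity.\<close>

lemma smoothing_cell_sum:
  assumes "0 < N" "finite F" "\<And>l. (\<forall>i. \<bar>y $ i - N * of_int (l $ i)\<bar> \<le> N / 2 + real r) \<Longrightarrow> l \<in> F"
  shows "(\<Sum>l\<in>F. smoothing r (cell N l) y) = 1"
  using assms(3)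
proof (induction r arbitrary: y)
  case 0
  \<comment> \<open>Rounding to the nearest lattice point finds the cell of \<open>y\<close>.\<close>
  define l0 :: "int ^ 'a" where "l0 = (\<chi> i. \<lfloor>y $ i / N + 1 / 2\<rfloor>)"
  have eq: "(N * (of_int k - 1 / 2) \<le> u \<and> u < N * (of_int k + 1 / 2)) \<longleftrightarrow> k = \<lfloor>u / N + 1 / 2\<rfloor>" for u k
  proof -
    have "N * (of_int k - 1 / 2) \<le> u \<longleftrightarrow> of_int k \<le> u / N + 1 / 2"
         "u < N * (of_int k + 1 / 2) \<longleftrightarrow> u / N + 1 / 2 < of_int k + 1"
      using \<open>0 < N\<close> by (auto simp: field_simps)
    then show ?thesis by (auto simp: floor_eq_iff eq_commute[of k])
  qed
  have c: "cell N l y = (if l = l0 then 1 else 0)" for l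
    unfolding cell_def eq by (auto simp: l0_def vec_eq_iff)
  have "l0 \<in> F"
  proof (rule 0, rule allI)
    fix i
    have "N * (of_int (l0 $ i) - 1 / 2) \<le> y $ i \<and> y $ i < N * (of_int (l0 $ i) + 1 / 2)"
      unfolding eq by (simp add: l0_def)
    then show "\<bar>y $ i - N * of_int (l0 $ i)\<bar> \<le> N / 2 + real 0" unfolding abs_le_iff right_diff_distrib distrib_left by linarith
  qed
  then show ?case using \<open>finite F\<close> by (simp add: c sum.delta)
next
  case (Suc r)
  have "(\<Sum>l\<in>F. smoothing (Suc r) (cell N l) y) = mollify (\<lambda>x. \<Sum>l\<in>F. smoothing r (cell N l) x) y"
    unfolding smoothing_Suc by (rule mollify_sum[OF smoothing_cell_borel_le, symmetric])
  also have "\<dots> = mollify (\<lambda>_. 1) y"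
  proof (rule mollify_cong)
    fix z assume z: "norm (y - z) \<le> 1"
    show "(\<Sum>l\<in>F. smoothing r (cell N l) z) = 1"
    proof (intro Suc.IH Suc.prems allI)
      fix l :: "int ^ 'a" and i assume "\<forall>i. \<bar>z $ i - N * of_int (l $ i)\<bar> \<le> N / 2 + real r"
      then have "\<bar>z $ i - N * of_int (l $ i)\<bar> \<le> N / 2 + real r" by blast
      moreover have "\<bar>y $ i - z $ i\<bar> \<le> 1" using component_le_norm_cart[of "y - z" i] z by simp
      ultimately show "\<bar>y $ i - N * of_int (l $ i)\<bar> \<le> N / 2 + real (Suc r)" by linarith
    qed
  qed
  finally show ?case by (simp add: mollify_const_fun)
qed

lemma unity_part_sum:
  assumes "finite F" "near 1 x \<subseteq> F"
  shows "(\<Sum>l\<in>F. unity_part K l x) = 1"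
  unfolding unity_part_def
proof (rule smoothing_cell_sum)
  fix l :: "int ^ 'a"
  let ?N = "2 * real (Suc K)"
  assume *: "\<forall>i. \<bar>(?N *\<^sub>R x) $ i - ?N * of_int (l $ i)\<bar> \<le> ?N / 2 + real (Suc K)"
  have "\<bar>x $ i - of_int (l $ i)\<bar> \<le> 1" for i
  proof -
    have "?N * \<bar>x $ i - of_int (l $ i)\<bar> = \<bar>(?N *\<^sub>R x) $ i - ?N * of_int (l $ i)\<bar>"
      by (simp add: abs_mult_pos' right_diff_distrib del: of_nat_Suc)
    also have "\<dots> \<le> ?N / 2 + real (Suc K)" using * by blast
    also have "?N / 2 + real (Suc K) = ?N * 1" by simp
    finally have "?N * \<bar>x $ i - of_int (l $ i)\<bar> \<le> ?N * 1" .
    then show ?thesis by (subst (asm) mult_le_cancel_left_pos) auto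
  qed
  then show "l \<in> F" using assms by (auto simp: near_def)
qed (use assms in auto)

lemma unity_part_support:
  assumes "unity_part K l x \<noteq> 0"
  shows "l \<in> near 1 x"
proof -
  let ?N = "2 * real (Suc K)"
  obtain y where y: "norm (?N *\<^sub>R x - y) \<le> Suc K" "cell ?N l y \<noteq> 0"
    using smoothing_support[OF assms[unfolded unity_part_def]] by blast
  have "\<bar>x $ i - of_int (l $ i)\<bar> \<le> 1" for i
  proof -
    have A: "\<bar>?N * x $ i - y $ i\<bar> \<le> Suc K" using component_le_norm_cart[of "?N *\<^sub>R x - y" i] y by simp
    have B: "\<bar>y $ i - ?N * of_int (l $ i)\<bar> \<le> ?N / 2"
    proof -
      have "?N * (of_int (l $ i) - 1 / 2) \<le> y $ i \<and> y $ i < ?N * (of_int (l $ i) + 1 / 2)"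
        using y(2) by (meson cell_def)
      then show ?thesis unfolding abs_le_iff right_diff_distrib distrib_left by linarith
    qed
    have "\<bar>u - z\<bar> \<le> 2 * h" if "\<bar>u - w\<bar> \<le> h" "\<bar>w - z\<bar> \<le> 2 * h / 2" for u w z h :: real
      using that by linarith
    from this[OF A B] have "\<bar>?N * x $ i - ?N * of_int (l $ i)\<bar> \<le> ?N * 1" by simp
    then have "?N * \<bar>x $ i - of_int (l $ i)\<bar> \<le> ?N * 1"
      by (simp add: abs_mult_pos' right_diff_distrib[symmetric] del: of_nat_Suc)
    then show ?thesis by (subst (asm) mult_le_cancel_left_pos) auto
  qed
  then show ?thesis by (auto simp: near_def)
qed

text \<open>The first mollification only makes the indicator function continuous; the remaining \<open>K\<close> ones give
\<open>K\<close> derivatives.\<close>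

lemma Ck_le_unity_part: "Ck_le K (unity_part_const K TYPE('n)) (unity_part K (l :: int ^ 'n))"
proof -
  let ?N = "2 * real (Suc K)"
  have "smoothing (Suc K) (cell ?N l) = smoothing K (mollify (cell ?N l))"
    unfolding smoothing_def by (simp add: funpow_swap1)
  moreover have "Ck_le 0 1 (mollify (cell ?N l))" by (rule Ck_le_0_mollify[OF cell_borel_le])
  from Ck_le_smoothing_gain[OF this, of K]
  have "Ck_le K (mollify_const TYPE('n) ^ K) (smoothing K (mollify (cell ?N l)))" by simp
  ultimately have "Ck_le K (mollify_const TYPE('n) ^ K) (smoothing (Suc K) (cell ?N l))" by simp
  from Ck_le_dilate_ge[OF this, of ?N] show ?thesis
    unfolding unity_part_def[abs_def] unity_part_const_def by simp
qed

lemma unity_part_const_pos: "0 < unity_part_const K TYPE('n::finite)"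
  using mollify_const_ge_1[where 'n='n] by (auto simp: unity_part_const_def)

definition cutoff :: "nat \<Rightarrow> real \<Rightarrow> int ^ 'n \<Rightarrow> real ^ 'n \<Rightarrow> complex" where
  "cutoff K D m x = (\<Sum>l\<in>near (D + 1) (rvec m). unity_part K l x)"

lemma cutoff_eq_1:
  assumes "m \<in> near D x"
  shows "cutoff K D m x = 1"
  unfolding cutoff_def
proof (rule unity_part_sum)
  show "near 1 x \<subseteq> near (D + 1) (rvec m)"
  proof
    fix l assume l: "l \<in> near 1 x"
    have "\<bar>of_int (m $ i) - of_int (l $ i) :: real\<bar> \<le> D + 1" for i
    proof -
      have "\<bar>x $ i - of_int (l $ i)\<bar> \<le> 1" "\<bar>x $ i - of_int (m $ i)\<bar> \<le> D"
        using l assms by (auto simp: near_def)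
      then show ?thesis by linarith
    qed
    then show "l \<in> near (D + 1) (rvec m)" by (simp add: near_def)
  qed
qed simp

lemma cutoff_support:
  assumes "cutoff K D m x \<noteq> 0"
  shows "m \<in> near (D + 2) x"
proof -
  obtain l where l: "l \<in> near (D + 1) (rvec m)" "unity_part K l x \<noteq> 0"
    using assms sum.neutral unfolding cutoff_def by metis
  have "\<bar>x $ i - of_int (m $ i)\<bar> \<le> D + 2" for i
  proof -
    have "\<bar>x $ i - of_int (l $ i)\<bar> \<le> 1" "\<bar>of_int (m $ i) - of_int (l $ i) :: real\<bar> \<le> D + 1"
      using l unity_part_support[OF l(2)] by (auto simp: near_def)
    then show ?thesis by linarith
  qed
  then show ?thesis by (simp add: near_def)
qed

lemma Ck_le_cutoff:
  fixes m :: "int ^ 'n"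
  assumes "0 \<le> D"
  shows "Ck_le K ((2 * (D + 1) + 1) ^ CARD('n) * unity_part_const K TYPE('n)) (cutoff K D m)"
proof -
  have "Ck_le K (\<Sum>l\<in>near (D + 1) (rvec m). unity_part_const K TYPE('n)) (cutoff K D m)"
    unfolding cutoff_def[abs_def] by (intro Ck_le_sum Ck_le_unity_part) auto
  then show ?thesis
    by (rule Ck_le_mono) (use card_near[of "D + 1" "rvec m"] assms unity_part_const_pos[of K, where 'n='n] in \<open>auto intro!: mult_right_mono\<close>)
qed

section \<open>Decomposition into smoother atoms\<close>

text \<open>Let \<open>f\<^sub>k = A(2\<^bsup>-k\<^esup> \<cdot>)\<close>, let \<open>G\<^sub>k\<close> be its high-order smoothing, and let \<open>v\<^sub>k = G\<^sub>k - G\<^sub>k\<^sub>-\<^sub>1(\<cdot>/2)\<close>. The functions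
\<open>v\<^sub>k(2\<^sup>k \<cdot>)\<close> telescope to \<open>A\<close>. Derivatives of \<open>v\<^sub>k\<close> up to order \<open>M\<close> are \<open>O(2\<^bsup>-kM\<^esup>)\<close> because \<open>v\<^sub>k\<close> is a
difference of two smoothing errors. For higher orders \<open>M\<close> derivatives are passed to \<open>f\<^sub>k\<close>, where
they produce the factor \<open>2\<^bsup>-kM\<^esup>\<close>, and the remaining ones are absorbed by the smoothing. Cutting \<open>v\<^sub>k\<close>
with the partition of unity gives the atoms of level \<open>k\<close>.\<close>

lemma smooth_atom_decomposition:
  fixes M K :: nat and d :: real
  assumes M: "1 \<le> M" and d: "0 \<le> d"
  obtains C D :: real where "0 < C" "0 \<le> D"
    "\<And>m A. Ck_le M 1 A \<Longrightarrow> (\<And>x. A x \<noteq> 0 \<Longrightarrow> m \<in> near d x) \<Longrightarrow>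
       \<exists>eta b. (\<forall>k l. smooth_atom K 1 k l (b k l :: real ^ 'n \<Rightarrow> complex)) \<and>
         (\<forall>k l. eta k l \<noteq> 0 \<longrightarrow> l \<in> near (D * 2 ^ k) (2 ^ k *\<^sub>R rvec m)) \<and>
         (\<forall>k l. norm (eta k l) \<le> C * (1 / 2) ^ (k * M)) \<and>
         (\<forall>x. ((\<lambda>(k, l). eta k l * b k l x) has_sum A x) UNIV)"
proof -
  define R :: real where "R = (K * CARD('n) + 2) ^ M"
  define P :: real where "P = (\<Sum>r<M. mollify_const TYPE('n) ^ K * 2 ^ r)"
  define C1 :: real where "C1 = (1 + R + P) * (1 + 2 ^ M)"
  define C0 :: real where "C0 = 2 ^ K * C1 * unity_part_const K TYPE('n)"
  define D :: real where "D = d + 2 * M * K + 1"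
  have R: "0 \<le> R" by (simp add: R_def)
  have P: "0 \<le> P" unfolding P_def using mollify_const_ge_1[where 'n='n] by (intro sum_nonneg) auto
  have C1: "0 < C1" unfolding C1_def using R P by (intro mult_pos_pos add_pos_pos add_pos_nonneg) auto
  have C0: "0 < C0" unfolding C0_def using C1 unity_part_const_pos[of K, where 'n='n] by simp
  have D: "0 \<le> D" unfolding D_def using d by simp
  show thesis
  proof (rule that[OF C0 D])
    fix m :: "int ^ 'n" and A :: "real ^ 'n \<Rightarrow> complex"
    assume A: "Ck_le M 1 A" and supp: "\<And>x. A x \<noteq> 0 \<Longrightarrow> m \<in> near d x"
    define t :: "nat \<Rightarrow> real" where "t k = (1 / 2) ^ k" for k
    define f where "f k x = A (t k *\<^sub>R x)" for k x
    define E where "E k = (smoothing_err K ^^ M) (f k)" for k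
    define G where "G k = high_smoothing K M (f k)" for k
    \<comment> \<open>At level \<open>0\<close> there is no coarser approximation to subtract.\<close>
    define v where "v k x = G k x - (if k = 0 then 0 else G (k - 1) ((1 / 2) *\<^sub>R x))" for k x
    have t: "0 < t k" "t k \<le> 1" for k by (auto simp: t_def power_le_one)
    have tnz [simp]: "t k \<noteq> 0" for k using t(1)[of k] by simp
    have tS: "t k = 2 * t (Suc k)" for k by (simp add: t_def)
    have C_A: "C_k M A" using A by (simp add: Ck_le_def)
    have C_f: "C_k M (f k)" for k unfolding f_def[abs_def] by (rule C_k_dilate[OF C_A])
    have D_f: "norm (Dlist is (f k) x) \<le> t k ^ length is" if "length is \<le> M" for "is" k x
    proof -
      have "norm (Dlist is (f k) x) = t k ^ length is * norm (Dlist is A (t k *\<^sub>R x))"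
        unfolding f_def[abs_def] Dlist_dilate[OF C_A that] using t(1)[of k] by (simp add: norm_mult norm_power)
      also have "\<dots> \<le> t k ^ length is * 1"
        using A that t(1)[of k] by (intro mult_left_mono) (auto simp: Ck_le_def)
      finally show ?thesis by simp
    qed
    have Ck_le_f: "Ck_le M 1 (f k)" for k
      unfolding Ck_le_def using C_f order_trans[OF D_f power_le_one] t less_imp_le by blast
    have D_E: "norm (Dlist is (E k) x) \<le> R * t k ^ M" if "length is \<le> M" for "is" k x
      using smoothing_err_iter_bound[OF less_imp_le[OF t(1)] t(2) C_f[of k] D_f that, where K=K and r=M and x=x]
      by (simp add: E_def R_def)
    have Ck_le_E: "Ck_le M (2 ^ M * 1) (E k)" for k unfolding E_def by (rule Ck_le_smoothing_err_iter[OF Ck_le_f])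
    have Ck_le_G: "Ck_le (M + K) (P * 1) (G k)" for k
      unfolding G_def P_def by (rule Ck_le_high_smoothing[OF Ck_le_f])
    have D_G: "norm (Dlist is (G k) x) \<le> P * t k ^ M" if "M \<le> length is" "length is \<le> M + K" for "is" k x
    proof -
      \<comment> \<open>The derivatives at the end of the list act first: \<open>be\<close> goes to \<open>f\<^sub>k\<close> and yields \<open>2\<^bsup>-kM\<^esup>\<close>, while \<open>ga\<close>
        is left to the smoothing.\<close>
      define be where "be = drop (length is - M) is"
      define ga where "ga = take (length is - M) is"
      have l: "is = ga @ be" "length be = M" "length ga \<le> K" using that by (auto simp: be_def ga_def)
      have "Ck_le 0 (t k ^ M) (Dlist be (f k))"
        unfolding Ck_le_0 using Ck_le_continuous[OF Ck_le_Dlist'[OF Ck_le_f, of be]] D_f[of be] l by simp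
      then have "Ck_le (0 + K) (P * t k ^ M) (high_smoothing K M (Dlist be (f k)))"
        unfolding P_def by (rule Ck_le_high_smoothing)
      moreover have "Dlist is (G k) = Dlist ga (high_smoothing K M (Dlist be (f k)))"
        using Dlist_high_smoothing[OF Ck_le_f, of be] l by (simp add: Dlist_append G_def)
      ultimately show ?thesis using l by (simp add: Ck_le_def)
    qed
    have GE: "G k x = f k x - E k x" for k x by (simp add: G_def E_def high_smoothing_def)
    have Ck_le_G': "Ck_le (M + K) (P * 1) (\<lambda>x. G k ((1 / 2) *\<^sub>R x))" for k
      by (rule Ck_le_dilate[OF Ck_le_G]) simp
    have v0: "v 0 = G 0" by (simp add: v_def fun_eq_iff)
    have vS: "v (Suc k) = (\<lambda>x. G (Suc k) x - G k ((1 / 2) *\<^sub>R x))" for k by (simp add: v_def fun_eq_iff)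
    \<comment> \<open>Both approximations are of the same function \<open>A\<close>, which cancels and leaves the two errors.\<close>
    have vSE: "v (Suc k) = (\<lambda>x. E k ((1 / 2) *\<^sub>R x) - E (Suc k) x)" for k
      unfolding vS GE by (simp add: f_def tS[of k] fun_eq_iff)
    have half: "norm (Dlist is (\<lambda>x. g ((1 / 2) *\<^sub>R x)) x) \<le> norm (Dlist is g ((1 / 2) *\<^sub>R x))"
      if "C_k r g" "length is \<le> r" for g :: "real ^ 'n \<Rightarrow> complex" and r "is" x
    proof -
      have "norm (Dlist is (\<lambda>x. g ((1 / 2) *\<^sub>R x)) x) = (1 / 2) ^ length is * norm (Dlist is g ((1 / 2) *\<^sub>R x))"
        unfolding Dlist_dilate[OF that] by (simp add: norm_mult norm_power norm_divide)
      also have "\<dots> \<le> 1 * norm (Dlist is g ((1 / 2) *\<^sub>R x))"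
        by (intro mult_right_mono power_le_one) auto
      finally show ?thesis by simp
    qed
    have tM: "t k ^ M = 2 ^ M * t (Suc k) ^ M" for k by (simp add: tS[of k] power_mult_distrib)
    have C1_ge: "B * t (Suc k) ^ M + B * t k ^ M \<le> C1 * t (Suc k) ^ M" if "0 \<le> B" "B \<le> 1 + R + P" for B k
    proof -
      have "B * t (Suc k) ^ M + B * t k ^ M = B * (1 + 2 ^ M) * t (Suc k) ^ M"
        unfolding tM[of k] by (simp add: algebra_simps)
      also have "\<dots> \<le> C1 * t (Suc k) ^ M"
        unfolding C1_def using that t(1)[of "Suc k"] by (intro mult_right_mono) auto
      finally show ?thesis .
    qed
    have C1_ge': "1 + R \<le> C1" "P \<le> C1"
    proof -
      have "(1 + R + P) * 1 \<le> C1" unfolding C1_def using R P by (intro mult_left_mono) auto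
      then have "1 + R + P \<le> C1" by simp
      then show "1 + R \<le> C1" "P \<le> C1" using R P by auto
    qed
    have Ck_le_v: "Ck_le K (C1 * t k ^ M) (v k)" for k
      unfolding Ck_le_def
    proof (intro conjI allI impI)
      have "Ck_le K (P * 1 + P * 1) (v k)"
      proof (cases k)
        case 0 then show ?thesis unfolding v0 0 using P by (intro Ck_le_mono[OF Ck_le_G]) auto
      next
        case (Suc k')
        have "Ck_le (M + K) (P * 1 + P * 1) (v k)" unfolding Suc vS by (intro Ck_le_diff Ck_le_G Ck_le_G')
        then show ?thesis by (rule Ck_le_mono) auto
      qed
      then show "C_k K (v k)" by (simp add: Ck_le_def)
      fix "is" :: "'n list" and x
      assume l: "length is \<le> K"
      show "norm (Dlist is (v k) x) \<le> C1 * t k ^ M"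
      proof (cases k)
        case 0
        show ?thesis
        proof (cases "length is \<le> M")
          case True
          have "Dlist is (v 0) x = Dlist is (f 0) x - Dlist is (E 0) x"
            unfolding v0 GE[abs_def] using C_f[of 0] Ck_le_E[of 0] True
            by (subst Dlist_diff[of M]) (auto simp: Ck_le_def)
          then have "norm (Dlist is (v 0) x) \<le> 1 + R"
            using D_f[OF True, of 0 x] D_E[OF True, of 0 x] norm_triangle_ineq4[of "Dlist is (f 0) x" "Dlist is (E 0) x"]
            by (simp add: t_def)
          then show ?thesis using C1_ge' 0 by (simp add: t_def)
        next
          case False
          then show ?thesis using D_G[of "is" 0 x] l C1_ge' 0 by (simp add: t_def v0)
        qed
      next
        case (Suc k')
        show ?thesis
        proof (cases "length is \<le> M")
          case True
          have c: "C_k M (E k')" "C_k M (E (Suc k'))" using Ck_le_E by (auto simp: Ck_le_def)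
          have "Dlist is (v k) x = Dlist is (\<lambda>x. E k' ((1 / 2) *\<^sub>R x)) x - Dlist is (E (Suc k')) x"
            unfolding Suc vSE by (subst Dlist_diff[OF C_k_dilate[OF c(1)] c(2) True]) simp
          also have "norm \<dots> \<le> R * t k' ^ M + R * t (Suc k') ^ M"
            by (intro order_trans[OF norm_triangle_ineq4] add_mono D_E[OF True] order_trans[OF half[OF c(1) True] D_E[OF True]])
          also have "\<dots> \<le> C1 * t k ^ M" using C1_ge[of R k'] R P Suc by simp
          finally show ?thesis .
        next
          case False
          have c: "C_k (M + K) (G k')" "C_k (M + K) (G (Suc k'))" using Ck_le_G by (auto simp: Ck_le_def)
          have l': "length is \<le> M + K" "M \<le> length is" using l False by auto
          have "Dlist is (v k) x = Dlist is (G (Suc k')) x - Dlist is (\<lambda>x. G k' ((1 / 2) *\<^sub>R x)) x"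
            unfolding Suc vS by (subst Dlist_diff[OF c(2) C_k_dilate[OF c(1)] l'(1)]) simp
          also have "norm \<dots> \<le> P * t (Suc k') ^ M + P * t k' ^ M"
            by (intro order_trans[OF norm_triangle_ineq4] add_mono D_G l' order_trans[OF half[OF c(1) l'(1)] D_G])
          also have "\<dots> \<le> C1 * t k ^ M" using C1_ge[of P k'] R P Suc by simp
          finally show ?thesis .
        qed
      qed
    qed
    have supp_G: "\<bar>x $ i - 2 ^ k * of_int (m $ i)\<bar> \<le> 2 ^ k * d + M * K" if "G k x \<noteq> 0" for k x i
    proof -
      obtain y where y: "norm (x - y) \<le> M * K" "f k y \<noteq> 0"
        using high_smoothing_support \<open>G k x \<noteq> 0\<close> unfolding G_def by blast
      have "\<bar>t k * y $ i - of_int (m $ i)\<bar> \<le> d"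
        using supp[of "t k *\<^sub>R y"] y by (auto simp: near_def f_def)
      then have "2 ^ k * \<bar>t k * y $ i - of_int (m $ i)\<bar> \<le> 2 ^ k * d" by (intro mult_left_mono) auto
      moreover have "2 ^ k * \<bar>t k * y $ i - of_int (m $ i)\<bar> = \<bar>y $ i - 2 ^ k * of_int (m $ i)\<bar>"
        by (simp add: abs_mult_pos' right_diff_distrib t_def power_one_over)
      moreover have "\<bar>x $ i - y $ i\<bar> \<le> M * K" using component_le_norm_cart[of "x - y" i] y by simp
      ultimately show ?thesis by linarith
    qed
    \<comment> \<open>In its own variable \<open>G\<^sub>k\<^sub>-\<^sub>1(\<cdot>/2)\<close> spreads twice as far as \<open>G\<^sub>k\<close>; this is the \<open>2 M K\<close> in \<open>D\<close>.\<close>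
    have supp_v: "\<bar>x $ i - 2 ^ k * of_int (m $ i)\<bar> \<le> 2 ^ k * d + 2 * M * K" if v: "v k x \<noteq> 0" for k x i
    proof (cases "G k x = 0")
      case False
      moreover have "0 \<le> real M * real K" by simp
      ultimately show ?thesis using supp_G[OF False, of i] unfolding of_nat_mult by linarith
    next
      case True
      then obtain k' where k: "k = Suc k'" using v by (cases k) (auto simp: v0)
      then have "G k' ((1 / 2) *\<^sub>R x) \<noteq> 0" using v True by (simp add: vS)
      from supp_G[OF this, of i] show ?thesis by (simp add: k abs_le_iff field_simps)
    qed
    define eta :: "nat \<Rightarrow> int ^ 'n \<Rightarrow> complex" where
      "eta k l = (if l \<in> near (D * 2 ^ k) (2 ^ k *\<^sub>R rvec m) then of_real (C0 * t k ^ M) else 0)" for k l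
    define b where "b k l x = of_real (1 / (C0 * t k ^ M)) * (v k (2 ^ k *\<^sub>R x) * unity_part K l (2 ^ k *\<^sub>R x))" for k l x
    have pos: "0 < C0 * t k ^ M" for k using C0 t(1)[of k] by simp
    have "smooth_atom K 1 k l (b k l)" for k l
      unfolding smooth_atom_iff_Ck_le
    proof
      have "Ck_le K (2 ^ K * (C1 * t k ^ M) * unity_part_const K TYPE('n)) (\<lambda>x. v k x * unity_part K l x)"
        by (intro Ck_le_mult Ck_le_v Ck_le_unity_part)
      moreover have "2 ^ K * (C1 * t k ^ M) * unity_part_const K TYPE('n) = C0 * t k ^ M"
        by (simp add: C0_def)
      ultimately have "Ck_le K (norm (of_real (1 / (C0 * t k ^ M)) :: complex) * (C0 * t k ^ M))
          (\<lambda>x. of_real (1 / (C0 * t k ^ M)) * (v k x * unity_part K l x))"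
        by (intro Ck_le_cmult) simp
      moreover have "norm (of_real (1 / (C0 * t k ^ M)) :: complex) * (C0 * t k ^ M) = 1"
        unfolding norm_of_real using pos[of k] t(1)[of k] by (subst abs_of_pos) auto
      ultimately show "Ck_le K 1 (\<lambda>x. b k l (x /\<^sub>R 2 ^ k))"
        unfolding b_def by simp
      show "\<forall>x. b k l x \<noteq> 0 \<longrightarrow> x \<in> dcube 1 k l"
        unfolding mem_dcube_iff using unity_part_support by (auto simp: b_def)
    qed
    moreover have "eta k l \<noteq> 0 \<longrightarrow> l \<in> near (D * 2 ^ k) (2 ^ k *\<^sub>R rvec m)" for k l
      by (simp add: eta_def)
    moreover have eta_le: "norm (eta k l) \<le> C0 * (1 / 2) ^ (k * M)" for k l
      using pos[of k] C0 by (auto simp: eta_def t_def power_mult norm_mult norm_power norm_divide)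
    moreover have "((\<lambda>(k, l). eta k l * b k l x) has_sum A x) UNIV" for x
    proof -
      have le1: "(\<Sum>l\<in>near 1 (2 ^ k *\<^sub>R x). eta k l * b k l x) = v k (2 ^ k *\<^sub>R x)" for k
      proof (cases "v k (2 ^ k *\<^sub>R x) = 0")
        case True then show ?thesis by (simp add: b_def)
      next
        case False
        have "eta k l = of_real (C0 * t k ^ M)" if l: "l \<in> near 1 (2 ^ k *\<^sub>R x)" for l
        proof -
          have "\<bar>2 ^ k * of_int (m $ i) - of_int (l $ i)\<bar> \<le> D * 2 ^ k" for i
          proof -
            have "\<bar>2 ^ k * x $ i - of_int (l $ i)\<bar> \<le> 1" using l by (simp add: near_def)
            moreover have "\<bar>2 ^ k * x $ i - 2 ^ k * of_int (m $ i)\<bar> \<le> 2 ^ k * d + 2 * M * K"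
              using supp_v[OF False, of i] by simp
            moreover have "(2 * real M * real K + 1) * 1 \<le> (2 * real M * real K + 1) * 2 ^ k"
              by (rule mult_left_mono) auto
            then have "2 ^ k * d + 2 * M * K + 1 \<le> D * 2 ^ k" by (simp add: D_def algebra_simps)
            ultimately show ?thesis by linarith
          qed
          then show ?thesis by (simp add: eta_def near_def)
        qed
        then have "(\<Sum>l\<in>near 1 (2 ^ k *\<^sub>R x). eta k l * b k l x)
            = (\<Sum>l\<in>near 1 (2 ^ k *\<^sub>R x). v k (2 ^ k *\<^sub>R x) * unity_part K l (2 ^ k *\<^sub>R x))"
          using pos[of k] by (intro sum.cong) (auto simp: b_def)
        also have "\<dots> = v k (2 ^ k *\<^sub>R x)"
          using unity_part_sum[of "near 1 (2 ^ k *\<^sub>R x)" "2 ^ k *\<^sub>R x" K] by (simp add: sum_distrib_left[symmetric])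
        finally show ?thesis .
      qed
      have b0: "b k l x = 0" if "l \<notin> near 1 (2 ^ k *\<^sub>R x)" for k l
        using that unity_part_support by (auto simp: b_def)
      have inner: "((\<lambda>l. eta k l * b k l x) has_sum v k (2 ^ k *\<^sub>R x)) UNIV" for k
        by (rule has_sum_finite_neutralI[of "near 1 (2 ^ k *\<^sub>R x)"]) (auto simp: le1 b0)
      have geo: "summable (\<lambda>k. c * t k ^ M)" for c
      proof -
        have "(1 / 2 :: real) ^ M < 1" using M by (simp add: power_one_over)
        then have "summable (\<lambda>k. c * ((1 / 2) ^ M) ^ k)"
          by (intro summable_mult summable_geometric) simp
        then show ?thesis by (simp add: t_def power_mult[symmetric] mult.commute)
      qed
      have vb: "norm (v k y) \<le> C1 * t k ^ M" for k y using Ck_le_bound[OF Ck_le_v] .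
      have outer: "((\<lambda>k. v k (2 ^ k *\<^sub>R x)) has_sum A x) UNIV"
      proof (rule norm_summable_imp_has_sum)
        show "summable (\<lambda>k. norm (v k (2 ^ k *\<^sub>R x)))"
          by (rule summable_comparison_test[OF _ geo[of C1]]) (use vb in auto)
        have tel: "(\<Sum>k<Suc r. v k (2 ^ k *\<^sub>R x)) = G r (2 ^ r *\<^sub>R x)" for r
          by (induction r) (auto simp: v0 vS)
        have Ab: "G r (2 ^ r *\<^sub>R x) = A x - E r (2 ^ r *\<^sub>R x)" for r
          by (simp add: GE f_def t_def power_one_over)
        have "(\<lambda>r. E r (2 ^ r *\<^sub>R x)) \<longlonglongrightarrow> 0"
        proof (rule Lim_null_comparison)
          show "\<forall>\<^sub>F r in sequentially. norm (E r (2 ^ r *\<^sub>R x)) \<le> R * t r ^ M"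
            using D_E[of "[]"] by auto
          show "(\<lambda>r. R * t r ^ M) \<longlonglongrightarrow> 0" using summable_LIMSEQ_zero[OF geo] .
        qed
        then have "(\<lambda>r. A x - E r (2 ^ r *\<^sub>R x)) \<longlonglongrightarrow> A x - 0" by (intro tendsto_intros)
        then have "(\<lambda>r. \<Sum>k<Suc r. v k (2 ^ k *\<^sub>R x)) \<longlonglongrightarrow> A x"
          unfolding tel Ab by simp
        then show "(\<lambda>k. v k (2 ^ k *\<^sub>R x)) sums A x"
          unfolding sums_def by (subst (asm) filterlim_sequentially_Suc)
      qed
      have "(\<lambda>(k, l). eta k l * b k l x) summable_on (SIGMA k:UNIV. UNIV)"
      proof (rule Infinite_Sum.abs_summable_summable, rule Infinite_Sum.abs_summable_on_Sigma_iff[THEN iffD2], intro conjI ballI)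
        show "(\<lambda>l. norm (case (k, l) of (k, l) \<Rightarrow> eta k l * b k l x)) summable_on UNIV" for k
          using inner[of k] by (auto simp: summable_on_iff_abs_summable_on_complex[symmetric] has_sum_imp_summable)
        have inf: "(\<Sum>\<^sub>\<infinity>l. norm (eta k l * b k l x)) \<le> 3 ^ CARD('n) * C1 * unity_part_const K TYPE('n) * t k ^ M" for k
        proof -
          have "(\<Sum>\<^sub>\<infinity>l. norm (eta k l * b k l x)) = (\<Sum>l\<in>near 1 (2 ^ k *\<^sub>R x). norm (eta k l * b k l x))"
            by (intro infsumI has_sum_finite_neutralI[of "near 1 (2 ^ k *\<^sub>R x)"]) (auto simp: b0)
          also have "\<dots> \<le> (\<Sum>l\<in>near 1 (2 ^ k *\<^sub>R x). C1 * t k ^ M * unity_part_const K TYPE('n))"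
          proof (rule sum_mono)
            fix l
            have "norm (eta k l * b k l x) \<le> norm (v k (2 ^ k *\<^sub>R x) * unity_part K l (2 ^ k *\<^sub>R x))"
              using pos[of k] by (auto simp: eta_def b_def norm_mult norm_divide)
            also have "\<dots> \<le> C1 * t k ^ M * unity_part_const K TYPE('n)"
              unfolding norm_mult using vb Ck_le_bound[OF Ck_le_unity_part, of K l] C1 t(1)[of k]
              by (intro mult_mono) auto
            finally show "norm (eta k l * b k l x) \<le> C1 * t k ^ M * unity_part_const K TYPE('n)" .
          qed
          also have "\<dots> \<le> 3 ^ CARD('n) * (C1 * t k ^ M * unity_part_const K TYPE('n))"
            using card_near[of 1 "2 ^ k *\<^sub>R x"] C1 t(1)[of k] unity_part_const_pos[of K, where 'n='n]
            by (auto intro!: mult_right_mono)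
          finally show ?thesis by (simp add: mult_ac)
        qed
        have "summable (\<lambda>k. \<Sum>\<^sub>\<infinity>l. norm (eta k l * b k l x))"
          by (rule summable_comparison_test[OF _ geo[of "3 ^ CARD('n) * C1 * unity_part_const K TYPE('n)"]])
             (use inf in \<open>auto simp: infsum_nonneg\<close>)
        then show "(\<lambda>k. norm (\<Sum>\<^sub>\<infinity>l. norm (case (k, l) of (k, l) \<Rightarrow> eta k l * b k l x))) summable_on UNIV"
          by (intro norm_summable_imp_summable_on) (auto simp: infsum_nonneg)
      qed
      from has_sum_SigmaI[OF _ outer this] inner show ?thesis by simp
    qed
    ultimately show "\<exists>eta b. (\<forall>k l. smooth_atom K 1 k l (b k l :: real ^ 'n \<Rightarrow> complex)) \<and>
         (\<forall>k l. eta k l \<noteq> 0 \<longrightarrow> l \<in> near (D * 2 ^ k) (2 ^ k *\<^sub>R rvec m)) \<and>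
         (\<forall>k l. norm (eta k l) \<le> C0 * (1 / 2) ^ (k * M)) \<and>
         (\<forall>x. ((\<lambda>(k, l). eta k l * b k l x) has_sum A x) UNIV)"
      by blast
  qed
qed

section \<open>Quasi-norms over a measure space\<close>

lemma epowr_ennreal: "0 \<le> a \<Longrightarrow> epowr (ennreal a) r = ennreal (a powr r)"
  by (simp add: epowr_def)

lemma epowr_top [simp]: "epowr \<infinity> r = \<infinity>" "epowr top r = \<infinity>"
  by (simp_all add: epowr_def)

lemma epowr_0 [simp]: "epowr 0 r = 0"
  by (simp add: epowr_def)

lemma epowr_mono: "0 < r \<Longrightarrow> x \<le> y \<Longrightarrow> epowr x r \<le> epowr y r"
  by (cases x; cases y) (auto simp: epowr_ennreal powr_mono2 top_unique intro!: ennreal_leI)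

lemma epowr_mult: "0 < r \<Longrightarrow> epowr (x * y) r = epowr x r * epowr y r"
  by (cases x; cases y)
     (auto simp: epowr_ennreal powr_mult ennreal_mult[symmetric] ennreal_mult_top ennreal_top_mult epowr_def)

lemma epowr_epowr: "0 < r \<Longrightarrow> 0 < t \<Longrightarrow> epowr (epowr x r) t = epowr x (r * t)"
  by (cases x) (auto simp: epowr_ennreal powr_powr)

lemma epowr_1 [simp]: "epowr x 1 = x"
  by (cases x) (auto simp: epowr_ennreal)

lemma epowr_inverse: "0 < r \<Longrightarrow> epowr (epowr x r) (1 / r) = x" "0 < r \<Longrightarrow> epowr (epowr x (1 / r)) r = x"
  by (simp_all add: epowr_epowr)

lemma epowr_le_iff: "0 < r \<Longrightarrow> epowr x r \<le> y \<longleftrightarrow> x \<le> epowr y (1 / r)"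
  by (metis epowr_inverse epowr_mono zero_less_divide_1_iff)

lemma epowr_eq_0_iff: "0 < r \<Longrightarrow> epowr x r = 0 \<longleftrightarrow> x = 0"
  by (metis epowr_0 epowr_inverse(1))

lemma epowr_measurable [measurable (raw)]:
  assumes [measurable]: "g \<in> borel_measurable M"
  shows "(\<lambda>x. epowr (g x) r) \<in> borel_measurable M"
  unfolding epowr_def by measurable

lemma infsum_nat_ennreal:
  fixes f :: "nat \<Rightarrow> ennreal"
  shows "(\<Sum>\<^sub>\<infinity>n. f n) = (\<Sum>n. f n)"
proof -
  have "f summable_on UNIV" by (rule nonneg_summable_on_complete) simp
  then show ?thesis using has_sum_imp_sums[OF has_sum_infsum, of f] by (simp add: sums_iff)
qed

lemma infsum_countable:
  fixes f :: "'i::countable \<Rightarrow> ennreal"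
  shows "(\<Sum>\<^sub>\<infinity>i. f i) = (\<Sum>n. if n \<in> range (to_nat :: 'i \<Rightarrow> nat) then f (from_nat n) else 0)"
proof -
  have "(\<Sum>\<^sub>\<infinity>i. f i) = (\<Sum>\<^sub>\<infinity>n\<in>range (to_nat :: 'i \<Rightarrow> nat). f (from_nat n))"
    by (subst infsum_reindex) (auto simp: comp_def)
  also have "\<dots> = (\<Sum>\<^sub>\<infinity>n. if n \<in> range (to_nat :: 'i \<Rightarrow> nat) then f (from_nat n) else 0)"
    by (rule infsum_cong_neutral) auto
  finally show ?thesis by (simp only: infsum_nat_ennreal)
qed

lemma nn_integral_count_space_infsum:
  fixes f :: "'i::countable \<Rightarrow> ennreal"
  shows "(\<integral>\<^sup>+i. f i \<partial>count_space UNIV) = (\<Sum>\<^sub>\<infinity>i. f i)"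
proof -
  have "(\<integral>\<^sup>+i. f i \<partial>count_space UNIV) = (\<integral>\<^sup>+n. f (from_nat n) \<partial>count_space (range (to_nat :: 'i \<Rightarrow> nat)))"
  proof -
    have "bij_betw (to_nat :: 'i \<Rightarrow> nat) UNIV (range (to_nat :: 'i \<Rightarrow> nat))" by (simp add: bij_betw_def)
    from nn_integral_bij_count_space[OF this, of "\<lambda>n. f (from_nat n)"] show ?thesis by simp
  qed
  also have "\<dots> = (\<integral>\<^sup>+n. (if n \<in> range (to_nat :: 'i \<Rightarrow> nat) then f (from_nat n) else 0) \<partial>count_space UNIV)"
    by (subst nn_integral_count_space_indicator) (auto intro!: nn_integral_cong simp: indicator_def)
  finally show ?thesis by (simp only: nn_integral_count_space_nat infsum_countable)
qed

lemma infsum_measurable [measurable (raw)]: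
  fixes f :: "'i::countable \<Rightarrow> 'a \<Rightarrow> ennreal"
  assumes [measurable]: "\<And>i. f i \<in> borel_measurable M"
  shows "(\<lambda>x. \<Sum>\<^sub>\<infinity>i. f i x) \<in> borel_measurable M"
  unfolding infsum_countable by measurable

lemma nn_integral_infsum:
  fixes f :: "'i::countable \<Rightarrow> 'a \<Rightarrow> ennreal"
  assumes [measurable]: "\<And>i. f i \<in> borel_measurable M"
  shows "(\<integral>\<^sup>+x. (\<Sum>\<^sub>\<infinity>i. f i x) \<partial>M) = (\<Sum>\<^sub>\<infinity>i. \<integral>\<^sup>+x. f i x \<partial>M)"
  unfolding infsum_countable
  by (subst nn_integral_suminf) (auto intro!: suminf_cong)

lemma infsum_cmult_ennreal:
  fixes f :: "'i::countable \<Rightarrow> ennreal"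
  shows "(\<Sum>\<^sub>\<infinity>i. c * f i) = c * (\<Sum>\<^sub>\<infinity>i. f i)"
  unfolding nn_integral_count_space_infsum[symmetric] by (rule nn_integral_cmult) auto

lemma infsum_mono_ennreal:
  fixes f g :: "'i::countable \<Rightarrow> ennreal"
  shows "(\<And>i. f i \<le> g i) \<Longrightarrow> (\<Sum>\<^sub>\<infinity>i. f i) \<le> (\<Sum>\<^sub>\<infinity>i. g i)"
  unfolding nn_integral_count_space_infsum[symmetric] by (rule nn_integral_mono)

lemma infsum_ge_term:
  fixes f :: "'i::countable \<Rightarrow> ennreal"
  shows "f i \<le> (\<Sum>\<^sub>\<infinity>i. f i)"
  unfolding nn_integral_count_space_infsum[symmetric] by (rule nn_integral_ge_point) simp

text \<open>One functional covers \<open>L\<^sub>p\<close> (Lebesgue measure) and \<open>\<ell>\<^sub>p\<close> (counting measure), so that each inequality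
below is proved once. Working with extended nonnegative functions avoids all summability
conditions.\<close>

definition Lqnorm :: "ennreal \<Rightarrow> 'a measure \<Rightarrow> ('a \<Rightarrow> ennreal) \<Rightarrow> ennreal" where
  "Lqnorm p M g = (if p = \<infinity> then esssup M g
     else epowr (\<integral>\<^sup>+x. epowr (g x) (enn2real p) \<partial>M) (1 / enn2real p))"

abbreviation lqnorm :: "ennreal \<Rightarrow> ('i \<Rightarrow> ennreal) \<Rightarrow> ennreal" where
  "lqnorm p \<equiv> Lqnorm p (count_space UNIV)"

lemma exponent_pos: "0 < p \<Longrightarrow> p \<noteq> \<infinity> \<Longrightarrow> 0 < enn2real p"
  by (simp add: enn2real_positive_iff less_top)

lemma ell_qnorm_eq:
  fixes x :: "'i::countable \<Rightarrow> ennreal"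
  shows "ell_qnorm p x = lqnorm p x"
proof (cases "p = \<infinity>")
  case True
  have "esssup (count_space UNIV) x = (SUP i. x i)"
  proof (rule antisym)
    show "esssup (count_space UNIV) x \<le> (SUP i. x i)"
      by (rule esssup_I) (auto simp: AE_count_space SUP_upper)
    show "(SUP i. x i) \<le> esssup (count_space UNIV) x"
      using esssup_AE[of x "count_space UNIV"] by (intro SUP_least) (simp add: AE_count_space)
  qed
  then show ?thesis using True by (simp add: ell_qnorm_def Lqnorm_def)
qed (simp add: ell_qnorm_def Lqnorm_def nn_integral_count_space_infsum)

lemma Lp_qnorm_eq: "Lp_qnorm p f = Lqnorm p lebesgue (\<lambda>x. ennreal (norm (f x)))"
  by (simp add: Lp_qnorm_def Lqnorm_def epowr_ennreal)

lemma Lqnorm_mono_AE: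
  assumes "0 < p" "f \<in> borel_measurable M" "AE x in M. f x \<le> g x"
  shows "Lqnorm p M f \<le> Lqnorm p M g"
proof (cases "p = \<infinity>")
  case True then show ?thesis using assms by (simp add: Lqnorm_def esssup_AE_mono)
next
  case False
  note r = exponent_pos[OF assms(1) False]
  have "AE x in M. epowr (f x) (enn2real p) \<le> epowr (g x) (enn2real p)"
    using assms(3) by eventually_elim (rule epowr_mono[OF r])
  then show ?thesis using False r by (auto simp: Lqnorm_def intro!: epowr_mono nn_integral_mono_AE)
qed

lemma Lqnorm_mono:
  assumes "0 < p" "f \<in> borel_measurable M" "\<And>x. f x \<le> g x"
  shows "Lqnorm p M f \<le> Lqnorm p M g"
  using Lqnorm_mono_AE[OF assms(1,2)] assms(3) by auto

lemma lqnorm_mono: "0 < p \<Longrightarrow> (\<And>x. f x \<le> g x) \<Longrightarrow> lqnorm p f \<le> lqnorm p g"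
  by (rule Lqnorm_mono) auto

lemma AE_le_Lqnorm_top: "AE x in M. g x \<le> Lqnorm \<infinity> M g"
  by (simp add: Lqnorm_def esssup_AE)

lemma Lqnorm_topI: "g \<in> borel_measurable M \<Longrightarrow> AE x in M. g x \<le> c \<Longrightarrow> Lqnorm \<infinity> M g \<le> c"
  by (simp add: Lqnorm_def esssup_I)

lemma Lqnorm_powr: "0 < p \<Longrightarrow> p \<noteq> \<infinity> \<Longrightarrow>
    epowr (Lqnorm p M g) (enn2real p) = (\<integral>\<^sup>+x. epowr (g x) (enn2real p) \<partial>M)"
  using exponent_pos[of p] by (simp add: Lqnorm_def epowr_inverse)

lemma Lqnorm_leI: "0 < p \<Longrightarrow> p \<noteq> \<infinity> \<Longrightarrow>
    (\<integral>\<^sup>+x. epowr (g x) (enn2real p) \<partial>M) \<le> epowr c (enn2real p) \<Longrightarrow> Lqnorm p M g \<le> c"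
  using exponent_pos[of p] by (subst Lqnorm_def) (simp add: epowr_le_iff)

lemma Lqnorm_cmult_le:
  assumes "0 < p" "g \<in> borel_measurable M"
  shows "Lqnorm p M (\<lambda>x. c * g x) \<le> c * Lqnorm p M g"
proof (cases "p = \<infinity>")
  case True
  have "AE x in M. c * g x \<le> c * Lqnorm \<infinity> M g"
    using AE_le_Lqnorm_top[of g M] by eventually_elim (rule mult_left_mono, auto)
  then show ?thesis unfolding True using assms(2) by (intro Lqnorm_topI) auto
next
  case False
  note r = exponent_pos[OF assms(1) False]
  show ?thesis
    by (rule Lqnorm_leI) (use assms False r in \<open>auto simp: epowr_mult Lqnorm_powr nn_integral_cmult\<close>)
qed

lemma Lqnorm_cmult:
  assumes "0 < p" "g \<in> borel_measurable M" "0 < a"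
  shows "Lqnorm p M (\<lambda>x. ennreal a * g x) = ennreal a * Lqnorm p M g"
proof (rule antisym)
  have c: "ennreal a * (ennreal (1 / a) * y) = y" "ennreal (1 / a) * (ennreal a * y) = y" for y
    using assms(3) by (simp_all add: mult.assoc[symmetric] ennreal_mult[symmetric])
  have "Lqnorm p M (\<lambda>x. ennreal (1 / a) * (ennreal a * g x)) \<le> ennreal (1 / a) * Lqnorm p M (\<lambda>x. ennreal a * g x)"
    by (rule Lqnorm_cmult_le) (use assms in auto)
  then have "Lqnorm p M g \<le> ennreal (1 / a) * Lqnorm p M (\<lambda>x. ennreal a * g x)" unfolding c(2) .
  then have "ennreal a * Lqnorm p M g \<le> ennreal a * (ennreal (1 / a) * Lqnorm p M (\<lambda>x. ennreal a * g x))"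
    by (rule mult_left_mono) simp
  then show "ennreal a * Lqnorm p M g \<le> Lqnorm p M (\<lambda>x. ennreal a * g x)" unfolding c(1) .
qed (rule Lqnorm_cmult_le[OF assms(1,2)])

lemma Lqnorm_zero: "0 < p \<Longrightarrow> Lqnorm p M (\<lambda>x. 0) = 0"
  using Lqnorm_cmult_le[of p "\<lambda>x. 0" M 0] by simp

lemma Lqnorm_eq_0_AE:
  assumes p: "0 < p" and g: "g \<in> borel_measurable M" and 0: "Lqnorm p M g = 0"
  shows "AE x in M. g x = 0"
proof (cases "p = \<infinity>")
  case True
  then show ?thesis using AE_le_Lqnorm_top[of g M] 0 by simp
next
  case False
  note r = exponent_pos[OF p False]
  have "(\<integral>\<^sup>+x. epowr (g x) (enn2real p) \<partial>M) = 0"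
    using Lqnorm_powr[OF p False, of M g] 0 by simp
  then have "AE x in M. epowr (g x) (enn2real p) = 0"
    using g by (subst (asm) nn_integral_0_iff_AE) auto
  then show ?thesis using r by (simp add: epowr_eq_0_iff)
qed

lemma lqnorm_ge_term:
  fixes x :: "'i::countable \<Rightarrow> ennreal"
  assumes p: "0 < p"
  shows "x i \<le> lqnorm p x"
proof (cases "p = \<infinity>")
  case True
  then show ?thesis using AE_le_Lqnorm_top[of x "count_space UNIV"] by (simp add: AE_count_space)
next
  case False
  note r = exponent_pos[OF p False]
  have "epowr (x i) (enn2real p) \<le> (\<Sum>\<^sub>\<infinity>i. epowr (x i) (enn2real p))"
    by (rule infsum_ge_term)
  then show ?thesis using False r by (simp add: Lqnorm_def nn_integral_count_space_infsum epowr_le_iff)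
qed

lemma suminf_geometric_ennreal:
  assumes "0 < e"
  shows "(\<Sum>i. ennreal (2 powr (- e * real i))) = ennreal (1 / (1 - 2 powr (- e)))"
proof -
  define u :: real where "u = 2 powr (- e)"
  have u: "0 \<le> u" "u < 1" using assms by (auto simp: u_def powr_less_one)
  have "2 powr (- e * real i) = u ^ i" for i
    unfolding u_def by (simp add: powr_realpow[symmetric] powr_powr)
  moreover have "(\<Sum>i. ennreal (u ^ i)) = ennreal (\<Sum>i. u ^ i)"
    using u by (intro suminf_ennreal2 summable_geometric) auto
  ultimately show ?thesis
    using suminf_geometric[of u] u unfolding u_def[symmetric] by simp
qed

lemma suminf_geometric_ennreal_mult:
  assumes "0 < e"
  shows "(\<Sum>i. ennreal (2 powr (- e * real i)) * T) = ennreal (1 / (1 - 2 powr (- e))) * T"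
  by (simp only: ennreal_suminf_multc suminf_geometric_ennreal[OF assms])

lemma powr2_cancel: "ennreal (2 powr (- a)) * (ennreal (2 powr a) * x) = x"
  by (simp add: mult.assoc[symmetric] ennreal_mult[symmetric] powr_add[symmetric])

text \<open>With \<open>c = \<Sum>\<^sub>i 2\<^bsup>-\<epsilon>i/2\<^esup>\<close> one has \<open>\<Sum>\<^sub>i g\<^sub>i \<le> c sup\<^sub>i 2\<^bsup>\<epsilon>i/2\<^esup> g\<^sub>i\<close> pointwise, and for finite \<open>p\<close> the \<open>p\<close>-th power of a supremum is at
most the sum of the \<open>p\<close>-th powers. The other half of the weight makes the resulting sum of
integrals converge. The argument is the same for \<open>p < 1\<close> and \<open>p \<ge> 1\<close>.\<close>

lemma Lqnorm_suminf:
  assumes p: "0 < p" and e: "0 < e"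
  obtains C :: real where "0 < C"
    "\<And>(M :: 'a measure) (g :: nat \<Rightarrow> 'a \<Rightarrow> ennreal). (\<And>i. g i \<in> borel_measurable M) \<Longrightarrow>
       Lqnorm p M (\<lambda>x. \<Sum>i::nat. g i x) \<le> ennreal C * (SUP i. ennreal (2 powr (e * real i)) * Lqnorm p M (g i))"
proof (cases "p = \<infinity>")
  case True
  define C where "C = 1 / (1 - 2 powr (- e))"
  have C: "0 < C" using e by (simp add: C_def powr_less_one)
  show thesis
  proof (rule that[OF C])
    fix M :: "'a measure" and g :: "nat \<Rightarrow> 'a \<Rightarrow> ennreal" assume g [measurable]: "\<And>i. g i \<in> borel_measurable M"
    define S where "S = (SUP i. ennreal (2 powr (e * real i)) * Lqnorm p M (g i))"
    have "AE x in M. \<forall>i. g i x \<le> Lqnorm p M (g i)"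
      using AE_le_Lqnorm_top True by (auto simp: AE_all_countable)
    then have "AE x in M. (\<Sum>i. g i x) \<le> ennreal C * S"
    proof eventually_elim
      case (elim x)
      have "g i x \<le> ennreal (2 powr (- e * real i)) * S" for i
      proof -
        have "g i x \<le> ennreal (2 powr (- (e * real i))) * (ennreal (2 powr (e * real i)) * Lqnorm p M (g i))"
          unfolding powr2_cancel using elim by blast
        also have "\<dots> \<le> ennreal (2 powr (- (e * real i))) * S"
          unfolding S_def by (intro mult_left_mono SUP_upper) auto
        finally show ?thesis by simp
      qed
      then have "(\<Sum>i. g i x) \<le> (\<Sum>i. ennreal (2 powr (- e * real i)) * S)"
        by (intro suminf_le) auto
      also have "\<dots> = ennreal C * S"
        unfolding C_def by (rule suminf_geometric_ennreal_mult[OF e])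
      finally show ?case .
    qed
    then have "Lqnorm \<infinity> M (\<lambda>x. \<Sum>i. g i x) \<le> ennreal C * S" by (intro Lqnorm_topI) auto
    then show "Lqnorm p M (\<lambda>x. \<Sum>i. g i x) \<le> ennreal C * (SUP i. ennreal (2 powr (e * real i)) * Lqnorm p M (g i))"
      unfolding S_def by (simp only: True)
  qed
next
  case False
  define r where "r = enn2real p"
  have r: "0 < r" unfolding r_def using exponent_pos[OF p False] .
  define c where "c = 1 / (1 - 2 powr (- (e / 2)))"
  define c' where "c' = 1 / (1 - 2 powr (- (e * r / 2)))"
  define C where "C = c * c' powr (1 / r)"
  have c: "0 < c" "0 < c'" using e r by (auto simp: c_def c'_def powr_less_one)
  then have C: "0 < C" by (simp add: C_def)
  show thesis
  proof (rule that[OF C])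
    fix M :: "'a measure" and g :: "nat \<Rightarrow> 'a \<Rightarrow> ennreal" assume g [measurable]: "\<And>i. g i \<in> borel_measurable M"
    define S where "S = (SUP i. ennreal (2 powr (e * real i)) * Lqnorm p M (g i))"
    \<comment> \<open>Half of the exponent \<open>e\<close> is spent on the pointwise bound, half is kept for the integrals.\<close>
    define w :: "nat \<Rightarrow> ennreal" where "w i = ennreal (2 powr (e / 2 * real i))" for i
    have pw: "epowr (\<Sum>i. g i x) r \<le> epowr (ennreal c) r * (\<Sum>i. epowr (w i) r * epowr (g i x) r)" for x
    proof -
      define T where "T = epowr (\<Sum>i. epowr (w i * g i x) r) (1 / r)"
      have "w i * g i x \<le> T" for i
      proof -
        have "epowr (w i * g i x) r \<le> (\<Sum>i. epowr (w i * g i x) r)"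
          using infsum_ge_term[of "\<lambda>i. epowr (w i * g i x) r" i] by (simp add: infsum_nat_ennreal)
        then show ?thesis unfolding T_def using r by (simp add: epowr_le_iff)
      qed
      then have "g i x \<le> ennreal (2 powr (- (e / 2) * real i)) * T" for i
        using mult_left_mono[of "w i * g i x" T "ennreal (2 powr (- (e / 2 * real i)))"]
        unfolding w_def powr2_cancel by simp
      then have "(\<Sum>i. g i x) \<le> (\<Sum>i. ennreal (2 powr (- (e / 2) * real i)) * T)"
        by (intro suminf_le) auto
      also have "\<dots> = ennreal c * T"
        unfolding c_def by (rule suminf_geometric_ennreal_mult) (use e in simp)
      finally have "epowr (\<Sum>i. g i x) r \<le> epowr (ennreal c) r * epowr T r"
        by (metis epowr_mono[OF r] epowr_mult[OF r])
      then show ?thesis using r by (simp add: T_def epowr_inverse epowr_mult)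
    qed
    have "(\<integral>\<^sup>+x. epowr (\<Sum>i. g i x) r \<partial>M) \<le> (\<integral>\<^sup>+x. epowr (ennreal c) r * (\<Sum>i. epowr (w i) r * epowr (g i x) r) \<partial>M)"
      by (intro nn_integral_mono pw)
    also have "\<dots> = epowr (ennreal c) r * (\<Sum>i. epowr (w i) r * epowr (Lqnorm p M (g i)) r)"
      using p False r by (simp add: nn_integral_cmult nn_integral_suminf Lqnorm_powr r_def)
    also have "\<dots> \<le> epowr (ennreal c) r * (\<Sum>i. ennreal (2 powr (- (e * r / 2) * real i)) * epowr S r)"
    proof (intro mult_left_mono suminf_le)
      fix i
      have "epowr (w i) r * epowr (Lqnorm p M (g i)) r = epowr (w i * Lqnorm p M (g i)) r"
        using r by (simp add: epowr_mult)
      also have "w i * Lqnorm p M (g i) = ennreal (2 powr (- (e / 2 * real i))) * (ennreal (2 powr (e * real i)) * Lqnorm p M (g i))"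
        unfolding w_def mult.assoc[symmetric] ennreal_mult[symmetric, OF powr_ge_zero powr_ge_zero] powr_add[symmetric]
        by simp
      also have "\<dots> \<le> ennreal (2 powr (- (e / 2 * real i))) * S"
        unfolding S_def by (intro mult_left_mono SUP_upper) auto
      finally have "epowr (w i) r * epowr (Lqnorm p M (g i)) r \<le> epowr (ennreal (2 powr (- (e / 2 * real i))) * S) r"
        using epowr_mono[OF r] by auto
      also have "\<dots> = ennreal (2 powr (- (e * r / 2) * real i)) * epowr S r"
        using r by (simp add: epowr_mult epowr_ennreal powr_powr mult_ac)
      finally show "epowr (w i) r * epowr (Lqnorm p M (g i)) r \<le> ennreal (2 powr (- (e * r / 2) * real i)) * epowr S r" .
    qed auto
    also have "\<dots> = epowr (ennreal C * S) r"
    proof -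
      have "(\<Sum>i. ennreal (2 powr (- (e * r / 2) * real i)) * epowr S r) = ennreal c' * epowr S r"
        unfolding c'_def by (rule suminf_geometric_ennreal_mult) (use e r in simp)
      moreover have "epowr (ennreal C) r = epowr (ennreal c) r * ennreal c'"
        using c r by (simp add: C_def epowr_mult epowr_ennreal powr_powr ennreal_mult)
      ultimately show ?thesis using r by (simp add: epowr_mult mult.assoc)
    qed
    finally show "Lqnorm p M (\<lambda>x. \<Sum>i. g i x) \<le> ennreal C * (SUP i. ennreal (2 powr (e * real i)) * Lqnorm p M (g i))"
      unfolding S_def[symmetric] by (intro Lqnorm_leI[OF p False]) (simp add: r_def)
  qed
qed

lemma Lqnorm_add:
  assumes p: "0 < p"
  obtains C :: real where "0 < C"
    "\<And>(M :: 'a measure) (f :: 'a \<Rightarrow> ennreal) g. f \<in> borel_measurable M \<Longrightarrow> g \<in> borel_measurable M \<Longrightarrow>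
       Lqnorm p M (\<lambda>x. f x + g x) \<le> ennreal C * (Lqnorm p M f + Lqnorm p M g)"
proof -
  obtain C where C: "0 < C"
    "\<And>(M :: 'a measure) (g :: nat \<Rightarrow> 'a \<Rightarrow> ennreal). (\<And>i. g i \<in> borel_measurable M) \<Longrightarrow>
       Lqnorm p M (\<lambda>x. \<Sum>i::nat. g i x) \<le> ennreal C * (SUP i. ennreal (2 powr (1 * real i)) * Lqnorm p M (g i))"
    using Lqnorm_suminf[OF p, of 1] by auto
  show thesis
  proof (rule that[of "C * 2"])
    fix M :: "'a measure" and f g :: "'a \<Rightarrow> ennreal"
    assume [measurable]: "f \<in> borel_measurable M" "g \<in> borel_measurable M"
    \<comment> \<open>Two functions are a sequence that vanishes from index \<open>2\<close> on; the largest weight is \<open>2\<close>.\<close>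
    define h where "h i = (if i = (0::nat) then f else if i = 1 then g else (\<lambda>_. 0))" for i
    have [measurable]: "h i \<in> borel_measurable M" for i by (simp add: h_def)
    have "(\<Sum>i. h i x) = f x + g x" for x
    proof -
      have "(\<Sum>i. h i x) = (\<Sum>i\<in>{0,1}. h i x)" by (rule suminf_finite) (auto simp: h_def)
      then show ?thesis by (simp add: h_def)
    qed
    then have "Lqnorm p M (\<lambda>x. f x + g x) \<le> ennreal C * (SUP i. ennreal (2 powr (1 * real i)) * Lqnorm p M (h i))"
      using C(2)[of h M] by simp
    also have "\<dots> \<le> ennreal C * (ennreal 2 * (Lqnorm p M f + Lqnorm p M g))"
    proof (intro mult_left_mono SUP_least)
      fix i :: nat
      consider "i = 0" | "i = 1" | "i \<ge> 2" by linarith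
      then show "ennreal (2 powr (1 * real i)) * Lqnorm p M (h i) \<le> ennreal 2 * (Lqnorm p M f + Lqnorm p M g)"
      proof cases
        case 1
        have "1 * Lqnorm p M f \<le> ennreal 2 * (Lqnorm p M f + Lqnorm p M g)" by (intro mult_mono) auto
        then show ?thesis using 1 by (simp add: h_def)
      next
        case 2
        have "ennreal 2 * Lqnorm p M g \<le> ennreal 2 * (Lqnorm p M f + Lqnorm p M g)" by (intro mult_mono) auto
        then show ?thesis using 2 by (simp add: h_def)
      next
        case 3 then show ?thesis using p by (simp add: h_def Lqnorm_zero)
      qed
    qed auto
    finally show "Lqnorm p M (\<lambda>x. f x + g x) \<le> ennreal (C * 2) * (Lqnorm p M f + Lqnorm p M g)"
      using C(1) by (simp add: ennreal_mult mult.assoc)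
  qed (use C in auto)
qed

lemma infsum_finite_support:
  fixes f :: "'i::countable \<Rightarrow> ennreal"
  assumes "finite {i. f i \<noteq> 0}" "card {i. f i \<noteq> 0} \<le> N" "\<And>i. f i \<le> T"
  shows "(\<Sum>\<^sub>\<infinity>i. f i) \<le> of_nat N * T"
proof -
  have "(\<Sum>\<^sub>\<infinity>i. f i) = (\<Sum>i\<in>{i. f i \<noteq> 0}. f i)"
    by (rule infsumI, rule has_sum_finite_neutralI) (use assms in auto)
  also have "\<dots> \<le> (\<Sum>i\<in>{i. f i \<noteq> 0}. T)" by (intro sum_mono assms)
  also have "\<dots> = of_nat (card {i. f i \<noteq> 0}) * T" by simp
  also have "\<dots> \<le> of_nat N * T" by (intro mult_right_mono) (use assms in auto)
  finally show ?thesis .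
qed

text \<open>At each point the sum has at most \<open>N\<close> nonzero terms and is at most \<open>N\<close> times their maximum; powers
of maxima are bounded by sums of powers, which integrate term by term.\<close>

lemma Lqnorm_overlap:
  fixes nu :: "'i::countable \<Rightarrow> ennreal" and w :: "'i \<Rightarrow> 'a \<Rightarrow> ennreal"
  assumes p: "0 < p" and w [measurable]: "\<And>l. w l \<in> borel_measurable M"
    and fin: "\<And>x. finite {l. w l x \<noteq> 0}" and card: "\<And>x. card {l. w l x \<noteq> 0} \<le> N"
    and W: "\<And>l. Lqnorm p M (w l) \<le> W"
  shows "Lqnorm p M (\<lambda>x. \<Sum>\<^sub>\<infinity>l. nu l * w l x) \<le> of_nat N * (W * lqnorm p nu)"
proof -
  have sub: "{l. nu l * w l x \<noteq> 0} \<subseteq> {l. w l x \<noteq> 0}" for x by auto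
  have fin': "finite {l. nu l * w l x \<noteq> 0}" for x by (rule finite_subset[OF sub fin])
  have card': "card {l. nu l * w l x \<noteq> 0} \<le> N" for x
    by (rule order_trans[OF card_mono[OF fin sub] card])
  show ?thesis
  proof (cases "p = \<infinity>")
    case True
    have "AE x in M. \<forall>l. w l x \<le> Lqnorm p M (w l)"
      using AE_le_Lqnorm_top True by (auto simp: AE_all_countable)
    then have "AE x in M. (\<Sum>\<^sub>\<infinity>l. nu l * w l x) \<le> of_nat N * (W * lqnorm p nu)"
    proof eventually_elim
      case (elim x)
      have "nu l * w l x \<le> W * lqnorm p nu" for l
        using mult_mono[OF order_trans[OF elim[rule_format] W] lqnorm_ge_term[OF p, of nu l]] by (simp add: mult.commute)
      then show ?case by (intro infsum_finite_support fin' card')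
    qed
    then show ?thesis unfolding True by (intro Lqnorm_topI) auto
  next
    case False
    define r where "r = enn2real p"
    have r: "0 < r" unfolding r_def using exponent_pos[OF p False] .
    have pw: "epowr (\<Sum>\<^sub>\<infinity>l. nu l * w l x) r \<le> epowr (of_nat N) r * (\<Sum>\<^sub>\<infinity>l. epowr (nu l) r * epowr (w l x) r)" for x
    proof -
      define T where "T = epowr (\<Sum>\<^sub>\<infinity>l. epowr (nu l * w l x) r) (1 / r)"
      have "nu l * w l x \<le> T" for l
        unfolding T_def using infsum_ge_term[of "\<lambda>l. epowr (nu l * w l x) r" l] r by (simp add: epowr_le_iff)
      then have "(\<Sum>\<^sub>\<infinity>l. nu l * w l x) \<le> of_nat N * T" by (intro infsum_finite_support fin' card')
      then have "epowr (\<Sum>\<^sub>\<infinity>l. nu l * w l x) r \<le> epowr (of_nat N) r * epowr T r"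
        using epowr_mono[OF r] epowr_mult[OF r] by metis
      then show ?thesis using r by (simp add: T_def epowr_inverse epowr_mult)
    qed
    have "(\<integral>\<^sup>+x. epowr (\<Sum>\<^sub>\<infinity>l. nu l * w l x) r \<partial>M) \<le> (\<integral>\<^sup>+x. epowr (of_nat N) r * (\<Sum>\<^sub>\<infinity>l. epowr (nu l) r * epowr (w l x) r) \<partial>M)"
      by (intro nn_integral_mono pw)
    also have "\<dots> = epowr (of_nat N) r * (\<Sum>\<^sub>\<infinity>l. epowr (nu l) r * epowr (Lqnorm p M (w l)) r)"
      using p False r by (simp add: nn_integral_cmult nn_integral_infsum Lqnorm_powr r_def)
    also have "\<dots> \<le> epowr (of_nat N) r * (\<Sum>\<^sub>\<infinity>l. epowr W r * epowr (nu l) r)"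
    proof (intro mult_left_mono infsum_mono_ennreal)
      show "epowr (nu l) r * epowr (Lqnorm p M (w l)) r \<le> epowr W r * epowr (nu l) r" for l
        by (subst mult.commute) (intro mult_right_mono epowr_mono[OF r] W, simp)
    qed simp
    also have "\<dots> = epowr (of_nat N) r * (epowr W r * epowr (lqnorm p nu) r)"
      using Lqnorm_powr[OF p False, of "count_space UNIV" nu]
      by (simp add: infsum_cmult_ennreal nn_integral_count_space_infsum r_def)
    also have "\<dots> = epowr (of_nat N * (W * lqnorm p nu)) r" using r by (simp add: epowr_mult)
    finally show ?thesis by (intro Lqnorm_leI[OF p False]) (simp add: r_def)
  qed
qed

section \<open>Convergence in Lebesgue spaces and almost everywhere\<close>

text \<open>Lebesgue measure is complete.\<close>

lemma measurable_lebesgue_AE: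
  fixes f g :: "'a::euclidean_space \<Rightarrow> complex"
  assumes [measurable]: "f \<in> borel_measurable lebesgue" and eq: "AE x in lebesgue. f x = g x"
  shows "g \<in> borel_measurable lebesgue"
proof (rule measurableI)
  fix B :: "complex set" assume [measurable]: "B \<in> sets borel"
  have ae: "AE x in lborel. f x = g x" using eq by (simp only: AE_completion_iff)
  have "Measurable.pred lebesgue (\<lambda>x. f x \<in> B \<and> g x \<notin> B)" "Measurable.pred lebesgue (\<lambda>x. f x \<notin> B \<and> g x \<in> B)"
    by (rule sets_completion_AE, use ae in eventually_elim, simp)+
  moreover have "Measurable.pred lebesgue (\<lambda>x. f x \<in> B)" by measurable
  ultimately have "{x. f x \<in> B} - {x. f x \<in> B \<and> g x \<notin> B} \<union> {x. f x \<notin> B \<and> g x \<in> B} \<in> sets lebesgue"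
    by (intro sets.Un sets.Diff) (simp_all add: pred_def)
  also have "{x. f x \<in> B} - {x. f x \<in> B \<and> g x \<notin> B} \<union> {x. f x \<notin> B \<and> g x \<in> B} = g -` B \<inter> space lebesgue"
    by auto
  finally show "g -` B \<inter> space lebesgue \<in> sets lebesgue" .
qed simp

lemma has_sum_countable_sums:
  fixes f :: "'i::countable \<Rightarrow> complex"
  assumes "(f has_sum S) UNIV"
  shows "(\<lambda>n. if n \<in> range (to_nat :: 'i \<Rightarrow> nat) then f (from_nat n) else 0) sums S"
proof (rule has_sum_imp_sums)
  have "((\<lambda>n. f (from_nat n)) has_sum S) (range (to_nat :: 'i \<Rightarrow> nat))"
    using assms by (subst has_sum_reindex) (auto simp: comp_def)
  then show "((\<lambda>n. if n \<in> range (to_nat :: 'i \<Rightarrow> nat) then f (from_nat n) else 0) has_sum S) UNIV"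
    by (subst has_sum_cong_neutral[where T="range (to_nat :: 'i \<Rightarrow> nat)" and g="\<lambda>n. f (from_nat n)"]) auto
qed

lemma has_sum_measurable:
  fixes g :: "'i::countable \<Rightarrow> 'a::euclidean_space \<Rightarrow> complex"
  assumes g: "\<And>i. g i \<in> borel_measurable lebesgue"
    and F: "AE x in lebesgue. ((\<lambda>i. g i x) has_sum F x) UNIV"
  shows "F \<in> borel_measurable lebesgue"
proof -
  define h where "h n x = (if n \<in> range (to_nat :: 'i \<Rightarrow> nat) then g (from_nat n) x else 0)" for n x
  have [measurable]: "h n \<in> borel_measurable lebesgue" for n
    using g unfolding h_def by auto
  have "(\<lambda>x. lim (\<lambda>N. \<Sum>n<N. h n x)) \<in> borel_measurable lebesgue"
    by (rule borel_measurable_lim_metric) measurable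
  moreover have "AE x in lebesgue. lim (\<lambda>N. \<Sum>n<N. h n x) = F x"
    using F
  proof eventually_elim
    case (elim x)
    from has_sum_countable_sums[OF this] show ?case
      unfolding h_def sums_def by (rule limI)
  qed
  ultimately show ?thesis by (rule measurable_lebesgue_AE)
qed

lemma infsum_pair_ennreal:
  fixes f :: "'i::countable \<Rightarrow> 'j::countable \<Rightarrow> ennreal"
  shows "(\<Sum>\<^sub>\<infinity>(i, j). f i j) = (\<Sum>\<^sub>\<infinity>i. \<Sum>\<^sub>\<infinity>j. f i j)"
  unfolding nn_integral_count_space_infsum[symmetric]
  using nn_integral_fst_count_space[of "\<lambda>(i, j). f i j"] by simp

lemma infsum_swap_ennreal:
  fixes f :: "'i::countable \<Rightarrow> 'j::countable \<Rightarrow> ennreal"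
  shows "(\<Sum>\<^sub>\<infinity>i. \<Sum>\<^sub>\<infinity>j. f i j) = (\<Sum>\<^sub>\<infinity>j. \<Sum>\<^sub>\<infinity>i. f i j)"
  using nn_integral_infsum[of "\<lambda>j i. f i j" "count_space UNIV"]
  by (simp add: nn_integral_count_space_infsum)

lemma sum_le_infsum_ennreal:
  fixes f :: "'i::countable \<Rightarrow> ennreal"
  assumes "finite F"
  shows "sum f F \<le> (\<Sum>\<^sub>\<infinity>i. f i)"
proof -
  have "sum f F = (\<Sum>\<^sub>\<infinity>i. if i \<in> F then f i else 0)"
    by (rule infsumI[symmetric], rule has_sum_finite_neutralI) (use assms in auto)
  also have "\<dots> \<le> (\<Sum>\<^sub>\<infinity>i. f i)" by (rule infsum_mono_ennreal) auto
  finally show ?thesis .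
qed

lemma norm_summable_of_finite:
  fixes g :: "'i::countable \<Rightarrow> complex"
  assumes "(\<Sum>\<^sub>\<infinity>i. ennreal (norm (g i))) < \<infinity>"
  shows "(\<lambda>i. norm (g i)) summable_on UNIV" "g summable_on S"
proof -
  obtain C where C: "(\<Sum>\<^sub>\<infinity>i. ennreal (norm (g i))) = ennreal C" "0 \<le> C"
    using assms by (cases "(\<Sum>\<^sub>\<infinity>i. ennreal (norm (g i)))") auto
  have "sum (\<lambda>i. norm (g i)) F \<le> C" if "finite F" for F
    using sum_le_infsum_ennreal[OF that, of "\<lambda>i. ennreal (norm (g i))"] C by (simp add: sum_nonneg)
  then show *: "(\<lambda>i. norm (g i)) summable_on UNIV"
    by (intro nonneg_bdd_above_summable_on) (auto intro!: bdd_aboveI)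
  show "g summable_on S"
    by (rule Infinite_Sum.abs_summable_summable, rule summable_on_subset_banach[OF *]) simp
qed

lemma norm_infsum_le_ennreal:
  fixes g :: "'i::countable \<Rightarrow> complex"
  assumes fin: "(\<Sum>\<^sub>\<infinity>i. ennreal (norm (g i))) < \<infinity>"
  shows "ennreal (norm (infsum g S)) \<le> (\<Sum>\<^sub>\<infinity>i. if i \<in> S then ennreal (norm (g i)) else 0)"
proof -
  have s: "(\<lambda>i. norm (g i)) summable_on S"
    by (rule summable_on_subset_banach[OF norm_summable_of_finite(1)[OF fin]]) simp
  have "ennreal (norm (infsum g S)) \<le> ennreal (infsum (\<lambda>i. norm (g i)) S)"
    by (intro ennreal_leI norm_infsum_bound s)
  also have "\<dots> = (SUP F\<in>{F. finite F \<and> F \<subseteq> S}. ennreal (sum (\<lambda>i. norm (g i)) F))"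
    by (rule infsum_nonneg_is_SUPREMUM_ennreal[OF s]) simp
  also have "\<dots> \<le> (\<Sum>\<^sub>\<infinity>i. if i \<in> S then ennreal (norm (g i)) else 0)"
  proof (rule SUP_least)
    fix F assume F: "F \<in> {F. finite F \<and> F \<subseteq> S}"
    have "ennreal (sum (\<lambda>i. norm (g i)) F) = sum (\<lambda>i. ennreal (norm (g i))) F"
      by (simp add: sum_ennreal)
    also have "\<dots> = sum (\<lambda>i. if i \<in> S then ennreal (norm (g i)) else 0) F"
      using F by (intro sum.cong) auto
    also have "\<dots> \<le> (\<Sum>\<^sub>\<infinity>i. if i \<in> S then ennreal (norm (g i)) else 0)"
      by (rule sum_le_infsum_ennreal) (use F in simp)
    finally show "ennreal (sum (\<lambda>i. norm (g i)) F) \<le> (\<Sum>\<^sub>\<infinity>i. if i \<in> S then ennreal (norm (g i)) else 0)" .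
  qed
  finally show ?thesis .
qed

text \<open>The total \<open>F\<close> of the absolutely convergent series satisfies \<open>|F - S\<^sub>J| \<le> T\<^sub>J\<close> for the partial sums
\<open>S\<^sub>J\<close>, so \<open>S\<^sub>J \<rightarrow> F\<close> in \<open>L\<^sub>p\<close>, and limits in \<open>L\<^sub>p\<close> are unique up to null sets.\<close>

lemma Lp_sums_iff_AE:
  fixes u :: "nat \<Rightarrow> int ^ 'n \<Rightarrow> real ^ 'n \<Rightarrow> complex"
  assumes p: "0 < p" and u: "\<And>j m. u j m \<in> borel_measurable lebesgue"
    and f: "f \<in> borel_measurable lebesgue"
    and T [measurable]: "\<And>J. T J \<in> borel_measurable lebesgue"
    and T0: "AE x in lebesgue. T 0 x < \<infinity>"
    and Tlim: "(\<lambda>J. Lqnorm p lebesgue (T J)) \<longlonglongrightarrow> 0"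
    and dom: "AE x in lebesgue. \<forall>J. (\<Sum>\<^sub>\<infinity>(j, m). if J \<le> j then ennreal (norm (u j m x)) else 0) \<le> T J x"
  shows "Lp_sums p u f \<longleftrightarrow> (AE x in lebesgue. ((\<lambda>(j, m). u j m x) has_sum f x) UNIV)"
proof -
  define F where "F x = (\<Sum>\<^sub>\<infinity>(j, m). u j m x)" for x
  define S where "S J x = (\<Sum>j<J. \<Sum>\<^sub>\<infinity>m. u j m x)" for J x
  have good: "AE x in lebesgue. ((\<lambda>(j, m). u j m x) has_sum F x) UNIV \<and>
      (\<forall>j. (\<lambda>m. u j m x) summable_on UNIV) \<and> (\<forall>J. ennreal (norm (F x - S J x)) \<le> T J x)"
    using T0 dom
  proof eventually_elim
    case (elim x)
    define g where "g = (\<lambda>(j, m). u j m x)"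
    have "(\<Sum>\<^sub>\<infinity>i. ennreal (norm (g i))) = (\<Sum>\<^sub>\<infinity>(j, m). if 0 \<le> j then ennreal (norm (u j m x)) else 0)"
      by (rule infsum_cong) (auto simp: g_def)
    also have "\<dots> \<le> T 0 x" using elim by blast
    finally have fin: "(\<Sum>\<^sub>\<infinity>i. ennreal (norm (g i))) < \<infinity>" using elim by simp
    have sm: "g summable_on A" for A using norm_summable_of_finite(2)[OF fin] .
    have sj: "(\<lambda>m. u j m x) summable_on UNIV" for j
    proof -
      have "g summable_on (Pair j ` UNIV)" by (rule sm)
      then show ?thesis by (subst (asm) summable_on_reindex) (auto simp: inj_on_def g_def comp_def)
    qed
    have FS: "F x - S J x = infsum g ({J..} \<times> UNIV)" for J
    proof -
      have "S J x = (\<Sum>\<^sub>\<infinity>j\<in>{..<J}. \<Sum>\<^sub>\<infinity>m. g (j, m))" by (simp add: S_def g_def)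
      also have "\<dots> = infsum g ({..<J} \<times> UNIV)" by (rule infsum_Sigma_banach[OF sm])
      finally have "S J x = infsum g ({..<J} \<times> UNIV)" .
      moreover have "F x = infsum g ({..<J} \<times> UNIV \<union> {J..} \<times> UNIV)"
      proof -
        have "({..<J} \<times> UNIV \<union> {J..} \<times> UNIV) = (UNIV :: (nat \<times> (int ^ 'n)) set)" by auto
        then show ?thesis by (simp add: F_def g_def)
      qed
      moreover have "infsum g ({..<J} \<times> UNIV \<union> {J..} \<times> UNIV) = infsum g ({..<J} \<times> UNIV) + infsum g ({J..} \<times> UNIV)"
        by (rule infsum_Un_disjoint[OF sm sm]) auto
      ultimately show ?thesis by simp
    qed
    have "ennreal (norm (F x - S J x)) \<le> T J x" for J
    proof -
      have "ennreal (norm (F x - S J x)) \<le> (\<Sum>\<^sub>\<infinity>i. if i \<in> {J..} \<times> UNIV then ennreal (norm (g i)) else 0)"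
        unfolding FS by (rule norm_infsum_le_ennreal[OF fin])
      also have "\<dots> = (\<Sum>\<^sub>\<infinity>(j, m). if J \<le> j then ennreal (norm (u j m x)) else 0)"
        by (rule infsum_cong) (auto simp: g_def split: if_splits)
      also have "\<dots> \<le> T J x" using elim by blast
      finally show ?thesis .
    qed
    moreover have "(g has_sum F x) UNIV" using sm[of UNIV] by (simp add: F_def g_def has_sum_infsum)
    ultimately show ?case using sj by (simp add: g_def)
  qed
  have Fm [measurable]: "F \<in> borel_measurable lebesgue"
  proof (rule has_sum_measurable[of "\<lambda>(j, m) x. u j m x"])
    show "AE x in lebesgue. ((\<lambda>i. (case i of (j, m) \<Rightarrow> \<lambda>x. u j m x) x) has_sum F x) UNIV"
      using good by eventually_elim (auto simp: case_prod_unfold)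
  qed (use u in auto)
  have Sm [measurable]: "S J \<in> borel_measurable lebesgue" for J
  proof -
    have "(\<lambda>x. \<Sum>\<^sub>\<infinity>m. u j m x) \<in> borel_measurable lebesgue" for j
    proof (rule has_sum_measurable[OF u])
      show "AE x in lebesgue. ((\<lambda>m. u j m x) has_sum (\<Sum>\<^sub>\<infinity>m. u j m x)) UNIV"
        using good by eventually_elim auto
    qed
    then show ?thesis unfolding S_def by (intro borel_measurable_sum)
  qed
  note [measurable] = f
  have lps: "Lp_sums p u h \<longleftrightarrow> (\<lambda>J. Lqnorm p lebesgue (\<lambda>x. ennreal (norm (h x - S J x)))) \<longlonglongrightarrow> 0" for h
    by (simp add: Lp_sums_def Lp_qnorm_eq S_def)
  show ?thesis
  proof
    assume A: "AE x in lebesgue. ((\<lambda>(j, m). u j m x) has_sum f x) UNIV"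
    have "Lqnorm p lebesgue (\<lambda>x. ennreal (norm (f x - S J x))) \<le> Lqnorm p lebesgue (T J)" for J
    proof (rule Lqnorm_mono_AE[OF p])
      show "AE x in lebesgue. ennreal (norm (f x - S J x)) \<le> T J x"
        using A good by eventually_elim (metis has_sum_unique)
    qed measurable
    then show "Lp_sums p u f"
      unfolding lps by (intro tendsto_sandwich[OF _ _ tendsto_const Tlim]) auto
  next
    assume "Lp_sums p u f"
    then have L: "(\<lambda>J. Lqnorm p lebesgue (\<lambda>x. ennreal (norm (f x - S J x)))) \<longlonglongrightarrow> 0" by (simp only: lps)
    obtain C :: real where C: "0 < C"
      "\<And>(M :: (real ^ 'n) measure) f g. f \<in> borel_measurable M \<Longrightarrow> g \<in> borel_measurable M \<Longrightarrow>
         Lqnorm p M (\<lambda>x. f x + g x) \<le> ennreal C * (Lqnorm p M f + Lqnorm p M g)"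
      using Lqnorm_add[OF p] by metis
    have le: "Lqnorm p lebesgue (\<lambda>x. ennreal (norm (f x - F x)))
        \<le> ennreal C * (Lqnorm p lebesgue (\<lambda>x. ennreal (norm (f x - S J x))) + Lqnorm p lebesgue (T J))" for J
    proof -
      have "Lqnorm p lebesgue (\<lambda>x. ennreal (norm (f x - F x)))
          \<le> Lqnorm p lebesgue (\<lambda>x. ennreal (norm (f x - S J x)) + T J x)"
      proof (rule Lqnorm_mono_AE[OF p])
        show "AE x in lebesgue. ennreal (norm (f x - F x)) \<le> ennreal (norm (f x - S J x)) + T J x"
          using good
        proof eventually_elim
          case (elim x)
          have "norm (f x - F x) \<le> norm (f x - S J x) + norm (F x - S J x)"
            using norm_triangle_ineq4[of "f x - S J x" "F x - S J x"] by simp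
          then have "ennreal (norm (f x - F x)) \<le> ennreal (norm (f x - S J x)) + ennreal (norm (F x - S J x))"
            by (subst ennreal_plus[symmetric]) (auto intro!: ennreal_leI simp del: ennreal_plus)
          also have "\<dots> \<le> ennreal (norm (f x - S J x)) + T J x" using elim by (intro add_left_mono) blast
          finally show ?case .
        qed
      qed measurable
      also have "\<dots> \<le> ennreal C * (Lqnorm p lebesgue (\<lambda>x. ennreal (norm (f x - S J x))) + Lqnorm p lebesgue (T J))"
        by (rule C(2)) measurable
      finally show ?thesis .
    qed
    have "(\<lambda>J. ennreal C * (Lqnorm p lebesgue (\<lambda>x. ennreal (norm (f x - S J x))) + Lqnorm p lebesgue (T J))) \<longlonglongrightarrow> ennreal C * (0 + 0)"
      by (intro ennreal_tendsto_cmult tendsto_add L Tlim) auto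
    then have "Lqnorm p lebesgue (\<lambda>x. ennreal (norm (f x - F x))) \<le> ennreal C * (0 + 0)"
      by (rule LIMSEQ_le_const) (use le in auto)
    then have "Lqnorm p lebesgue (\<lambda>x. ennreal (norm (f x - F x))) = 0" by simp
    then have "AE x in lebesgue. ennreal (norm (f x - F x)) = 0"
      by (intro Lqnorm_eq_0_AE[OF p]) measurable
    then show "AE x in lebesgue. ((\<lambda>(j, m). u j m x) has_sum f x) UNIV"
      using good by eventually_elim (auto simp: ennreal_eq_0_iff)
  qed
qed

section \<open>Sequence spaces and their majorants\<close>

text \<open>The exponent \<open>n/p\<close>, which is \<open>0\<close> for \<open>p = \<infinity>\<close>.\<close>

definition dim_exp :: "'n::finite itself \<Rightarrow> ennreal \<Rightarrow> real" where
  "dim_exp _ p = enn2real (of_nat CARD('n) / p)"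

text \<open>The quasi-norm of \<open>b\<^sup>s\<^sub>p\<^sub>,\<^sub>q\<close> for extended nonnegative sequences. Sums of moduli of coefficients can be
formed here before they are known to be finite.\<close>

definition b_enorm :: "real \<Rightarrow> ennreal \<Rightarrow> ennreal \<Rightarrow> (nat \<Rightarrow> int ^ 'n \<Rightarrow> ennreal) \<Rightarrow> ennreal" where
  "b_enorm s p q nu = lqnorm q (\<lambda>j. ennreal (2 powr (real j * (s - dim_exp TYPE('n) p))) * lqnorm p (nu j))"

lemma b_qnorm_eq:
  fixes lam :: "nat \<Rightarrow> int ^ 'n \<Rightarrow> complex"
  shows "b_qnorm s p q lam = b_enorm s p q (\<lambda>j m. ennreal (norm (lam j m)))"
  by (simp add: b_qnorm_def b_enorm_def ell_qnorm_eq dim_exp_def)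

lemma level_le_b_enorm:
  fixes nu :: "nat \<Rightarrow> int ^ 'n \<Rightarrow> ennreal"
  assumes "0 < q"
  shows "ennreal (2 powr (real j * (s - dim_exp TYPE('n) p))) * lqnorm p (nu j) \<le> b_enorm s p q nu"
  unfolding b_enorm_def
  using lqnorm_ge_term[OF assms, of "\<lambda>j. ennreal (2 powr (real j * (s - dim_exp TYPE('n) p))) * lqnorm p (nu j)" j] by simp

lemma b_enorm_cmult:
  assumes "0 < p" "0 < q" "0 < c"
  shows "b_enorm s p q (\<lambda>j m. ennreal c * nu j m) = ennreal c * b_enorm s p q nu"
proof -
  have "lqnorm p (\<lambda>m. ennreal c * nu j m) = ennreal c * lqnorm p (nu j)" for j
    by (rule Lqnorm_cmult) (use assms in auto)
  then have "b_enorm s p q (\<lambda>j m. ennreal c * nu j m) =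
      lqnorm q (\<lambda>j. ennreal c * (ennreal (2 powr (real j * (s - dim_exp TYPE('a) p))) * lqnorm p (nu j)))"
    unfolding b_enorm_def by (simp add: mult.left_commute)
  also have "\<dots> = ennreal c * b_enorm s p q nu"
    unfolding b_enorm_def by (rule Lqnorm_cmult) (use assms in auto)
  finally show ?thesis .
qed

lemma b_enorm_add:
  assumes p: "0 < p" and q: "0 < q"
  obtains C :: real where "0 < C"
    "\<And>nu mu :: nat \<Rightarrow> int ^ 'n \<Rightarrow> ennreal. b_enorm s p q (\<lambda>j m. nu j m + mu j m) \<le> ennreal C * (b_enorm s p q nu + b_enorm s p q mu)"
proof -
  obtain A :: real where A: "0 < A"
    "\<And>(M :: (int ^ 'n) measure) (f :: int ^ 'n \<Rightarrow> ennreal) g. f \<in> borel_measurable M \<Longrightarrow> g \<in> borel_measurable M \<Longrightarrow>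
       Lqnorm p M (\<lambda>x. f x + g x) \<le> ennreal A * (Lqnorm p M f + Lqnorm p M g)"
    using Lqnorm_add[OF p] by metis
  obtain B :: real where B: "0 < B"
    "\<And>(M :: nat measure) (f :: nat \<Rightarrow> ennreal) g. f \<in> borel_measurable M \<Longrightarrow> g \<in> borel_measurable M \<Longrightarrow>
       Lqnorm q M (\<lambda>x. f x + g x) \<le> ennreal B * (Lqnorm q M f + Lqnorm q M g)"
    using Lqnorm_add[OF q] by metis
  show thesis
  proof (rule that[of "A * B"])
    fix nu mu :: "nat \<Rightarrow> int ^ 'n \<Rightarrow> ennreal"
    let ?w = "\<lambda>j. ennreal (2 powr (real j * (s - dim_exp TYPE('n) p)))"
    have "b_enorm s p q (\<lambda>j m. nu j m + mu j m) \<le> lqnorm q (\<lambda>j. ennreal A * (?w j * lqnorm p (nu j) + ?w j * lqnorm p (mu j)))"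
      unfolding b_enorm_def
    proof (rule lqnorm_mono[OF q])
      fix j
      have "?w j * lqnorm p (\<lambda>m. nu j m + mu j m) \<le> ?w j * (ennreal A * (lqnorm p (nu j) + lqnorm p (mu j)))"
        by (intro mult_left_mono A(2)) auto
      then show "?w j * lqnorm p (\<lambda>m. nu j m + mu j m) \<le> ennreal A * (?w j * lqnorm p (nu j) + ?w j * lqnorm p (mu j))"
        by (simp add: distrib_left mult.left_commute)
    qed
    also have "\<dots> = ennreal A * lqnorm q (\<lambda>j. ?w j * lqnorm p (nu j) + ?w j * lqnorm p (mu j))"
      by (rule Lqnorm_cmult) (use q A in auto)
    also have "\<dots> \<le> ennreal A * (ennreal B * (b_enorm s p q nu + b_enorm s p q mu))"
      unfolding b_enorm_def by (intro mult_left_mono B(2)) auto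
    finally show "b_enorm s p q (\<lambda>j m. nu j m + mu j m) \<le> ennreal (A * B) * (b_enorm s p q nu + b_enorm s p q mu)"
      using A B by (simp add: ennreal_mult mult.assoc)
  qed (use A B in simp)
qed

lemma dcube_eq_cbox:
  "dcube d j m = cbox (\<chi> i. of_int (m $ i) / 2 ^ j - d / 2 ^ j) (\<chi> i. of_int (m $ i) / 2 ^ j + d / 2 ^ j)"
  by (auto simp: dcube_def mem_box_cart abs_le_iff algebra_simps)

lemma dcube_measurable [measurable]: "dcube d j (m :: int ^ 'n) \<in> sets lebesgue"
  unfolding dcube_eq_cbox by simp

lemma emeasure_dcube:
  fixes m :: "int ^ 'n"
  assumes "0 \<le> d"
  shows "emeasure lebesgue (dcube d j m) = ennreal ((2 * d / 2 ^ j) ^ CARD('n))"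
proof -
  define a :: "real ^ 'n" where "a = (\<chi> i. of_int (m $ i) / 2 ^ j - d / 2 ^ j)"
  define b :: "real ^ 'n" where "b = (\<chi> i. of_int (m $ i) / 2 ^ j + d / 2 ^ j)"
  have "measure lebesgue (cbox a b) = (\<Prod>i\<in>(UNIV :: 'n set). b $ i - a $ i)"
    using content_cbox_cart[of a b] assms
    by (auto simp: a_def b_def interval_ne_empty_cart)
  also have "\<dots> = (2 * d / 2 ^ j) ^ CARD('n)"
    by (simp add: a_def b_def)
  finally have "measure lebesgue (cbox a b) = (2 * d / 2 ^ j) ^ CARD('n)" .
  moreover have "emeasure lebesgue (cbox a b) = ennreal (measure lebesgue (cbox a b))"
    by (rule emeasure_eq_ennreal_measure) (simp add: emeasure_lborel_cbox_eq)
  ultimately show ?thesis by (simp add: dcube_eq_cbox a_def b_def)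
qed

lemma Lqnorm_dcube:
  assumes p: "0 < p" and d: "0 \<le> d"
  obtains W :: real where "0 < W"
    "\<And>j (m :: int ^ 'n). Lqnorm p lebesgue (indicator (dcube d j m)) \<le> ennreal (W * 2 powr (- (real j * dim_exp TYPE('n) p)))"
proof (cases "p = \<infinity>")
  case True
  show thesis
  proof (rule that[of 1])
    fix j and m :: "int ^ 'n"
    have "dim_exp TYPE('n) p = 0" using True by (simp add: dim_exp_def)
    moreover have "Lqnorm \<infinity> lebesgue (indicator (dcube d j m)) \<le> 1"
      by (rule Lqnorm_topI) (auto simp: indicator_def)
    ultimately show "Lqnorm p lebesgue (indicator (dcube d j m)) \<le> ennreal (1 * 2 powr (- (real j * dim_exp TYPE('n) p)))"
      using True by simp
  qed simp
next
  case False
  define r where "r = enn2real p"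
  have r: "0 < r" "p = ennreal r" unfolding r_def using exponent_pos[OF p False] False by (auto simp: less_top)
  have a: "dim_exp TYPE('n) p = CARD('n) / r"
    unfolding dim_exp_def r(2) using r(1) by (simp add: ennreal_of_nat_eq_real_of_nat divide_ennreal)
  define W where "W = (2 * d) powr (CARD('n) / r) + 1"
  show thesis
  proof (rule that[of W])
    fix j and m :: "int ^ 'n"
    have "(\<integral>\<^sup>+x. epowr (indicator (dcube d j m) x) r \<partial>lebesgue) = (\<integral>\<^sup>+x. indicator (dcube d j m) x \<partial>lebesgue)"
      by (intro nn_integral_cong) (auto simp: indicator_def epowr_def)
    also have "\<dots> = ennreal ((2 * d / 2 ^ j) ^ CARD('n))"
      using emeasure_dcube[OF d, of j m] by simp
    also have "\<dots> \<le> epowr (ennreal (W * 2 powr (- (real j * dim_exp TYPE('n) p)))) r"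
    proof -
      have "(2 * d / 2 ^ j) ^ CARD('n) = ((2 * d) powr (CARD('n) / r) * 2 powr (- (real j * dim_exp TYPE('n) p))) powr r"
      proof (cases "d = 0")
        case True then show ?thesis by simp
      next
        case False
        then have "0 < d" using d by simp
        have "2 * d / 2 ^ j = 2 * d * 2 powr (- real j)"
          by (simp add: powr_minus powr_realpow divide_inverse)
        then have "(2 * d / 2 ^ j) ^ CARD('n) = (2 * d * 2 powr (- real j)) powr CARD('n)"
          using \<open>0 < d\<close> by (simp add: powr_realpow)
        also have "\<dots> = (2 * d) powr CARD('n) * 2 powr (- real j * CARD('n))"
          using \<open>0 < d\<close> by (simp add: powr_mult powr_powr)
        finally have 1: "(2 * d / 2 ^ j) ^ CARD('n) = (2 * d) powr CARD('n) * 2 powr (- real j * CARD('n))" .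
        have "((2 * d) powr (CARD('n) / r) * 2 powr (- (real j * (CARD('n) / r)))) powr r
            = ((2 * d) powr (CARD('n) / r)) powr r * (2 powr (- (real j * (CARD('n) / r)))) powr r"
          by (rule powr_mult)
        also have "\<dots> = (2 * d) powr CARD('n) * 2 powr (- real j * CARD('n))"
          unfolding powr_powr using r(1) by simp
        finally show ?thesis unfolding a 1 by simp
      qed
      also have "\<dots> \<le> (W * 2 powr (- (real j * dim_exp TYPE('n) p))) powr r"
        using r by (intro powr_mono2 mult_right_mono) (auto simp: W_def)
      finally show ?thesis by (simp add: epowr_ennreal W_def ennreal_leI)
    qed
    finally show "Lqnorm p lebesgue (indicator (dcube d j m)) \<le> ennreal (W * 2 powr (- (real j * dim_exp TYPE('n) p)))"
      unfolding r_def by (intro Lqnorm_leI[OF p False])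
  qed (simp add: W_def add_nonneg_pos)
qed

definition overlap :: "real \<Rightarrow> 'n::finite itself \<Rightarrow> nat" where
  "overlap D _ = nat \<lceil>(2 * D + 1) ^ CARD('n)\<rceil>"

lemma card_near_overlap: "0 \<le> D \<Longrightarrow> card (near D (y :: real ^ 'n)) \<le> overlap D TYPE('n)"
  using order_trans[OF card_near[of D y] of_nat_ceiling] unfolding overlap_def of_nat_le_iff .

text \<open>A pointwise majorant of the part from level \<open>J\<close> on of a series of atoms with coefficients \<open>nu\<close>.\<close>

definition majorant :: "real \<Rightarrow> (nat \<Rightarrow> int ^ 'n \<Rightarrow> ennreal) \<Rightarrow> nat \<Rightarrow> real ^ 'n \<Rightarrow> ennreal" where
  "majorant d nu J x = (\<Sum>r. if J \<le> r then (\<Sum>\<^sub>\<infinity>l. nu r l * indicator (dcube d r l) x) else 0)"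

lemma majorant_measurable [measurable]: "majorant d nu J \<in> borel_measurable lebesgue"
  unfolding majorant_def[abs_def] by measurable

lemma majorant_eq_infsum: "majorant d nu J x = (\<Sum>\<^sub>\<infinity>(r, l). if J \<le> r then nu r l * indicator (dcube d r l) x else 0)"
  unfolding majorant_def infsum_pair_ennreal infsum_nat_ennreal by (intro suminf_cong) auto

text \<open>Level \<open>r\<close> of the majorant has \<open>L\<^sub>p\<close> quasi-norm at most a constant times
\<open>2\<^bsup>-rn/p\<^esup> \<parallel>\<nu>\<^sub>r\<parallel>\<^sub>p = 2\<^bsup>-rs\<^esup> (2\<^bsup>r(s-n/p)\<^esup> \<parallel>\<nu>\<^sub>r\<parallel>\<^sub>p)\<close>. Half of the decay \<open>2\<^bsup>-rs\<^esup>\<close> pays for the summation over \<open>r\<close>,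
the other half remains.\<close>

lemma majorant_bound:
  assumes p: "0 < p" and q: "0 < q" and s: "0 < s" and d: "0 \<le> d"
  obtains C :: real where "0 < C"
    "\<And>(nu :: nat \<Rightarrow> int ^ 'n \<Rightarrow> ennreal) J.
       Lqnorm p lebesgue (majorant d nu J) \<le> ennreal (C * 2 powr (- (s / 2 * real J))) * b_enorm s p q nu"
proof -
  let ?a = "dim_exp TYPE('n) p"
  obtain A where A: "0 < A"
    "\<And>(M :: (real ^ 'n) measure) (g :: nat \<Rightarrow> real ^ 'n \<Rightarrow> ennreal). (\<And>i. g i \<in> borel_measurable M) \<Longrightarrow>
       Lqnorm p M (\<lambda>x. \<Sum>i. g i x) \<le> ennreal A * (SUP i. ennreal (2 powr (s / 2 * real i)) * Lqnorm p M (g i))"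
    using Lqnorm_suminf[OF p, of "s / 2"] s by auto
  obtain W where W: "0 < W"
    "\<And>j (m :: int ^ 'n). Lqnorm p lebesgue (indicator (dcube d j m)) \<le> ennreal (W * 2 powr (- (real j * ?a)))"
    using Lqnorm_dcube[OF p d] by metis
  define N where "N = overlap d TYPE('n)"
  define C where "C = A * (N * W) + 1"
  have C: "0 < C" unfolding C_def using A W by (simp add: add_nonneg_pos)
  show thesis
  proof (rule that[OF C])
    fix nu :: "nat \<Rightarrow> int ^ 'n \<Rightarrow> ennreal" and J
    define g where "g r x = (if J \<le> r then (\<Sum>\<^sub>\<infinity>l. nu r l * indicator (dcube d r l) x) else 0)" for r x
    have g [measurable]: "g r \<in> borel_measurable lebesgue" for r unfolding g_def by measurable
    have "ennreal (2 powr (s / 2 * real r)) * Lqnorm p lebesgue (g r)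
        \<le> ennreal (N * W * 2 powr (- (s / 2 * real J))) * b_enorm s p q nu" for r
    proof (cases "J \<le> r")
      case False
      then show ?thesis using p by (simp add: g_def[abs_def] Lqnorm_zero)
    next
      case True
      have sub: "{l. (indicator (dcube d r l) x :: ennreal) \<noteq> 0} = near d (2 ^ r *\<^sub>R x)" for x :: "real ^ 'n"
        by (auto simp: indicator_def mem_dcube_iff)
      have "Lqnorm p lebesgue (g r) \<le> of_nat N * (ennreal (W * 2 powr (- (real r * ?a))) * lqnorm p (nu r))"
        using True unfolding g_def
        by (simp, intro Lqnorm_overlap[OF p _ _ _ W(2)]) (auto simp: sub N_def card_near_overlap d)
      then have "ennreal (2 powr (s / 2 * real r)) * Lqnorm p lebesgue (g r)
         \<le> ennreal (2 powr (s / 2 * real r)) * (of_nat N * (ennreal (W * 2 powr (- (real r * ?a))) * lqnorm p (nu r)))"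
        by (rule mult_left_mono) simp
      also have "\<dots> = ennreal (2 powr (s / 2 * real r) * (N * (W * 2 powr (- (real r * ?a))))) * lqnorm p (nu r)"
        using W by (simp add: ennreal_mult mult.assoc ennreal_of_nat_eq_real_of_nat)
      also have "2 powr (s / 2 * real r) * (N * (W * 2 powr (- (real r * ?a))))
          = N * W * 2 powr (- (s / 2 * real r)) * 2 powr (real r * (s - ?a))"
      proof -
        have e: "s / 2 * real r + - (real r * ?a) = - (s / 2 * real r) + real r * (s - ?a)" by (simp add: algebra_simps)
        have "2 powr (s / 2 * real r) * 2 powr (- (real r * ?a)) = 2 powr (- (s / 2 * real r)) * 2 powr (real r * (s - ?a))"
          by (simp only: powr_add[symmetric] e)
        then show ?thesis by (simp add: mult.left_commute mult.assoc)
      qed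
      also have "ennreal (N * W * 2 powr (- (s / 2 * real r)) * 2 powr (real r * (s - ?a))) * lqnorm p (nu r)
          = ennreal (N * W * 2 powr (- (s / 2 * real r))) * (ennreal (2 powr (real r * (s - ?a))) * lqnorm p (nu r))"
        using W by (simp add: ennreal_mult mult.assoc)
      also have "\<dots> \<le> ennreal (N * W * 2 powr (- (s / 2 * real J))) * b_enorm s p q nu"
        using True s W by (intro mult_mono level_le_b_enorm q ennreal_leI mult_left_mono) auto
      finally show ?thesis .
    qed
    then have "Lqnorm p lebesgue (majorant d nu J) \<le> ennreal A * (ennreal (N * W * 2 powr (- (s / 2 * real J))) * b_enorm s p q nu)"
      unfolding majorant_def[abs_def] g_def[symmetric]
      by (intro order_trans[OF A(2)[OF g]] mult_left_mono SUP_least) auto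
    also have "\<dots> = ennreal (A * (N * W) * 2 powr (- (s / 2 * real J))) * b_enorm s p q nu"
      using A W by (simp add: ennreal_mult mult.assoc)
    also have "\<dots> \<le> ennreal (C * 2 powr (- (s / 2 * real J))) * b_enorm s p q nu"
      by (intro mult_right_mono ennreal_leI) (auto simp: C_def)
    finally show "Lqnorm p lebesgue (majorant d nu J) \<le> ennreal (C * 2 powr (- (s / 2 * real J))) * b_enorm s p q nu" .
  qed
qed

lemma majorant_tendsto_0:
  fixes nu :: "nat \<Rightarrow> int ^ 'n \<Rightarrow> ennreal"
  assumes p: "0 < p" and q: "0 < q" and s: "0 < s" and d: "0 \<le> d" and fin: "b_enorm s p q nu < \<infinity>"
  shows "(\<lambda>J. Lqnorm p lebesgue (majorant d nu J)) \<longlonglongrightarrow> 0"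
    and "AE x in lebesgue. majorant d nu 0 x < \<infinity>"
proof -
  obtain C where C: "0 < C"
    "\<And>(nu :: nat \<Rightarrow> int ^ 'n \<Rightarrow> ennreal) J.
       Lqnorm p lebesgue (majorant d nu J) \<le> ennreal (C * 2 powr (- (s / 2 * real J))) * b_enorm s p q nu"
    using majorant_bound[OF p q s d] by metis
  obtain b where b: "b_enorm s p q nu = ennreal b" "0 \<le> b" using fin by (cases "b_enorm s p q nu") auto
  have "(\<lambda>J. C * (2 powr (- (s / 2))) ^ J * b) \<longlonglongrightarrow> C * 0 * b"
    using s by (intro tendsto_intros LIMSEQ_power_zero) (simp add: powr_less_one)
  moreover have "(2 powr (- (s / 2))) ^ J = 2 powr (- (s / 2 * real J))" for J
    by (simp add: powr_realpow[symmetric] powr_powr)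
  ultimately have "(\<lambda>J. C * 2 powr (- (s / 2 * real J)) * b) \<longlonglongrightarrow> 0" by simp
  then have "(\<lambda>J. ennreal (C * 2 powr (- (s / 2 * real J)) * b)) \<longlonglongrightarrow> ennreal 0"
    by (rule tendsto_ennrealI)
  moreover have "ennreal (C * 2 powr (- (s / 2 * real J)) * b) = ennreal (C * 2 powr (- (s / 2 * real J))) * b_enorm s p q nu" for J
    using C b by (simp add: ennreal_mult)
  ultimately have lim: "(\<lambda>J. ennreal (C * 2 powr (- (s / 2 * real J))) * b_enorm s p q nu) \<longlonglongrightarrow> 0" by simp
  show "(\<lambda>J. Lqnorm p lebesgue (majorant d nu J)) \<longlonglongrightarrow> 0"
    by (rule tendsto_sandwich[OF _ _ tendsto_const lim]) (use C in auto)
  have "Lqnorm p lebesgue (majorant d nu 0) < \<infinity>"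
    by (rule le_less_trans[OF C(2)]) (simp add: b ennreal_mult_less_top)
  then show "AE x in lebesgue. majorant d nu 0 x < \<infinity>"
  proof (cases "p = \<infinity>")
    case True
    have "AE x in lebesgue. majorant d nu 0 x \<le> Lqnorm \<infinity> lebesgue (majorant d nu 0)" by (rule AE_le_Lqnorm_top)
    then show ?thesis
      by eventually_elim (use True \<open>Lqnorm p lebesgue (majorant d nu 0) < \<infinity>\<close> in \<open>simp add: le_less_trans\<close>)
  next
    case False
    note r = exponent_pos[OF p False]
    have "(\<integral>\<^sup>+x. epowr (majorant d nu 0 x) (enn2real p) \<partial>lebesgue) \<noteq> \<infinity>"
      using \<open>Lqnorm p lebesgue (majorant d nu 0) < \<infinity>\<close> Lqnorm_powr[OF p False, of lebesgue "majorant d nu 0"]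
      by (auto simp: epowr_def split: if_splits)
    then have "AE x in lebesgue. epowr (majorant d nu 0 x) (enn2real p) \<noteq> \<infinity>"
      by (intro nn_integral_PInf_AE) measurable
    then show ?thesis by eventually_elim (auto simp: less_top[symmetric])
  qed
qed

section \<open>Superposition of coefficient sequences\<close>

lemma ennreal_le_divide_powr:
  assumes "ennreal (2 powr a) * x \<le> ennreal B" "0 \<le> B"
  shows "x \<le> ennreal (B * 2 powr (- a))"
proof -
  have "x = ennreal (2 powr (- a)) * (ennreal (2 powr a) * x)" by (simp only: powr2_cancel)
  also have "\<dots> \<le> ennreal (2 powr (- a)) * ennreal B" by (rule mult_left_mono[OF assms(1)]) simp
  also have "\<dots> = ennreal (B * 2 powr (- a))" using assms(2) by (simp add: ennreal_mult mult.commute)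
  finally show ?thesis .
qed

lemma lqnorm_shift:
  fixes z :: "nat \<Rightarrow> ennreal"
  assumes q: "0 < q"
  shows "lqnorm q (\<lambda>r. if i \<le> r then z (r - i) else 0) \<le> lqnorm q z"
proof (cases "q = \<infinity>")
  case True
  have "z j \<le> lqnorm q z" for j by (rule lqnorm_ge_term[OF q])
  then have "Lqnorm \<infinity> (count_space UNIV) (\<lambda>r. if i \<le> r then z (r - i) else 0) \<le> lqnorm q z"
    by (intro Lqnorm_topI) (auto simp: AE_count_space)
  then show ?thesis using True by simp
next
  case False
  let ?r = "enn2real q"
  have "(\<Sum>\<^sub>\<infinity>r. epowr (if i \<le> r then z (r - i) else 0) ?r) = (\<Sum>\<^sub>\<infinity>r\<in>(\<lambda>j. j + i) ` UNIV. epowr (z (r - i)) ?r)"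
  proof (rule infsum_cong_neutral)
    fix x assume "x \<in> UNIV - (\<lambda>j. j + i) ` UNIV"
    then have "\<not> i \<le> x" by (metis DiffD2 le_add_diff_inverse2 rangeI)
    then show "epowr (if i \<le> x then z (x - i) else 0) ?r = 0" by simp
  qed auto
  also have "\<dots> = (\<Sum>\<^sub>\<infinity>j. epowr (z j) ?r)"
    by (subst infsum_reindex) (auto simp: comp_def inj_on_def)
  finally show ?thesis
    by (intro Lqnorm_leI[OF q False]) (simp add: Lqnorm_powr[OF q False] nn_integral_count_space_infsum)
qed

lemma infsum_rev:
  fixes h :: "nat \<Rightarrow> ennreal"
  assumes "\<And>j. r < j \<Longrightarrow> h j = 0"
  shows "(\<Sum>\<^sub>\<infinity>j. h j) = (\<Sum>i. if i \<le> r then h (r - i) else 0)"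
proof -
  have "(\<Sum>\<^sub>\<infinity>j. h j) = (\<Sum>j\<le>r. h j)"
    by (rule infsumI, rule has_sum_finite_neutralI) (use assms in auto)
  also have "\<dots> = (\<Sum>i\<le>r. h (r - i))"
    by (rule sum.reindex_bij_witness[of _ "\<lambda>i. r - i" "\<lambda>i. r - i"]) auto
  also have "\<dots> = (\<Sum>i\<le>r. if i \<le> r then h (r - i) else 0)" by (intro sum.cong) auto
  also have "\<dots> = (\<Sum>i. if i \<le> r then h (r - i) else 0)"
    by (rule suminf_finite[symmetric]) auto
  finally show ?thesis .
qed

text \<open>Put \<open>i = r - j\<close>. The overlap lemma bounds the contribution of level \<open>r - i\<close> to level \<open>r\<close>, and on the
scale of \<open>b\<^sup>s\<^sub>p\<^sub>,\<^sub>q\<close> this contribution carries the factor \<open>2\<^bsup>-i(\<sigma>-s)\<^esup>\<close>. With \<open>\<sigma> - s = 3e\<close>, one third of the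
exponent pays for the sum over \<open>i\<close> in \<open>\<ell>\<^sub>p\<close> and one third for that in \<open>\<ell>\<^sub>q\<close>.\<close>

lemma synthesis_bound:
  assumes p: "0 < p" and q: "0 < q" and s: "s < \<sigma>" and D: "0 \<le> D" and B: "0 \<le> B"
  obtains C :: real where "0 < C"
    "\<And>(L :: nat \<Rightarrow> int ^ 'n \<Rightarrow> ennreal) (H :: nat \<Rightarrow> int ^ 'n \<Rightarrow> nat \<Rightarrow> int ^ 'n \<Rightarrow> ennreal).
       (\<And>j m r l. H j m r l \<noteq> 0 \<Longrightarrow> j \<le> r \<and> l \<in> near (D * 2 ^ (r - j)) (2 ^ (r - j) *\<^sub>R rvec m)) \<Longrightarrow>
       (\<And>j m r. j \<le> r \<Longrightarrow>
          ennreal (2 powr (real (r - j) * (\<sigma> - dim_exp TYPE('n) p))) * lqnorm p (H j m r) \<le> ennreal B) \<Longrightarrow>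
       b_enorm s p q (\<lambda>r l. \<Sum>\<^sub>\<infinity>(j, m). L j m * H j m r l) \<le> ennreal C * b_enorm s p q L"
proof -
  let ?a = "dim_exp TYPE('n) p"
  define e where "e = (\<sigma> - s) / 3"
  have e: "0 < e" using s by (simp add: e_def)
  obtain A where A: "0 < A"
    "\<And>(M :: (int ^ 'n) measure) (g :: nat \<Rightarrow> int ^ 'n \<Rightarrow> ennreal). (\<And>i. g i \<in> borel_measurable M) \<Longrightarrow>
       Lqnorm p M (\<lambda>x. \<Sum>i. g i x) \<le> ennreal A * (SUP i. ennreal (2 powr (e * real i)) * Lqnorm p M (g i))"
    using Lqnorm_suminf[OF p e] by metis
  obtain A' where A': "0 < A'"
    "\<And>(M :: nat measure) (g :: nat \<Rightarrow> nat \<Rightarrow> ennreal). (\<And>i. g i \<in> borel_measurable M) \<Longrightarrow>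
       Lqnorm q M (\<lambda>x. \<Sum>i. g i x) \<le> ennreal A' * (SUP i. ennreal (2 powr (e * real i)) * Lqnorm q M (g i))"
    using Lqnorm_suminf[OF q e] by metis
  define N where "N = overlap D TYPE('n)"
  \<comment> \<open>The summand \<open>1\<close> keeps the constant positive in case \<open>B = 0\<close>.\<close>
  define C where "C = A * (N * B) * A' + 1"
  have C: "0 < C" unfolding C_def using A A' B by (simp add: add_nonneg_pos)
  show thesis
  proof (rule that[OF C])
    fix L :: "nat \<Rightarrow> int ^ 'n \<Rightarrow> ennreal" and H :: "nat \<Rightarrow> int ^ 'n \<Rightarrow> nat \<Rightarrow> int ^ 'n \<Rightarrow> ennreal"
    assume near: "\<And>j m r l. H j m r l \<noteq> 0 \<Longrightarrow> j \<le> r \<and> l \<in> near (D * 2 ^ (r - j)) (2 ^ (r - j) *\<^sub>R rvec m)"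
      and bound: "\<And>j m r. j \<le> r \<Longrightarrow>
          ennreal (2 powr (real (r - j) * (\<sigma> - ?a))) * lqnorm p (H j m r) \<le> ennreal B"
    define nu where "nu r l = (\<Sum>\<^sub>\<infinity>(j, m). L j m * H j m r l)" for r l
    define g where "g r i l = (if i \<le> r then (\<Sum>\<^sub>\<infinity>m. L (r - i) m * H (r - i) m r l) else 0)" for r i l
    define z where "z j = ennreal (2 powr (real j * (s - ?a))) * lqnorm p (L j)" for j
    define h where "h i r = (if i \<le> r then ennreal (2 powr (- (2 * e) * real i)) * z (r - i) else 0)" for i r
    \<comment> \<open>Terms with \<open>j > r\<close> vanish; the others are counted by \<open>i = r - j\<close>.\<close>
    have nu_g: "nu r = (\<lambda>l. \<Sum>i. g r i l)" for r
    proof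
      fix l
      have "(\<Sum>\<^sub>\<infinity>m. L j m * H j m r l) = 0" if "r < j" for j
      proof -
        have "H j m r l = 0" for m using near[of j m r l] that by force
        then show ?thesis by simp
      qed
      then show "nu r l = (\<Sum>i. g r i l)"
        unfolding nu_def g_def infsum_pair_ennreal by (rule infsum_rev)
    qed
    have g_bound: "lqnorm p (g r i) \<le> of_nat N * (ennreal (B * 2 powr (- (real i * (\<sigma> - ?a)))) * lqnorm p (L (r - i)))"
      if i: "i \<le> r" for r i
    proof -
      have sub: "{m. H (r - i) m r l \<noteq> 0} \<subseteq> near D ((1 / 2 ^ i) *\<^sub>R rvec l)" for l
      proof
        fix m assume "m \<in> {m. H (r - i) m r l \<noteq> 0}"
        then have n: "l \<in> near (D * 2 ^ i) (2 ^ i *\<^sub>R rvec m)" using near[of "r - i" m r l] i by simp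
        then show "m \<in> near D ((1 / 2 ^ i) *\<^sub>R rvec l)" by (rule near_rescale)
      qed
      have fin: "finite {m. H (r - i) m r l \<noteq> 0}" for l by (rule finite_subset[OF sub]) simp
      have card: "card {m. H (r - i) m r l \<noteq> 0} \<le> N" for l
        unfolding N_def by (rule order_trans[OF card_mono[OF _ sub] card_near_overlap[OF D]]) simp
      have W: "lqnorm p (H (r - i) m r) \<le> ennreal (B * 2 powr (- (real i * (\<sigma> - ?a))))" for m
        using bound[of "r - i" r m] i by (intro ennreal_le_divide_powr B) simp
      show ?thesis
        using i unfolding g_def by (simp, intro Lqnorm_overlap[OF p _ fin card W]) auto
    qed
    have level: "ennreal (2 powr (real r * (s - ?a))) * lqnorm p (nu r) \<le> ennreal (A * (N * B)) * (\<Sum>i. h i r)" for r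
    proof -
      have "ennreal (2 powr (e * real i)) * lqnorm p (g r i) \<le> ennreal (2 powr (- (real r * (s - ?a)))) * (ennreal (N * B) * (\<Sum>i. h i r))" for i
      proof (cases "i \<le> r")
        case False
        then show ?thesis using p by (simp add: g_def[abs_def] Lqnorm_zero)
      next
        case True
        have "ennreal (2 powr (e * real i)) * lqnorm p (g r i) \<le> ennreal (2 powr (e * real i)) *
            (of_nat N * (ennreal (B * 2 powr (- (real i * (\<sigma> - ?a)))) * lqnorm p (L (r - i))))"
          by (intro mult_left_mono g_bound[OF True]) simp
        also have "\<dots> = ennreal (N * B * (2 powr (e * real i) * 2 powr (- (real i * (\<sigma> - ?a))))) * lqnorm p (L (r - i))"
          using B by (simp add: ennreal_mult ennreal_of_nat_eq_real_of_nat mult_ac)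
        also have "2 powr (e * real i) * 2 powr (- (real i * (\<sigma> - ?a)))
            = 2 powr (- (real r * (s - ?a))) * (2 powr (- (2 * e) * real i) * 2 powr (real (r - i) * (s - ?a)))"
        proof -
          have "\<sigma> = s + 3 * e" by (simp add: e_def field_simps)
          then have "e * real i + - (real i * (\<sigma> - ?a)) = - (real r * (s - ?a)) + (- (2 * e) * real i + real (r - i) * (s - ?a))"
            using True by (simp add: of_nat_diff algebra_simps)
          then show ?thesis by (simp only: powr_add[symmetric])
        qed
        also have "ennreal (N * B * (2 powr (- (real r * (s - ?a))) * (2 powr (- (2 * e) * real i) * 2 powr (real (r - i) * (s - ?a))))) * lqnorm p (L (r - i))
            = ennreal (2 powr (- (real r * (s - ?a)))) * (ennreal (N * B) * h i r)"
          using True B by (simp add: h_def z_def ennreal_mult mult_ac)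
        also have "\<dots> \<le> ennreal (2 powr (- (real r * (s - ?a)))) * (ennreal (N * B) * (\<Sum>i. h i r))"
          using infsum_ge_term[of "\<lambda>i. h i r" i] by (intro mult_left_mono) (auto simp: infsum_nat_ennreal)
        finally show ?thesis .
      qed
      then have "lqnorm p (nu r) \<le> ennreal A * (ennreal (2 powr (- (real r * (s - ?a)))) * (ennreal (N * B) * (\<Sum>i. h i r)))"
        unfolding nu_g by (intro order_trans[OF A(2)] mult_left_mono SUP_least) auto
      then have "ennreal (2 powr (real r * (s - ?a))) * lqnorm p (nu r) \<le> ennreal (2 powr (real r * (s - ?a))) *
          (ennreal A * (ennreal (2 powr (- (real r * (s - ?a)))) * (ennreal (N * B) * (\<Sum>i. h i r))))"
        by (rule mult_left_mono) simp
      also have "\<dots> = ennreal (A * (N * B)) * (ennreal (2 powr (- (real r * (s - ?a)))) * (ennreal (2 powr (real r * (s - ?a))) * (\<Sum>i. h i r)))"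
        using A B by (simp add: ennreal_mult mult_ac)
      finally show ?thesis unfolding powr2_cancel .
    qed
    \<comment> \<open>The remaining factor \<open>2\<^bsup>-2ei\<^esup>\<close> makes this a convolution with a geometric sequence in \<open>\<ell>\<^sub>q\<close>.\<close>
    have "b_enorm s p q nu \<le> lqnorm q (\<lambda>r. ennreal (A * (N * B)) * (\<Sum>i. h i r))"
      unfolding b_enorm_def by (rule lqnorm_mono[OF q level])
    also have "\<dots> \<le> ennreal (A * (N * B)) * lqnorm q (\<lambda>r. \<Sum>i. h i r)"
      by (rule Lqnorm_cmult_le[OF q]) simp
    also have "\<dots> \<le> ennreal (A * (N * B)) * (ennreal A' * lqnorm q z)"
    proof (intro mult_left_mono order_trans[OF A'(2)] SUP_least)
      fix i :: nat
      have "lqnorm q (h i) = lqnorm q (\<lambda>r. ennreal (2 powr (- (2 * e) * real i)) * (if i \<le> r then z (r - i) else 0))"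
        unfolding h_def by (rule arg_cong[where f="lqnorm q"]) auto
      also have "\<dots> \<le> ennreal (2 powr (- (2 * e) * real i)) * lqnorm q (\<lambda>r. if i \<le> r then z (r - i) else 0)"
        by (rule Lqnorm_cmult_le[OF q]) simp
      also have "\<dots> \<le> ennreal (2 powr (- (2 * e) * real i)) * lqnorm q z"
        by (intro mult_left_mono lqnorm_shift[OF q]) simp
      finally have "ennreal (2 powr (e * real i)) * lqnorm q (h i) \<le> ennreal (2 powr (e * real i)) * (ennreal (2 powr (- (2 * e) * real i)) * lqnorm q z)"
        by (rule mult_left_mono) simp
      also have "\<dots> = ennreal (2 powr (- e * real i)) * lqnorm q z"
        by (simp add: mult.assoc[symmetric] ennreal_mult[symmetric] powr_add[symmetric])
      also have "\<dots> \<le> 1 * lqnorm q z"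
      proof (rule mult_right_mono)
        have "2 powr (- e * real i) \<le> 2 powr (0 :: real)" using e by (intro powr_mono) auto
        then show "ennreal (2 powr (- e * real i)) \<le> 1" by (simp add: ennreal_le_1)
      qed simp
      finally show "ennreal (2 powr (e * real i)) * lqnorm q (h i) \<le> lqnorm q z" by simp
    qed auto
    also have "\<dots> = ennreal (A * (N * B) * A') * b_enorm s p q L"
      using A A' B by (simp add: ennreal_mult mult.assoc b_enorm_def z_def[abs_def])
    also have "\<dots> \<le> ennreal C * b_enorm s p q L"
      by (intro mult_right_mono ennreal_leI) (auto simp: C_def)
    finally show "b_enorm s p q (\<lambda>r l. \<Sum>\<^sub>\<infinity>(j, m). L j m * H j m r l) \<le> ennreal C * b_enorm s p q L"
      unfolding nu_def .
  qed
qed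

section \<open>Series of smooth atoms\<close>

lemma smooth_atom_measurable: "smooth_atom K d j m a \<Longrightarrow> a \<in> borel_measurable lebesgue"
proof -
  assume "smooth_atom K d j m a"
  then have "continuous_on UNIV a" using C_k_continuous by (auto simp: smooth_atom_def)
  then have "a \<in> borel_measurable borel" by (rule borel_measurable_continuous_onI)
  then show ?thesis by (simp add: measurable_completion)
qed

lemma smooth_atom_le_indicator:
  assumes "smooth_atom K d j m a"
  shows "ennreal (norm (a x)) \<le> indicator (dcube d j m) x"
proof (cases "a x = 0")
  case False
  have "Ck_le K 1 (\<lambda>x. a (x /\<^sub>R 2 ^ j))" "x \<in> dcube d j m" using assms False by (auto simp: smooth_atom_iff_Ck_le)
  then show ?thesis using Ck_le_bound[of K 1 "\<lambda>x. a (x /\<^sub>R 2 ^ j)" "2 ^ j *\<^sub>R x"] by (simp add: ennreal_le_1)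
qed simp

lemma atom_majorant_dominated:
  fixes nu :: "nat \<Rightarrow> int ^ 'n \<Rightarrow> ennreal"
  assumes "\<And>r l. ennreal (norm (v r l x)) \<le> nu r l * indicator (dcube d r l) x"
  shows "(\<Sum>\<^sub>\<infinity>(j, m). if J \<le> j then ennreal (norm (v j m x)) else 0) \<le> majorant d nu J x"
  unfolding majorant_eq_infsum by (rule infsum_mono_ennreal) (use assms in auto)

lemma Lp_sums_atoms_iff:
  fixes lam :: "nat \<Rightarrow> int ^ 'n \<Rightarrow> complex"
  assumes p: "0 < p" and q: "0 < q" and s: "0 < s" and d: "0 \<le> d"
    and fin: "b_qnorm s p q lam < \<infinity>" and a: "\<And>j m. smooth_atom K d j m (a j m)"
    and f: "f \<in> borel_measurable lebesgue"
  shows "Lp_sums p (\<lambda>j m x. lam j m * a j m x) f \<longleftrightarrow>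
     (AE x in lebesgue. ((\<lambda>(j, m). lam j m * a j m x) has_sum f x) UNIV)"
proof (rule Lp_sums_iff_AE[OF p _ f])
  let ?nu = "\<lambda>j m. ennreal (norm (lam j m))"
  have fin': "b_enorm s p q ?nu < \<infinity>" using fin by (simp add: b_qnorm_eq)
  show "(\<lambda>J. Lqnorm p lebesgue (majorant d ?nu J)) \<longlonglongrightarrow> 0" "AE x in lebesgue. majorant d ?nu 0 x < \<infinity>"
    using majorant_tendsto_0[OF p q s d fin'] by auto
  show "AE x in lebesgue. \<forall>J. (\<Sum>\<^sub>\<infinity>(j, m). if J \<le> j then ennreal (norm (lam j m * a j m x)) else 0) \<le> majorant d ?nu J x"
    by (intro AE_I2 allI atom_majorant_dominated)
       (auto simp: norm_mult ennreal_mult intro!: mult_left_mono smooth_atom_le_indicator[OF a])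
  show "(\<lambda>x. lam j m * a j m x) \<in> borel_measurable lebesgue" for j m
    using smooth_atom_measurable[OF a[of j m]] by simp
qed simp

lemma atom_sum_norm_le_majorant:
  fixes lam :: "nat \<Rightarrow> int ^ 'n \<Rightarrow> complex"
  assumes a: "\<And>j m. smooth_atom K d j m (a j m)" and S: "((\<lambda>(j, m). lam j m * a j m x) has_sum S) UNIV"
  shows "ennreal (norm S) \<le> majorant d (\<lambda>j m. ennreal (norm (lam j m))) 0 x"
proof -
  let ?g = "\<lambda>(j, m). lam j m * a j m x"
  have le: "(\<Sum>\<^sub>\<infinity>i. ennreal (norm (?g i))) \<le> majorant d (\<lambda>j m. ennreal (norm (lam j m))) 0 x"
  proof -
    have "(\<Sum>\<^sub>\<infinity>i. ennreal (norm (?g i))) = (\<Sum>\<^sub>\<infinity>(j, m). if 0 \<le> j then ennreal (norm (lam j m * a j m x)) else 0)"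
      by (rule infsum_cong) auto
    also have "\<dots> \<le> majorant d (\<lambda>j m. ennreal (norm (lam j m))) 0 x"
      by (rule atom_majorant_dominated)
         (auto simp: norm_mult ennreal_mult intro!: mult_left_mono smooth_atom_le_indicator[OF a])
    finally show ?thesis .
  qed
  show ?thesis
  proof (cases "(\<Sum>\<^sub>\<infinity>i. ennreal (norm (?g i))) < \<infinity>")
    case True
    have "ennreal (norm S) = ennreal (norm (infsum ?g UNIV))" using infsumI[OF S] by simp
    also have "\<dots> \<le> (\<Sum>\<^sub>\<infinity>i. ennreal (norm (?g i)))"
      using norm_infsum_le_ennreal[OF True, of UNIV] by simp
    finally show ?thesis using le by simp
  next
    case False
    then have "(\<Sum>\<^sub>\<infinity>i. ennreal (norm (?g i))) = top"
      unfolding infinity_ennreal_def less_top[symmetric] by blast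
    then have "majorant d (\<lambda>j m. ennreal (norm (lam j m))) 0 x = top"
      using le by (simp only: top_unique)
    then show ?thesis by simp
  qed
qed

section \<open>Molecules\<close>

text \<open>The atoms are indexed by their absolute level \<open>r\<close> rather than by \<open>r - j\<close>, so that collecting the
contributions of all molecules to one cube needs no reindexing.\<close>

definition molecule ::
  "nat \<Rightarrow> real \<Rightarrow> real \<Rightarrow> ennreal \<Rightarrow> real \<Rightarrow> real \<Rightarrow> nat \<Rightarrow> int ^ 'n \<Rightarrow> (real ^ 'n \<Rightarrow> complex) \<Rightarrow> bool" where
  "molecule K d \<sigma> p D B j m u \<longleftrightarrow>
     (\<exists>eta b. (\<forall>r l. smooth_atom K d r l (b r l)) \<and>
       (\<forall>r l. eta r l \<noteq> 0 \<longrightarrow> j \<le> r \<and> l \<in> near (D * 2 ^ (r - j)) (2 ^ (r - j) *\<^sub>R rvec m)) \<and>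
       (\<forall>r\<ge>j. ennreal (2 powr (real (r - j) * (\<sigma> - dim_exp TYPE('n) p))) *
          lqnorm p (\<lambda>l. ennreal (norm (eta r l))) \<le> ennreal B) \<and>
       (AE x in lebesgue. ((\<lambda>(r, l). eta r l * b r l x) has_sum u x) UNIV))"

lemma molecule_measurable:
  assumes "molecule K d \<sigma> p D B j m u"
  shows "u \<in> borel_measurable lebesgue"
proof -
  obtain eta b where b: "\<And>r l. smooth_atom K d r l (b r l)"
    and S: "AE x in lebesgue. ((\<lambda>(r, l). eta r l * b r l x) has_sum u x) UNIV"
    using assms unfolding molecule_def by blast
  show ?thesis
  proof (rule has_sum_measurable[of "\<lambda>(r, l) x. eta r l * b r l x"])
    show "(case i of (r, l) \<Rightarrow> \<lambda>x. eta r l * b r l x) \<in> borel_measurable lebesgue" for i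
      using smooth_atom_measurable[OF b] by (cases i) simp
    show "AE x in lebesgue. ((\<lambda>i. (case i of (r, l) \<Rightarrow> \<lambda>x. eta r l * b r l x) x) has_sum u x) UNIV"
      using S by eventually_elim (simp add: case_prod_unfold)
  qed
qed

text \<open>Dividing by the sum of the moduli also covers the case that all coefficients vanish, since then
the quotient is \<open>0\<close>.\<close>

lemma smooth_atom_convex_combination:
  assumes "finite I" and a: "\<And>i. i \<in> I \<Longrightarrow> smooth_atom K d r l (b i)"
    and c: "(\<Sum>i\<in>I. norm (c i)) = N"
  shows "smooth_atom K d r l (\<lambda>x. (\<Sum>i\<in>I. c i * b i x) / of_real N)"
  unfolding smooth_atom_iff_Ck_le
proof
  have "Ck_le K (\<Sum>i\<in>I. norm (c i) * 1) (\<lambda>x. \<Sum>i\<in>I. c i * b i (x /\<^sub>R 2 ^ r))"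
    using a by (intro Ck_le_sum Ck_le_cmult assms(1)) (auto simp: smooth_atom_iff_Ck_le)
  then have "Ck_le K (norm (inverse (of_real N) :: complex) * N)
      (\<lambda>x. inverse (of_real N) * (\<Sum>i\<in>I. c i * b i (x /\<^sub>R 2 ^ r)))"
    using c by (intro Ck_le_cmult) simp
  moreover have "norm (inverse (of_real N) :: complex) * N \<le> 1"
    using c by (cases "N = 0") (auto simp: norm_inverse sum_nonneg abs_of_nonneg)
  ultimately show "Ck_le K 1 (\<lambda>x. (\<Sum>i\<in>I. c i * b i (x /\<^sub>R 2 ^ r)) / of_real N)"
    by (subst divide_inverse, subst mult.commute) (rule Ck_le_mono, auto)
  show "\<forall>x. (\<Sum>i\<in>I. c i * b i x) / of_real N \<noteq> 0 \<longrightarrow> x \<in> dcube d r l"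
  proof (intro allI impI)
    fix x assume "(\<Sum>i\<in>I. c i * b i x) / of_real N \<noteq> 0"
    then obtain i where "i \<in> I" "c i * b i x \<noteq> 0" by (auto elim: sum.not_neutral_contains_not_neutral)
    then show "x \<in> dcube d r l" using a[of i] by (auto simp: smooth_atom_iff_Ck_le)
  qed
qed

text \<open>Every representation by building blocks \<open>P\<close> can be replaced by one with building blocks \<open>Q\<close> at the
cost of a constant \<open>C\<close>. Measurability of \<open>f\<close> is what identifies it, as an \<open>L\<^sub>p\<close> limit, with an
almost everywhere sum.\<close>

definition refines ::
  "real \<Rightarrow> ennreal \<Rightarrow> ennreal \<Rightarrow> (nat \<Rightarrow> int ^ 'n \<Rightarrow> (real ^ 'n \<Rightarrow> complex) \<Rightarrow> bool) \<Rightarrow>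
   (nat \<Rightarrow> int ^ 'n \<Rightarrow> (real ^ 'n \<Rightarrow> complex) \<Rightarrow> bool) \<Rightarrow> real \<Rightarrow> bool" where
  "refines s p q P Q C \<longleftrightarrow>
     (\<forall>f lam a. f \<in> borel_measurable lebesgue \<longrightarrow> atomic_rep s p q P f lam a \<longrightarrow>
        (\<exists>lam' a'. atomic_rep s p q Q f lam' a' \<and> b_qnorm s p q lam' \<le> ennreal C * b_qnorm s p q lam))"

lemma atomic_rep_mono:
  "atomic_rep s p q P f lam a \<Longrightarrow> (\<And>j m a. P j m a \<Longrightarrow> Q j m a) \<Longrightarrow> atomic_rep s p q Q f lam a"
  by (auto simp: atomic_rep_def)

lemma refines_mono:
  assumes R: "refines s p q P Q C"
    and P: "\<And>j m a. P' j m a \<Longrightarrow> P j m a" and Q: "\<And>j m a. Q j m a \<Longrightarrow> Q' j m a"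
  shows "refines s p q P' Q' C"
  unfolding refines_def
proof (intro allI impI)
  fix f lam a assume f: "f \<in> borel_measurable lebesgue" and rep: "atomic_rep s p q P' f lam a"
  have "atomic_rep s p q P f lam a" by (rule atomic_rep_mono[OF rep]) (rule P)
  then obtain lam' a' where 1: "atomic_rep s p q Q f lam' a'" "b_qnorm s p q lam' \<le> ennreal C * b_qnorm s p q lam"
    using R f unfolding refines_def by blast
  have "atomic_rep s p q Q' f lam' a'" by (rule atomic_rep_mono[OF 1(1)]) (rule Q)
  then show "\<exists>lam' a'. atomic_rep s p q Q' f lam' a' \<and> b_qnorm s p q lam' \<le> ennreal C * b_qnorm s p q lam"
    using 1(2) by blast
qed

lemma refines_trans:
  assumes PQ: "refines s p q P Q C" and QR: "refines s p q Q R C'" and C: "0 \<le> C" "0 \<le> C'"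
  shows "refines s p q P R (C' * C)"
  unfolding refines_def
proof (intro allI impI)
  fix f lam a assume f: "f \<in> borel_measurable lebesgue" and rep: "atomic_rep s p q P f lam a"
  obtain lam1 a1 where 1: "atomic_rep s p q Q f lam1 a1" "b_qnorm s p q lam1 \<le> ennreal C * b_qnorm s p q lam"
    using PQ f rep unfolding refines_def by blast
  obtain lam2 a2 where 2: "atomic_rep s p q R f lam2 a2" "b_qnorm s p q lam2 \<le> ennreal C' * b_qnorm s p q lam1"
    using QR f 1(1) unfolding refines_def by blast
  have "b_qnorm s p q lam2 \<le> ennreal C' * (ennreal C * b_qnorm s p q lam)"
    by (rule order_trans[OF 2(2) mult_left_mono[OF 1(2)]]) simp
  then show "\<exists>lam' a'. atomic_rep s p q R f lam' a' \<and> b_qnorm s p q lam' \<le> ennreal (C' * C) * b_qnorm s p q lam"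
    using 2(1) C by (auto simp: ennreal_mult mult.assoc)
qed

text \<open>For each cube the collected terms are a finite sum of atoms at that cube; divided by the sum \<open>nu\<close>
of the moduli of their coefficients it is again an atom. The sequence \<open>nu\<close> is in \<open>b\<^sup>s\<^sub>p\<^sub>,\<^sub>q\<close> by
\<open>synthesis_bound\<close>, and its majorant dominates the expanded fourfold series absolutely almost
everywhere. Therefore the order of summation is immaterial, and the series of molecules as well as
that of the new atoms converge to the same function. The third conclusion is needed to multiply
molecular representations by scalars.\<close>

lemma molecular_synthesis:
  assumes p: "0 < p" and q: "0 < q" and s: "0 < s" "s < \<sigma>" and d: "0 \<le> d" and D: "0 \<le> D" and B: "0 \<le> B"
  obtains C :: real where "0 < C"
    "refines s p q (molecule K d \<sigma> p D B) (smooth_atom K d :: nat \<Rightarrow> int ^ 'n \<Rightarrow> _ \<Rightarrow> bool) C"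
    "\<And>lam u (f :: real ^ 'n \<Rightarrow> complex). f \<in> borel_measurable lebesgue \<Longrightarrow> b_qnorm s p q lam < \<infinity> \<Longrightarrow>
       (\<And>j m. molecule K d \<sigma> p D B j m (u j m)) \<Longrightarrow>
       Lp_sums p (\<lambda>j m x. lam j m * u j m x) f \<longleftrightarrow>
         (AE x in lebesgue. ((\<lambda>(j, m). lam j m * u j m x) has_sum f x) UNIV)"
proof -
  obtain C where C: "0 < C"
    "\<And>(L :: nat \<Rightarrow> int ^ 'n \<Rightarrow> ennreal) (H :: nat \<Rightarrow> int ^ 'n \<Rightarrow> nat \<Rightarrow> int ^ 'n \<Rightarrow> ennreal).
       (\<And>j m r l. H j m r l \<noteq> 0 \<Longrightarrow> j \<le> r \<and> l \<in> near (D * 2 ^ (r - j)) (2 ^ (r - j) *\<^sub>R rvec m)) \<Longrightarrow>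
       (\<And>j m r. j \<le> r \<Longrightarrow>
          ennreal (2 powr (real (r - j) * (\<sigma> - dim_exp TYPE('n) p))) * lqnorm p (H j m r) \<le> ennreal B) \<Longrightarrow>
       b_enorm s p q (\<lambda>r l. \<Sum>\<^sub>\<infinity>(j, m). L j m * H j m r l) \<le> ennreal C * b_enorm s p q L"
    by (rule synthesis_bound[OF p q s(2) D B]) blast
  have main: "(Lp_sums p (\<lambda>j m x. lam j m * u j m x) f \<longleftrightarrow>
        (AE x in lebesgue. ((\<lambda>(j, m). lam j m * u j m x) has_sum f x) UNIV)) \<and>
      (Lp_sums p (\<lambda>j m x. lam j m * u j m x) f \<longrightarrow>
        (\<exists>lam' a. atomic_rep s p q (smooth_atom K d) f lam' a \<and> b_qnorm s p q lam' \<le> ennreal C * b_qnorm s p q lam))"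
    if f: "f \<in> borel_measurable lebesgue" and fin: "b_qnorm s p q lam < \<infinity>"
      and mol: "\<And>j m. molecule K d \<sigma> p D B j m (u j m)"
    for lam :: "nat \<Rightarrow> int ^ 'n \<Rightarrow> complex" and u :: "nat \<Rightarrow> int ^ 'n \<Rightarrow> real ^ 'n \<Rightarrow> complex" and f :: "real ^ 'n \<Rightarrow> complex"
  proof -
    obtain eta b where b: "\<And>j m r l. smooth_atom K d r l (b j m r l)"
      and near: "\<And>j m r l. eta j m r l \<noteq> 0 \<Longrightarrow> j \<le> r \<and> l \<in> near (D * 2 ^ (r - j)) (2 ^ (r - j) *\<^sub>R rvec m)"
      and bd: "\<And>j m r. j \<le> r \<Longrightarrow> ennreal (2 powr (real (r - j) * (\<sigma> - dim_exp TYPE('n) p))) *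
          lqnorm p (\<lambda>l. ennreal (norm (eta j m r l))) \<le> ennreal B"
      and u_sum: "\<And>j m. AE x in lebesgue. ((\<lambda>(r, l). eta j m r l * b j m r l x) has_sum u j m x) UNIV"
    proof -
      define P where "P = (\<lambda>(j, m) eta b. (\<forall>r l. smooth_atom K d r l (b r l)) \<and>
         (\<forall>r l. eta r l \<noteq> 0 \<longrightarrow> j \<le> r \<and> l \<in> near (D * 2 ^ (r - j)) (2 ^ (r - j) *\<^sub>R rvec m)) \<and>
         (\<forall>r\<ge>j. ennreal (2 powr (real (r - j) * (\<sigma> - dim_exp TYPE('n) p))) *
            lqnorm p (\<lambda>l. ennreal (norm (eta r l))) \<le> ennreal B) \<and>
         (AE x in lebesgue. ((\<lambda>(r, l). eta r l * b r l x) has_sum u j m x) UNIV))"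
      have "\<exists>w. P z (fst w) (snd w)" for z
        using mol[of "fst z" "snd z"] unfolding molecule_def P_def by (auto simp: case_prod_unfold)
      then obtain w where w: "\<And>z. P z (fst (w z)) (snd (w z))" by metis
      note w' = w[of "(j, m)" for j m, unfolded P_def prod.case]
      show ?thesis
        by (rule that[of "\<lambda>j m. snd (w (j, m))" "\<lambda>j m. fst (w (j, m))"]) (use w' in blast)+
    qed
    define L where "L j m = ennreal (norm (lam j m))" for j m
    define H where "H j m r l = ennreal (norm (eta j m r l))" for j m r l
    define nu where "nu r l = (\<Sum>\<^sub>\<infinity>(j, m). L j m * H j m r l)" for r l
    define I where "I r l = {(j, m). eta j m r l \<noteq> 0}" for r l
    define c where "c r l i = lam (fst i) (snd i) * eta (fst i) (snd i) r l" for r l i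
    define nr where "nr r l = (\<Sum>i\<in>I r l. norm (c r l i))" for r l
    define lam' where "lam' r l = complex_of_real (nr r l)" for r l
    define a where "a r l x = (\<Sum>i\<in>I r l. c r l i * b (fst i) (snd i) r l x) / of_real (nr r l)" for r l x
    have "b_enorm s p q nu \<le> ennreal C * b_enorm s p q L"
      unfolding nu_def by (rule C(2)) (use near bd in \<open>auto simp: H_def[abs_def]\<close>)
    moreover have L_eq: "b_enorm s p q L = b_qnorm s p q lam" by (simp add: b_qnorm_eq L_def[abs_def])
    ultimately have nu_le: "b_enorm s p q nu \<le> ennreal C * b_qnorm s p q lam" by simp
    also have "\<dots> < \<infinity>" using fin by (simp add: ennreal_mult_less_top)
    finally have nu_fin: "b_enorm s p q nu < \<infinity>" .
    \<comment> \<open>Only levels \<open>j \<le> r\<close> occur, and for each of them only cubes close to the given one.\<close>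
    have finI: "finite (I r l)" for r l
    proof (rule finite_subset)
      show "I r l \<subseteq> (SIGMA j:{..r}. near D ((1 / 2 ^ (r - j)) *\<^sub>R rvec l))"
        using near near_rescale by (fastforce simp: I_def)
    qed auto
    have nr0: "0 \<le> nr r l" for r l by (simp add: nr_def sum_nonneg)
    have nu_eq: "nu r l = ennreal (nr r l)" for r l
    proof -
      have "nu r l = (\<Sum>i\<in>I r l. L (fst i) (snd i) * H (fst i) (snd i) r l)"
        unfolding nu_def
        by (rule infsumI, rule has_sum_finite_neutralI[OF finI])
           (auto simp: I_def H_def case_prod_unfold)
      also have "\<dots> = (\<Sum>i\<in>I r l. ennreal (norm (c r l i)))"
        by (simp add: L_def H_def c_def norm_mult ennreal_mult)
      also have "\<dots> = ennreal (nr r l)" by (simp add: nr_def)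
      finally show ?thesis .
    qed
    have lam'_eq: "b_qnorm s p q lam' = b_enorm s p q nu"
      using nr0 by (simp add: b_qnorm_eq lam'_def nu_eq[abs_def])
    have atom: "smooth_atom K d r l (a r l)" for r l
      unfolding a_def by (rule smooth_atom_convex_combination[OF finI b]) (simp add: nr_def)
    have term_eq: "lam' r l * a r l x = (\<Sum>i\<in>I r l. c r l i * b (fst i) (snd i) r l x)" for r l x
    proof (cases "nr r l = 0")
      case True
      then have "norm (c r l i) = 0" if "i \<in> I r l" for i
        using that finI unfolding nr_def by (subst (asm) sum_nonneg_eq_0_iff) auto
      then show ?thesis using True by (simp add: lam'_def)
    next
      case False then show ?thesis by (simp add: lam'_def a_def)
    qed
    define theta where "theta i k x = lam (fst i) (snd i) * (eta (fst i) (snd i) (fst k) (snd k) * b (fst i) (snd i) (fst k) (snd k) x)"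
      for i k :: "nat \<times> (int ^ 'n)" and x
    \<comment> \<open>The fourfold series is dominated from level \<open>J\<close> of the new atoms on; as molecules of level \<open>j\<close> only
      contain atoms of levels \<open>r \<ge> j\<close>, the same majorant serves the series of molecules.\<close>
    have theta_majorant: "(\<Sum>\<^sub>\<infinity>i. \<Sum>\<^sub>\<infinity>k. if J \<le> fst k then ennreal (norm (theta i k x)) else 0) \<le> majorant d nu J x" for J x
    proof -
      have "(\<Sum>\<^sub>\<infinity>i. \<Sum>\<^sub>\<infinity>k. if J \<le> fst k then ennreal (norm (theta i k x)) else 0)
          = (\<Sum>\<^sub>\<infinity>k. \<Sum>\<^sub>\<infinity>i. if J \<le> fst k then ennreal (norm (theta i k x)) else 0)"
        by (rule infsum_swap_ennreal)
      also have "\<dots> \<le> (\<Sum>\<^sub>\<infinity>k. if J \<le> fst k then nu (fst k) (snd k) * indicator (dcube d (fst k) (snd k)) x else 0)"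
      proof (rule infsum_mono_ennreal)
        fix k :: "nat \<times> (int ^ 'n)"
        have "(\<Sum>\<^sub>\<infinity>i. ennreal (norm (theta i k x)))
            \<le> (\<Sum>\<^sub>\<infinity>i. indicator (dcube d (fst k) (snd k)) x * (L (fst i) (snd i) * H (fst i) (snd i) (fst k) (snd k)))"
        proof (rule infsum_mono_ennreal)
          fix i
          have "ennreal (norm (theta i k x)) = L (fst i) (snd i) * H (fst i) (snd i) (fst k) (snd k) * ennreal (norm (b (fst i) (snd i) (fst k) (snd k) x))"
            by (simp add: theta_def norm_mult ennreal_mult L_def H_def mult.assoc)
          also have "\<dots> \<le> L (fst i) (snd i) * H (fst i) (snd i) (fst k) (snd k) * indicator (dcube d (fst k) (snd k)) x"
            by (intro mult_left_mono smooth_atom_le_indicator[OF b]) simp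
          finally show "ennreal (norm (theta i k x)) \<le> indicator (dcube d (fst k) (snd k)) x * (L (fst i) (snd i) * H (fst i) (snd i) (fst k) (snd k))"
            by (simp add: mult.commute)
        qed
        also have "\<dots> = nu (fst k) (snd k) * indicator (dcube d (fst k) (snd k)) x"
          unfolding infsum_cmult_ennreal by (simp add: nu_def case_prod_unfold mult.commute)
        finally show "(\<Sum>\<^sub>\<infinity>i. if J \<le> fst k then ennreal (norm (theta i k x)) else 0)
            \<le> (if J \<le> fst k then nu (fst k) (snd k) * indicator (dcube d (fst k) (snd k)) x else 0)" by simp
      qed
      also have "\<dots> = majorant d nu J x" by (simp add: majorant_eq_infsum case_prod_unfold)
      finally show ?thesis .
    qed
    have ae: "AE x in lebesgue. majorant d nu 0 x < \<infinity> \<and> (\<forall>i. ((\<lambda>k. theta i k x) has_sum lam (fst i) (snd i) * u (fst i) (snd i) x) UNIV)"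
    proof -
      have "AE x in lebesgue. \<forall>j m. ((\<lambda>(r, l). eta j m r l * b j m r l x) has_sum u j m x) UNIV"
        using u_sum by (simp add: AE_all_countable)
      then show ?thesis
        using majorant_tendsto_0(2)[OF p q s(1) d nu_fin]
      proof eventually_elim
        case (elim x)
        have "((\<lambda>k. theta i k x) has_sum lam (fst i) (snd i) * u (fst i) (snd i) x) UNIV" for i
          using has_sum_cmult_right[OF elim(1)[rule_format, of "fst i" "snd i"], of "lam (fst i) (snd i)"]
          by (simp add: theta_def case_prod_unfold)
        then show ?case using elim by blast
      qed
    qed
    \<comment> \<open>The majorant of the new coefficients also controls the given series.\<close>
    have sums_iff: "Lp_sums p (\<lambda>j m x. lam j m * u j m x) f \<longleftrightarrow>
        (AE x in lebesgue. ((\<lambda>(j, m). lam j m * u j m x) has_sum f x) UNIV)"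
    proof (rule Lp_sums_iff_AE[OF p _ f majorant_measurable])
      show "(\<lambda>J. Lqnorm p lebesgue (majorant d nu J)) \<longlonglongrightarrow> 0" "AE x in lebesgue. majorant d nu 0 x < \<infinity>"
        using majorant_tendsto_0[OF p q s(1) d nu_fin] by auto
      show "(\<lambda>x. lam j m * u j m x) \<in> borel_measurable lebesgue" for j m
        using molecule_measurable[OF mol[of j m]] by simp
      show "AE x in lebesgue. \<forall>J. (\<Sum>\<^sub>\<infinity>(j, m). if J \<le> j then ennreal (norm (lam j m * u j m x)) else 0) \<le> majorant d nu J x"
        using ae
      proof eventually_elim
        case (elim x)
        show ?case
        proof
          fix J
          have "(\<Sum>\<^sub>\<infinity>(j, m). if J \<le> j then ennreal (norm (lam j m * u j m x)) else 0)
              = (\<Sum>\<^sub>\<infinity>i. if J \<le> fst i then ennreal (norm (lam (fst i) (snd i) * u (fst i) (snd i) x)) else 0)"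
            by (simp add: case_prod_unfold)
          also have "\<dots> \<le> (\<Sum>\<^sub>\<infinity>i. \<Sum>\<^sub>\<infinity>k. if J \<le> fst k then ennreal (norm (theta i k x)) else 0)"
          proof (rule infsum_mono_ennreal)
            fix i
            show "(if J \<le> fst i then ennreal (norm (lam (fst i) (snd i) * u (fst i) (snd i) x)) else 0)
                \<le> (\<Sum>\<^sub>\<infinity>k. if J \<le> fst k then ennreal (norm (theta i k x)) else 0)"
            proof (cases "J \<le> fst i")
              case True
              have "(\<Sum>\<^sub>\<infinity>k. ennreal (norm (theta i k x))) \<le> (\<Sum>\<^sub>\<infinity>i. \<Sum>\<^sub>\<infinity>k. ennreal (norm (theta i k x)))"
                by (rule infsum_ge_term)
              also have "\<dots> \<le> majorant d nu 0 x" using theta_majorant[of 0 x] by simp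
              finally have fin: "(\<Sum>\<^sub>\<infinity>k. ennreal (norm (theta i k x))) < \<infinity>" using elim by (auto intro: le_less_trans)
              have "ennreal (norm (lam (fst i) (snd i) * u (fst i) (snd i) x)) = ennreal (norm (infsum (\<lambda>k. theta i k x) UNIV))"
                using elim infsumI by metis
              also have "\<dots> \<le> (\<Sum>\<^sub>\<infinity>k. ennreal (norm (theta i k x)))"
                using norm_infsum_le_ennreal[OF fin, of UNIV] by simp
              also have "\<dots> \<le> (\<Sum>\<^sub>\<infinity>k. if J \<le> fst k then ennreal (norm (theta i k x)) else 0)"
              proof (rule infsum_mono_ennreal)
                fix k
                have "theta i k x = 0" if "\<not> J \<le> fst k"
                  using near[of "fst i" "snd i" "fst k" "snd k"] True that by (auto simp: theta_def)
                then show "ennreal (norm (theta i k x)) \<le> (if J \<le> fst k then ennreal (norm (theta i k x)) else 0)" by auto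
              qed
              finally show ?thesis using True by simp
            qed simp
          qed
          also have "\<dots> \<le> majorant d nu J x" by (rule theta_majorant)
          finally show "(\<Sum>\<^sub>\<infinity>(j, m). if J \<le> j then ennreal (norm (lam j m * u j m x)) else 0) \<le> majorant d nu J x" .
        qed
      qed
    qed
    have "\<exists>lam' a. atomic_rep s p q (smooth_atom K d) f lam' a \<and> b_qnorm s p q lam' \<le> ennreal C * b_qnorm s p q lam"
      if sums: "Lp_sums p (\<lambda>j m x. lam j m * u j m x) f"
    proof -
      have "AE x in lebesgue. ((\<lambda>(r, l). lam' r l * a r l x) has_sum f x) UNIV"
        using sums[unfolded sums_iff] ae
      proof eventually_elim
        case (elim x)
        define G where "G = (\<lambda>(i, k). theta i k x)"
        have "(\<Sum>\<^sub>\<infinity>z. ennreal (norm (G z))) = (\<Sum>\<^sub>\<infinity>(i, k). ennreal (norm (theta i k x)))"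
          by (rule infsum_cong) (auto simp: G_def)
        also have "\<dots> \<le> majorant d nu 0 x" using theta_majorant[of 0 x] by (simp add: infsum_pair_ennreal)
        finally have "(\<Sum>\<^sub>\<infinity>z. ennreal (norm (G z))) < \<infinity>" using elim by (auto intro: le_less_trans)
        then have "G summable_on UNIV \<times> UNIV" by (rule norm_summable_of_finite(2))
        moreover have "((\<lambda>i. lam (fst i) (snd i) * u (fst i) (snd i) x) has_sum f x) UNIV"
          using elim(1) by (simp add: case_prod_unfold)
        ultimately have "(G has_sum f x) (UNIV \<times> UNIV)"
          using elim(2) by (intro has_sum_SigmaI[where g="\<lambda>i. lam (fst i) (snd i) * u (fst i) (snd i) x"]) (auto simp: G_def)
        then have "((\<lambda>(k, i). G (i, k)) has_sum f x) (UNIV \<times> UNIV)"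
          by (subst (asm) has_sum_swap)
        then have "((\<lambda>k. lam' (fst k) (snd k) * a (fst k) (snd k) x) has_sum f x) UNIV"
        proof (rule has_sum_SigmaD)
          fix k
          show "((\<lambda>i. case (k, i) of (k, i) \<Rightarrow> G (i, k)) has_sum lam' (fst k) (snd k) * a (fst k) (snd k) x) UNIV"
            unfolding term_eq
            by (rule has_sum_finite_neutralI[OF finI[of "fst k" "snd k"]])
               (auto simp: G_def theta_def I_def c_def mult.assoc)
        qed
        then show ?case by (simp add: case_prod_unfold)
      qed
      then have "Lp_sums p (\<lambda>r l x. lam' r l * a r l x) f"
        using nu_fin by (subst Lp_sums_atoms_iff[OF p q s(1) d _ atom f]) (simp_all add: lam'_eq)
      then have "atomic_rep s p q (smooth_atom K d) f lam' a"
        using nu_fin atom by (simp add: atomic_rep_def lam'_eq)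
      then show ?thesis
        using nu_le lam'_eq by auto
    qed
    then show ?thesis using sums_iff by blast
  qed
  show thesis
  proof (rule that[OF C(1)])
    show "refines s p q (molecule K d \<sigma> p D B) (smooth_atom K d :: nat \<Rightarrow> int ^ 'n \<Rightarrow> _ \<Rightarrow> bool) C"
      unfolding refines_def atomic_rep_def[of s p q "molecule K d \<sigma> p D B"] using main by blast
  qed (use main in blast)
qed

section \<open>Atoms as molecules\<close>

lemma AE_lebesgue_scale:
  fixes P :: "real ^ 'n \<Rightarrow> bool"
  assumes "AE x in lebesgue. P x" and c: "c \<noteq> 0"
  shows "AE x in lebesgue. P (c *\<^sub>R x)"
proof -
  have "negligible {x. \<not> P x}"
    using assms(1) by (simp add: eventually_ae_filter_negligible) (metis (mono_tags, lifting) mem_Collect_eq negligible_subset subsetI)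
  then have "negligible ((\<lambda>x. inverse c *\<^sub>R x) ` {x. \<not> P x})"
    by (intro negligible_differentiable_image_negligible) (auto intro!: derivative_intros)
  moreover have "{x. \<not> P (c *\<^sub>R x)} \<subseteq> (\<lambda>x. inverse c *\<^sub>R x) ` {x. \<not> P x}"
  proof
    fix x assume "x \<in> {x. \<not> P (c *\<^sub>R x)}"
    then show "x \<in> (\<lambda>x. inverse c *\<^sub>R x) ` {x. \<not> P x}"
      using c by (intro image_eqI[of _ _ "c *\<^sub>R x"]) auto
  qed
  ultimately have "negligible {x. \<not> P (c *\<^sub>R x)}" by (rule negligible_subset)
  then show ?thesis by (auto simp: eventually_ae_filter_negligible)
qed

lemma smooth_atom_zero: "smooth_atom K d j m (\<lambda>x. 0)"
  by (simp add: smooth_atom_iff_Ck_le Ck_le_const)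

lemma smooth_atom_dilate:
  fixes b :: "real ^ 'n \<Rightarrow> complex"
  assumes "smooth_atom K d k l b"
  shows "smooth_atom K d (j + k) l (\<lambda>x. b (2 ^ j *\<^sub>R x))"
  unfolding smooth_atom_iff_Ck_le
proof
  have "(2 ^ j :: real) *\<^sub>R (x /\<^sub>R 2 ^ (j + k)) = x /\<^sub>R 2 ^ k" for x :: "real ^ 'n"
    by (simp add: power_add divide_simps)
  then show "Ck_le K 1 (\<lambda>x. b (2 ^ j *\<^sub>R (x /\<^sub>R 2 ^ (j + k))))"
    using assms by (simp only: smooth_atom_iff_Ck_le)
  show "\<forall>x. b (2 ^ j *\<^sub>R x) \<noteq> 0 \<longrightarrow> x \<in> dcube d (j + k) l"
    using assms unfolding smooth_atom_iff_Ck_le mem_dcube_iff by (auto simp: power_add mult.commute)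
qed

text \<open>Dilation by \<open>2\<^sup>j\<close> shifts levels by \<open>j\<close>.\<close>

lemma moleculeI:
  fixes A :: "real ^ 'n \<Rightarrow> complex"
  assumes b: "\<And>k l. smooth_atom K d k l (b k l)"
    and near: "\<And>k l. eta k l \<noteq> 0 \<Longrightarrow> l \<in> near (D * 2 ^ k) (2 ^ k *\<^sub>R rvec m)"
    and bound: "\<And>k. ennreal (2 powr (real k * (\<sigma> - dim_exp TYPE('n) p))) * lqnorm p (\<lambda>l. ennreal (norm (eta k l))) \<le> ennreal B"
    and S: "AE x in lebesgue. ((\<lambda>(k, l). eta k l * b k l x) has_sum A x) UNIV"
  shows "molecule K d \<sigma> p D B j m (\<lambda>x. A (2 ^ j *\<^sub>R x))"
proof -
  define eta' where "eta' r l = (if j \<le> r then eta (r - j) l else 0)" for r l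
  define b' where "b' r l x = (if j \<le> r then b (r - j) l (2 ^ j *\<^sub>R x) else 0)" for r l x
  have "smooth_atom K d r l (b' r l)" for r l
  proof (cases "j \<le> r")
    case True
    then show ?thesis using smooth_atom_dilate[OF b[of "r - j" l], of j] by (simp add: b'_def[abs_def])
  qed (simp add: b'_def[abs_def] smooth_atom_zero)
  moreover have "eta' r l \<noteq> 0 \<longrightarrow> j \<le> r \<and> l \<in> near (D * 2 ^ (r - j)) (2 ^ (r - j) *\<^sub>R rvec m)" for r l
    using near by (auto simp: eta'_def)
  moreover have "ennreal (2 powr (real (r - j) * (\<sigma> - dim_exp TYPE('n) p))) * lqnorm p (\<lambda>l. ennreal (norm (eta' r l))) \<le> ennreal B" if "j \<le> r" for r
    using bound[of "r - j"] that by (simp add: eta'_def)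
  moreover have "AE x in lebesgue. ((\<lambda>(r, l). eta' r l * b' r l x) has_sum A (2 ^ j *\<^sub>R x)) UNIV"
  proof -
    have "AE x in lebesgue. ((\<lambda>(k, l). eta k l * b k l (2 ^ j *\<^sub>R x)) has_sum A (2 ^ j *\<^sub>R x)) UNIV"
      by (rule AE_lebesgue_scale[OF S]) simp
    then show ?thesis
    proof eventually_elim
      case (elim x)
      define h where "h = (\<lambda>(k, l :: int ^ 'n). (j + k, l))"
      define F where "F = (\<lambda>(r, l). eta' r l * b' r l x)"
      have "inj h" by (auto simp: h_def inj_on_def)
      have "F \<circ> h = (\<lambda>(k, l). eta k l * b k l (2 ^ j *\<^sub>R x))"
        by (auto simp: F_def h_def eta'_def b'_def fun_eq_iff)
      then have "(F has_sum A (2 ^ j *\<^sub>R x)) (range h)"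
        using elim \<open>inj h\<close> by (subst has_sum_reindex) auto
      moreover have "F z = 0" if "z \<notin> range h" for z
      proof (cases z)
        case (Pair r l)
        have "\<not> j \<le> r"
        proof
          assume "j \<le> r"
          then have "z = h (r - j, l)" using Pair by (simp add: h_def)
          then show False using that by blast
        qed
        then show ?thesis by (simp add: Pair F_def eta'_def)
      qed
      ultimately have "(F has_sum A (2 ^ j *\<^sub>R x)) UNIV"
        by (subst has_sum_cong_neutral[where T="range h" and g=F]) auto
      then show ?case by (simp add: F_def)
    qed
  qed
  ultimately show ?thesis unfolding molecule_def by blast
qed

text \<open>The number of lattice points involved is at most \<open>((2 D + 1) 2\<^sup>k)\<^sup>n\<close>.\<close>

lemma lqnorm_near:
  assumes p: "0 < p" and D: "0 \<le> D"
  obtains W :: real where "0 < W"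
    "\<And>k (y :: real ^ 'n). lqnorm p (\<lambda>l. indicator (near (D * 2 ^ k) y) l) \<le> ennreal (W * 2 powr (real k * dim_exp TYPE('n) p))"
proof (cases "p = \<infinity>")
  case True
  show thesis
  proof (rule that[of 1])
    fix k and y :: "real ^ 'n"
    have "dim_exp TYPE('n) p = 0" using True by (simp add: dim_exp_def)
    moreover have "Lqnorm \<infinity> (count_space UNIV) (\<lambda>l. indicator (near (D * 2 ^ k) y) l) \<le> 1"
      by (rule Lqnorm_topI) (auto simp: indicator_def AE_count_space)
    ultimately show "lqnorm p (\<lambda>l. indicator (near (D * 2 ^ k) y) l) \<le> ennreal (1 * 2 powr (real k * dim_exp TYPE('n) p))"
      using True by simp
  qed simp
next
  case False
  define r where "r = enn2real p"
  have r: "0 < r" "p = ennreal r" unfolding r_def using exponent_pos[OF p False] False by (auto simp: less_top)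
  have a: "dim_exp TYPE('n) p = CARD('n) / r"
    unfolding dim_exp_def r(2) using r(1) by (simp add: ennreal_of_nat_eq_real_of_nat divide_ennreal)
  define W where "W = (2 * D + 1) powr (CARD('n) / r)"
  show thesis
  proof (rule that[of W])
    fix k and y :: "real ^ 'n"
    let ?F = "near (D * 2 ^ k) y"
    have "(\<integral>\<^sup>+l. epowr (indicator ?F l) r \<partial>count_space UNIV) = (\<integral>\<^sup>+l. indicator ?F l \<partial>count_space UNIV)"
      by (intro nn_integral_cong) (auto simp: indicator_def epowr_def)
    also have "\<dots> = ennreal (card ?F)" by (simp add: ennreal_of_nat_eq_real_of_nat)
    also have "\<dots> \<le> epowr (ennreal (W * 2 powr (real k * dim_exp TYPE('n) p))) r"
    proof -
      have "real (card ?F) \<le> (2 * (D * 2 ^ k) + 1) ^ CARD('n)" using D by (intro card_near) simp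
      also have "\<dots> \<le> ((2 * D + 1) * 2 ^ k) ^ CARD('n)"
        using D by (intro power_mono) (auto simp: distrib_right)
      also have "\<dots> = ((2 * D + 1) * 2 powr real k) powr CARD('n)"
        using D by (simp add: powr_realpow)
      also have "\<dots> = (2 * D + 1) powr CARD('n) * 2 powr (real k * CARD('n))"
        using D by (simp add: powr_mult powr_powr)
      also have "\<dots> = W powr r * (2 powr (real k * (CARD('n) / r))) powr r"
        unfolding W_def powr_powr using r(1) by simp
      also have "\<dots> = (W * 2 powr (real k * dim_exp TYPE('n) p)) powr r"
        unfolding a by (rule powr_mult[symmetric])
      finally show ?thesis by (simp add: epowr_ennreal W_def ennreal_leI)
    qed
    finally show "lqnorm p (\<lambda>l. indicator (near (D * 2 ^ k) y) l) \<le> ennreal (W * 2 powr (real k * dim_exp TYPE('n) p))"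
      unfolding r_def by (intro Lqnorm_leI[OF p False])
  qed (use D in \<open>simp add: W_def\<close>)
qed

text \<open>The \<open>O(2\<^bsup>kn\<^esup>)\<close> atoms of relative level \<open>k\<close> have coefficients \<open>O(2\<^bsup>-kM\<^esup>)\<close>; the \<open>\<ell>\<^sub>p\<close> norm of these
coefficients is therefore \<open>O(2\<^bsup>-k(M-n/p)\<^esup>)\<close>.\<close>

lemma smooth_atom_molecule:
  assumes p: "0 < p" and M: "1 \<le> M" and d: "0 \<le> d"
  obtains B D :: real where "0 \<le> B" "0 \<le> D"
    "\<And>j m (u :: real ^ 'n \<Rightarrow> complex). smooth_atom M d j m u \<Longrightarrow> molecule K 1 (real M) p D B j m u"
proof -
  obtain C D :: real where C: "0 < C" and D: "0 \<le> D"
    and dec: "\<And>m A. Ck_le M 1 A \<Longrightarrow> (\<And>x. A x \<noteq> 0 \<Longrightarrow> m \<in> near d x) \<Longrightarrow>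
       \<exists>eta b. (\<forall>k l. smooth_atom K 1 k l (b k l :: real ^ 'n \<Rightarrow> complex)) \<and>
         (\<forall>k l. eta k l \<noteq> 0 \<longrightarrow> l \<in> near (D * 2 ^ k) (2 ^ k *\<^sub>R rvec m)) \<and>
         (\<forall>k l. norm (eta k l) \<le> C * (1 / 2) ^ (k * M)) \<and>
         (\<forall>x. ((\<lambda>(k, l). eta k l * b k l x) has_sum A x) UNIV)"
    by (rule smooth_atom_decomposition[OF M d, where K=K and 'n='n]) blast
  obtain W :: real where W: "0 < W"
    "\<And>k (y :: real ^ 'n). lqnorm p (\<lambda>l. indicator (near (D * 2 ^ k) y) l) \<le> ennreal (W * 2 powr (real k * dim_exp TYPE('n) p))"
    using lqnorm_near[OF p D] by metis
  show thesis
  proof (rule that[of "C * W" D])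
    fix j m and u :: "real ^ 'n \<Rightarrow> complex"
    assume u: "smooth_atom M d j m u"
    define A where "A x = u (x /\<^sub>R 2 ^ j)" for x
    have cA: "Ck_le M 1 A" using u by (simp add: smooth_atom_iff_Ck_le A_def[abs_def])
    have sA: "m \<in> near d x" if "A x \<noteq> 0" for x
    proof -
      have "x /\<^sub>R 2 ^ j \<in> dcube d j m"
        using u that unfolding smooth_atom_iff_Ck_le A_def by blast
      then show ?thesis by (simp add: mem_dcube_iff)
    qed
    obtain eta b where b: "\<And>k l. smooth_atom K 1 k l (b k l)"
      and near: "\<And>k l. eta k l \<noteq> 0 \<Longrightarrow> l \<in> near (D * 2 ^ k) (2 ^ k *\<^sub>R rvec m)"
      and le: "\<And>k l. norm (eta k l) \<le> C * (1 / 2) ^ (k * M)"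
      and S: "\<And>x. ((\<lambda>(k, l). eta k l * b k l x) has_sum A x) UNIV"
      using dec[OF cA sA] by blast
    have "molecule K 1 (real M) p D (C * W) j m (\<lambda>x. A (2 ^ j *\<^sub>R x))"
    proof (rule moleculeI[OF b near])
      fix k
      let ?a = "dim_exp TYPE('n) p"
      have pw: "C * (1 / 2) ^ (k * M) = C * 2 powr (- (real k * real M))"
      proof -
        have "2 powr (- (real k * real M)) = 1 / 2 powr real (k * M)" by (simp add: powr_minus_divide)
        also have "\<dots> = 1 / 2 ^ (k * M)" by (subst powr_realpow) auto
        finally show ?thesis by (simp add: power_one_over)
      qed
      have "lqnorm p (\<lambda>l. ennreal (norm (eta k l)))
          \<le> lqnorm p (\<lambda>l. ennreal (C * 2 powr (- (real k * real M))) * indicator (near (D * 2 ^ k) (2 ^ k *\<^sub>R rvec m)) l)"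
        using near[of k] le[of k] by (intro lqnorm_mono[OF p]) (auto simp: indicator_def pw[symmetric] intro!: ennreal_leI)
      also have "\<dots> \<le> ennreal (C * 2 powr (- (real k * real M))) * lqnorm p (\<lambda>l. indicator (near (D * 2 ^ k) (2 ^ k *\<^sub>R rvec m)) l)"
        by (rule Lqnorm_cmult_le[OF p]) simp
      also have "\<dots> \<le> ennreal (C * 2 powr (- (real k * real M))) * ennreal (W * 2 powr (real k * ?a))"
        by (intro mult_left_mono W) simp
      finally have "ennreal (2 powr (real k * (real M - ?a))) * lqnorm p (\<lambda>l. ennreal (norm (eta k l)))
          \<le> ennreal (2 powr (real k * (real M - ?a))) * (ennreal (C * 2 powr (- (real k * real M))) * ennreal (W * 2 powr (real k * ?a)))"
        by (rule mult_left_mono) simp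
      also have "\<dots> = ennreal (C * W * (2 powr (real k * (real M - ?a)) * (2 powr (- (real k * real M)) * 2 powr (real k * ?a))))"
        using C W by (simp add: ennreal_mult[symmetric] mult_ac)
      also have "2 powr (real k * (real M - ?a)) * (2 powr (- (real k * real M)) * 2 powr (real k * ?a)) = 1"
        by (simp add: powr_add[symmetric] algebra_simps)
      finally show "ennreal (2 powr (real k * (real M - ?a))) * lqnorm p (\<lambda>l. ennreal (norm (eta k l))) \<le> ennreal (C * W)" by simp
    qed (use S in auto)
    then show "molecule K 1 (real M) p D (C * W) j m u" by (simp add: A_def)
  qed (use C W D in auto)
qed

text \<open>The complement of the support is a possibly uncountable union of open sets; by Lindelof countably
many of them suffice.\<close>

lemma AE_zero_outside_ess_supp:
  fixes a :: "real ^ 'n \<Rightarrow> complex"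
  shows "AE x in lebesgue. x \<notin> ess_supp a \<longrightarrow> a x = 0"
proof -
  define U where "U = {U. open U \<and> (AE x in lebesgue. x \<in> U \<longrightarrow> a x = 0)}"
  obtain V where V: "V \<subseteq> U" "countable V" "\<Union>V = \<Union>U"
    by (rule Lindelof[of U]) (auto simp: U_def)
  have "AE x in lebesgue. \<forall>S\<in>V. x \<in> S \<longrightarrow> a x = 0"
    using V by (subst AE_ball_countable) (auto simp: U_def)
  then show ?thesis
  proof eventually_elim
    case (elim x)
    then show ?case using V(3) unfolding ess_supp_def U_def[symmetric] by auto
  qed
qed

lemma besov_qnorm_lessD:
  assumes "besov_qnorm K d s p q f < c"
  obtains lam a where "atomic_rep s p q (smooth_atom K d) f lam a" "b_qnorm s p q lam < c"
proof -
  have "\<exists>y\<in>{b_qnorm s p q lam | lam. \<exists>a. atomic_rep s p q (smooth_atom K d) f lam a}. y < c"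
    using assms unfolding besov_qnorm_def atomic_qnorm_def by (simp only: Inf_less_iff)
  then show thesis using that by blast
qed

text \<open>A representation of the dilated atom may involve cubes anywhere. The cutoff function equals \<open>1\<close> on
the support of the atom, so multiplying the representation by it keeps the sum; the products are
atoms up to a constant and vanish for distant cubes.\<close>

lemma nonsmooth_atom_molecule:
  assumes p: "0 < p" and \<sigma>: "0 < \<sigma>" and d: "0 \<le> d" and d': "0 \<le> d'"
  obtains B D :: real where "0 \<le> B" "0 \<le> D"
    "\<And>j m (u :: real ^ 'n \<Rightarrow> complex). nonsmooth_atom K d' \<sigma> p d j m u \<Longrightarrow> molecule K d' \<sigma> p D B j m u"
proof -
  define C where "C = 2 ^ K * ((2 * (d + 1) + 1) ^ CARD('n) * unity_part_const K TYPE('n)) * 1"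
  have C: "0 < C" unfolding C_def using d unity_part_const_pos[of K, where 'n='n] by simp
  define D where "D = d + 2 + d'"
  show thesis
  proof (rule that[of "2 * C" D])
    fix j m and u :: "real ^ 'n \<Rightarrow> complex"
    assume u: "nonsmooth_atom K d' \<sigma> p d j m u"
    define A where "A x = u (x /\<^sub>R 2 ^ j)" for x
    have um: "u \<in> borel_measurable lebesgue" using u by (simp add: nonsmooth_atom_def besov_space_def Lp_space_def)
    have Am: "A \<in> borel_measurable lebesgue"
      using measurable_compose[OF lebesgue_measurable_scaling[of "inverse (2 ^ j)"] um] by (simp add: A_def[abs_def])
    \<comment> \<open>The infimum need not be attained, so the bound \<open>1\<close> is relaxed to \<open>2\<close>.\<close>
    have "besov_qnorm K d' \<sigma> p p A < 2"
      using u by (auto simp: nonsmooth_atom_def A_def[abs_def] intro: le_less_trans)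
    then obtain lam b where rep: "atomic_rep \<sigma> p p (smooth_atom K d') A lam b" and lam2: "b_qnorm \<sigma> p p lam < 2"
      by (rule besov_qnorm_lessD)
    have b: "\<And>k l. smooth_atom K d' k l (b k l)" using rep by (simp add: atomic_rep_def)
    have S: "AE x in lebesgue. ((\<lambda>(k, l). lam k l * b k l x) has_sum A x) UNIV"
      using rep by (subst Lp_sums_atoms_iff[OF p p \<sigma> d' _ b Am, symmetric]) (auto simp: atomic_rep_def)
    have A0: "AE x in lebesgue. m \<in> near d x \<or> A x = 0"
    proof -
      have "AE x in lebesgue. x \<in> dcube d j m \<or> u x = 0"
        using AE_zero_outside_ess_supp[of u]
      proof eventually_elim
        case (elim x) then show ?case using u by (auto simp: nonsmooth_atom_def)
      qed
      from AE_lebesgue_scale[OF this, of "inverse (2 ^ j)"] show ?thesis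
        by (simp add: mem_dcube_iff A_def)
    qed
    define eta where "eta k l = (if l \<in> near (D * 2 ^ k) (2 ^ k *\<^sub>R rvec m) then of_real C * lam k l else 0)" for k l
    define b' where "b' k l x = of_real (1 / C) * (cutoff K d m x * b k l x)" for k l x
    \<comment> \<open>Both the cutoff function and the atom are nonzero at \<open>x\<close>, which forces \<open>2\<^sup>k m\<close> and \<open>l\<close> together.\<close>
    have near_l: "l \<in> near (D * 2 ^ k) (2 ^ k *\<^sub>R rvec m)" if "b' k l x \<noteq> 0" for k l x
    proof -
      have m: "m \<in> near (d + 2) x" using that cutoff_support by (auto simp: b'_def)
      have "x \<in> dcube d' k l" using that b[of k l] by (auto simp: b'_def smooth_atom_iff_Ck_le)
      then have l: "l \<in> near d' (2 ^ k *\<^sub>R x)" by (simp add: mem_dcube_iff)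
      have "\<bar>2 ^ k * of_int (m $ i) - of_int (l $ i)\<bar> \<le> D * 2 ^ k" for i
      proof -
        have "\<bar>2 ^ k * x $ i - of_int (l $ i)\<bar> \<le> d'" using l by (simp add: near_def)
        moreover have "2 ^ k * \<bar>x $ i - of_int (m $ i)\<bar> \<le> 2 ^ k * (d + 2)"
          using m by (intro mult_left_mono) (auto simp: near_def)
        then have "\<bar>2 ^ k * x $ i - 2 ^ k * of_int (m $ i)\<bar> \<le> 2 ^ k * (d + 2)"
          by (simp add: abs_mult_pos' right_diff_distrib)
        moreover have "d' * 1 \<le> d' * 2 ^ k" using d' by (intro mult_left_mono) auto
        then have "2 ^ k * (d + 2) + d' \<le> D * 2 ^ k" by (simp add: D_def algebra_simps)
        ultimately show ?thesis by linarith
      qed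
      then show ?thesis by (simp add: near_def)
    qed
    have "molecule K d' \<sigma> p D (2 * C) j m (\<lambda>x. A (2 ^ j *\<^sub>R x))"
    proof (rule moleculeI)
      fix k l
      show "smooth_atom K d' k l (b' k l)"
        unfolding smooth_atom_iff_Ck_le
      proof
        have "Ck_le K ((2 * (d + 1) + 1) ^ CARD('n) * unity_part_const K TYPE('n)) (\<lambda>x. cutoff K d m (inverse (2 ^ k) *\<^sub>R x))"
          by (intro Ck_le_dilate Ck_le_cutoff d) (simp add: inverse_le_1_iff)
        moreover have "Ck_le K 1 (\<lambda>x. b k l (inverse (2 ^ k) *\<^sub>R x))" using b[of k l] by (simp add: smooth_atom_iff_Ck_le)
        ultimately have "Ck_le K C (\<lambda>x. cutoff K d m (inverse (2 ^ k) *\<^sub>R x) * b k l (inverse (2 ^ k) *\<^sub>R x))"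
          unfolding C_def by (rule Ck_le_mult)
        from Ck_le_cmult[OF this, of "of_real (1 / C)"] show "Ck_le K 1 (\<lambda>x. b' k l (inverse (2 ^ k) *\<^sub>R x))"
          using C by (simp add: b'_def norm_divide)
        show "\<forall>x. b' k l x \<noteq> 0 \<longrightarrow> x \<in> dcube d' k l"
          using b[of k l] by (auto simp: b'_def smooth_atom_iff_Ck_le)
      qed
    next
      fix k l assume "eta k l \<noteq> 0"
      then show "l \<in> near (D * 2 ^ k) (2 ^ k *\<^sub>R rvec m)" by (auto simp: eta_def split: if_splits)
    next
      fix k
      let ?w = "ennreal (2 powr (real k * (\<sigma> - dim_exp TYPE('n) p)))"
      have "lqnorm p (\<lambda>l. ennreal (norm (eta k l))) \<le> lqnorm p (\<lambda>l. ennreal C * ennreal (norm (lam k l)))"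
        using C by (intro lqnorm_mono[OF p]) (auto simp: eta_def norm_mult ennreal_mult)
      also have "\<dots> \<le> ennreal C * lqnorm p (\<lambda>l. ennreal (norm (lam k l)))"
        by (rule Lqnorm_cmult_le[OF p]) simp
      finally have "?w * lqnorm p (\<lambda>l. ennreal (norm (eta k l))) \<le> ?w * (ennreal C * lqnorm p (\<lambda>l. ennreal (norm (lam k l))))"
        by (rule mult_left_mono) simp
      also have "\<dots> = ennreal C * (?w * lqnorm p (\<lambda>l. ennreal (norm (lam k l))))" by (simp add: mult.left_commute)
      also have "\<dots> \<le> ennreal C * b_qnorm \<sigma> p p lam"
        unfolding b_qnorm_eq by (intro mult_left_mono level_le_b_enorm[OF p, of k \<sigma> p "\<lambda>j m. ennreal (norm (lam j m))"]) simp
      also have "\<dots> \<le> ennreal C * 2" using lam2 by (intro mult_left_mono) auto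
      also have "\<dots> = ennreal (2 * C)" using C by (simp add: ennreal_mult mult.commute)
      finally show "?w * lqnorm p (\<lambda>l. ennreal (norm (eta k l))) \<le> ennreal (2 * C)" .
    next
      show "AE x in lebesgue. ((\<lambda>(k, l). eta k l * b' k l x) has_sum A x) UNIV"
        using S A0
      proof eventually_elim
        case (elim x)
        have e1: "cutoff K d m x * A x = A x" using elim(2) cutoff_eq_1[of m d x K] by auto
        have e2: "eta k l * b' k l x = cutoff K d m x * (lam k l * b k l x)" for k l
        proof (cases "b' k l x = 0")
          case True
          then show ?thesis using C by (auto simp: b'_def)
        next
          case False
          then show ?thesis using near_l[OF False] C by (simp add: eta_def b'_def)
        qed
        show ?case
          using has_sum_cmult_right[OF elim(1), of "cutoff K d m x"] by (simp only: case_prod_unfold e1 e2)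
      qed
    qed
    then show "molecule K d' \<sigma> p D (2 * C) j m u" by (simp add: A_def)
  qed (use C d d' in \<open>auto simp: D_def\<close>)
qed

section \<open>Comparison of atomic quasi-norms\<close>

lemma smooth_atom_mono: "smooth_atom K d j m a \<Longrightarrow> d \<le> d' \<Longrightarrow> smooth_atom K d' j m a"
  unfolding smooth_atom_iff_Ck_le mem_dcube_iff near_def by (auto intro: order_trans)

lemma lqnorm_single:
  fixes c :: ennreal
  assumes p: "0 < p"
  shows "lqnorm p (\<lambda>i :: 'i::countable. if i = i0 then c else 0) = c"
proof (rule antisym)
  show "c \<le> lqnorm p (\<lambda>i. if i = i0 then c else 0)"
    using lqnorm_ge_term[OF p, of "\<lambda>i. if i = i0 then c else 0" i0] by simp
  show "lqnorm p (\<lambda>i. if i = i0 then c else 0) \<le> c"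
  proof (cases "p = \<infinity>")
    case True
    have "Lqnorm \<infinity> (count_space UNIV) (\<lambda>i. if i = i0 then c else 0) \<le> c"
      by (rule Lqnorm_topI) (auto simp: AE_count_space)
    then show ?thesis using True by simp
  next
    case False
    have "(\<Sum>\<^sub>\<infinity>i. epowr (if i = i0 then c else 0) (enn2real p)) = epowr c (enn2real p)"
      by (rule infsumI, rule has_sum_finite_neutralI[of "{i0}"]) auto
    then show ?thesis
      by (intro Lqnorm_leI[OF p False]) (simp add: nn_integral_count_space_infsum)
  qed
qed

lemma b_qnorm_single:
  fixes m :: "int ^ 'n"
  assumes p: "0 < p" and q: "0 < q"
  shows "b_qnorm s p q (\<lambda>j' m'. if j' = j \<and> m' = m then 1 else 0) = ennreal (2 powr (real j * (s - dim_exp TYPE('n) p)))"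
proof -
  have "lqnorm p (\<lambda>m'. ennreal (norm (if j' = j \<and> m' = m then 1 else 0 :: complex))) = (if j' = j then 1 else 0)" for j'
  proof (cases "j' = j")
    case True
    have "(\<lambda>m'. ennreal (norm (if j' = j \<and> m' = m then 1 else 0 :: complex))) = (\<lambda>m'. if m' = m then 1 else 0)"
      using True by auto
    then show ?thesis using True lqnorm_single[OF p, of m 1] by simp
  next
    case False then show ?thesis using Lqnorm_zero[OF p] by simp
  qed
  then have "b_qnorm s p q (\<lambda>j' m'. if j' = j \<and> m' = m then 1 else 0)
      = lqnorm q (\<lambda>j'. ennreal (2 powr (real j' * (s - dim_exp TYPE('n) p))) * (if j' = j then 1 else 0))"
    unfolding b_qnorm_eq b_enorm_def by simp
  also have "\<dots> = lqnorm q (\<lambda>j'. if j' = j then ennreal (2 powr (real j * (s - dim_exp TYPE('n) p))) else 0)"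
    by (rule arg_cong[where f="lqnorm q"]) auto
  also have "\<dots> = ennreal (2 powr (real j * (s - dim_exp TYPE('n) p)))" by (rule lqnorm_single[OF q])
  finally show ?thesis .
qed

text \<open>An atom represents itself, with a single nonzero coefficient.\<close>

lemma single_atom_rep:
  assumes p: "0 < p" and q: "0 < q" and s: "0 < s" and d: "0 \<le> d" and a: "smooth_atom K d j m (a :: real ^ 'n \<Rightarrow> complex)"
  obtains b where "atomic_rep s p q (smooth_atom K d) a (\<lambda>j' m'. if j' = j \<and> m' = m then 1 else 0) b"
proof -
  define lam :: "nat \<Rightarrow> int ^ 'n \<Rightarrow> complex" where "lam j' m' = (if j' = j \<and> m' = m then 1 else 0)" for j' m'
  define b where "b j' m' = (if j' = j \<and> m' = m then a else (\<lambda>x. 0))" for j' m'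
  have fin: "b_qnorm s p q lam < \<infinity>"
    unfolding lam_def[abs_def] b_qnorm_single[OF p q] by simp
  have b: "smooth_atom K d j' m' (b j' m')" for j' m'
    using a by (auto simp: b_def smooth_atom_zero)
  have "((\<lambda>(j', m'). lam j' m' * b j' m' x) has_sum a x) UNIV" for x
    by (rule has_sum_finite_neutralI[of "{(j, m)}"]) (auto simp: lam_def b_def split: if_splits)
  then have "Lp_sums p (\<lambda>j m x. lam j m * b j m x) a"
    by (subst Lp_sums_atoms_iff[OF p q s d fin b smooth_atom_measurable[OF a]]) auto
  then have "atomic_rep s p q (smooth_atom K d) a lam b"
    using fin b by (simp add: atomic_rep_def)
  then show thesis using that unfolding lam_def[abs_def] by blast
qed

lemma smooth_atom_Lp:
  assumes p: "0 < p" and d: "0 \<le> d" and a: "smooth_atom K d j m (a :: real ^ 'n \<Rightarrow> complex)"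
  shows "a \<in> Lp_space p"
proof -
  obtain W :: real where W: "0 < W"
    "\<And>j (m :: int ^ 'n). Lqnorm p lebesgue (indicator (dcube d j m)) \<le> ennreal (W * 2 powr (- (real j * dim_exp TYPE('n) p)))"
    using Lqnorm_dcube[OF p d] by metis
  note [measurable] = smooth_atom_measurable[OF a]
  have "Lp_qnorm p a \<le> Lqnorm p lebesgue (indicator (dcube d j m))"
    unfolding Lp_qnorm_eq by (rule Lqnorm_mono[OF p _ smooth_atom_le_indicator[OF a]]) measurable
  also have "\<dots> \<le> ennreal (W * 2 powr (- (real j * dim_exp TYPE('n) p)))" by (rule W)
  also have "\<dots> < \<infinity>" by simp
  finally show ?thesis by (simp add: Lp_space_def smooth_atom_measurable[OF a])
qed

lemma besov_qnorm_le: "atomic_rep s p q (smooth_atom K d) f lam a \<Longrightarrow> besov_qnorm K d s p q f \<le> b_qnorm s p q lam"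
  unfolding besov_qnorm_def atomic_qnorm_def by (rule Inf_lower) blast

text \<open>Dilated to level \<open>0\<close> the atom is its own representation, and the norm of the single coefficient \<open>1\<close>
at level \<open>0\<close> is \<open>1\<close>.\<close>

lemma smooth_atom_imp_nonsmooth_atom:
  fixes a :: "real ^ 'n \<Rightarrow> complex"
  assumes p: "0 < p" and \<sigma>: "0 < \<sigma>" and d: "1 \<le> d" and d': "1 \<le> d'" and a: "smooth_atom K 1 j m a"
  shows "nonsmooth_atom K d' \<sigma> p d j m a"
proof -
  have d'0: "0 \<le> d'" using d' by simp
  have a': "smooth_atom K d' j m a" by (rule smooth_atom_mono[OF a d'])
  obtain b where "atomic_rep \<sigma> p p (smooth_atom K d') a (\<lambda>j' m'. if j' = j \<and> m' = m then 1 else 0) b"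
    using single_atom_rep[OF p p \<sigma> d'0 a'] by blast
  then have "a \<in> besov_space K d' \<sigma> p p"
    using smooth_atom_Lp[OF p d'0 a'] by (auto simp: besov_space_def)
  moreover have "ess_supp a \<subseteq> dcube d j m"
  proof
    fix x assume x: "x \<in> ess_supp a"
    have "open (- dcube d j m)" unfolding dcube_eq_cbox by (intro open_Compl closed_cbox)
    moreover have "a y = 0" if "y \<notin> dcube d j m" for y
      using smooth_atom_mono[OF a d] that by (auto simp: smooth_atom_iff_Ck_le)
    ultimately have "- dcube d j m \<in> {U. open U \<and> (AE x in lebesgue. x \<in> U \<longrightarrow> a x = 0)}" by auto
    then show "x \<in> dcube d j m" using x unfolding ess_supp_def by blast
  qed
  moreover have "besov_qnorm K d' \<sigma> p p (\<lambda>x. a (x /\<^sub>R 2 ^ j)) \<le> 1"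
  proof -
    have "smooth_atom K d' 0 m (\<lambda>x. a (x /\<^sub>R 2 ^ j))"
      using a' by (auto simp: smooth_atom_iff_Ck_le mem_dcube_iff)
    then obtain b where "atomic_rep \<sigma> p p (smooth_atom K d') (\<lambda>x. a (x /\<^sub>R 2 ^ j)) (\<lambda>j' m'. if j' = 0 \<and> m' = m then 1 else 0) b"
      using single_atom_rep[OF p p \<sigma> d'0] by blast
    from besov_qnorm_le[OF this] show ?thesis by (simp add: b_qnorm_single[OF p p])
  qed
  ultimately show ?thesis by (simp add: nonsmooth_atom_def)
qed

lemma le_cmult_Inf:
  assumes "0 < C" "\<And>x. x \<in> S \<Longrightarrow> y \<le> ennreal C * x"
  shows "y \<le> ennreal C * Inf S"
proof -
  have c: "ennreal (1 / C) * (ennreal C * x) = x" "ennreal C * (ennreal (1 / C) * x) = x" for x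
    using assms(1) by (simp_all add: mult.assoc[symmetric] ennreal_mult[symmetric])
  have "ennreal (1 / C) * y \<le> Inf S"
  proof (rule Inf_greatest)
    fix x assume "x \<in> S"
    then have "ennreal (1 / C) * y \<le> ennreal (1 / C) * (ennreal C * x)"
      by (intro mult_left_mono assms(2)) auto
    then show "ennreal (1 / C) * y \<le> x" unfolding c(1) .
  qed
  then have "ennreal C * (ennreal (1 / C) * y) \<le> ennreal C * Inf S" by (rule mult_left_mono) simp
  then show ?thesis unfolding c(2) .
qed

lemma refines_atomic_qnorm_le:
  assumes C: "0 < C" and R: "refines s p q P Q C" and f: "f \<in> borel_measurable lebesgue"
  shows "atomic_qnorm s p q Q f \<le> ennreal C * atomic_qnorm s p q P f"
  unfolding atomic_qnorm_def
proof (rule le_cmult_Inf[OF C])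
  fix x assume "x \<in> {b_qnorm s p q lam |lam. \<exists>a. atomic_rep s p q P f lam a}"
  then obtain lam a where la: "x = b_qnorm s p q lam" "atomic_rep s p q P f lam a" by blast
  then obtain lam' a' where "atomic_rep s p q Q f lam' a'" "b_qnorm s p q lam' \<le> ennreal C * x"
    using R f unfolding refines_def by blast
  then show "Inf {b_qnorm s p q lam |lam. \<exists>a. atomic_rep s p q Q f lam a} \<le> ennreal C * x"
    by (intro Inf_lower2) auto
qed

lemma b_qnorm_cmult:
  assumes "0 < p" "0 < q" "c \<noteq> 0"
  shows "b_qnorm s p q (\<lambda>j m. c * lam j m) = ennreal (norm c) * b_qnorm s p q lam"
  unfolding b_qnorm_eq using b_enorm_cmult[of p q "norm c" s "\<lambda>j m. ennreal (norm (lam j m))"] assms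
  by (simp add: norm_mult ennreal_mult)

lemma smooth_rep_zero:
  assumes p: "0 < p" and q: "0 < q" and s: "0 < s" and d: "0 \<le> d"
    and f: "f \<in> borel_measurable lebesgue" "AE x in lebesgue. f x = 0"
  shows "besov_qnorm K d s p q (f :: real ^ 'n \<Rightarrow> complex) = 0"
proof -
  define lam :: "nat \<Rightarrow> int ^ 'n \<Rightarrow> complex" where "lam j m = 0" for j m
  have b0: "b_qnorm s p q lam = 0"
    unfolding b_qnorm_eq b_enorm_def lam_def by (simp add: Lqnorm_zero p q)
  have "AE x in lebesgue. ((\<lambda>(j, m). lam j m * 0) has_sum f x) UNIV"
    using f(2) by eventually_elim (simp add: lam_def case_prod_unfold)
  then have "Lp_sums p (\<lambda>j m x. lam j m * (\<lambda>_. 0) x) f"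
    using Lp_sums_atoms_iff[OF p q s d _ smooth_atom_zero f(1), of lam] b0 by simp
  then have "atomic_rep s p q (smooth_atom K d) f lam (\<lambda>j m x. 0)"
    using b0 by (simp add: atomic_rep_def smooth_atom_zero)
  from besov_qnorm_le[OF this] show ?thesis by (simp add: b0)
qed

text \<open>The \<open>L\<^sub>p\<close> quasi-norm is bounded by the Besov quasi-norm, since each representation is dominated by
its majorant.\<close>

lemma besov_qnorm_zeroD:
  fixes f :: "real ^ 'n \<Rightarrow> complex"
  assumes p: "0 < p" and q: "0 < q" and s: "0 < s" and d: "0 \<le> d"
    and f: "f \<in> borel_measurable lebesgue" and 0: "besov_qnorm K d s p q f = 0"
  shows "AE x in lebesgue. f x = 0"
proof -
  obtain C where C: "0 < C"
    "\<And>(nu :: nat \<Rightarrow> int ^ 'n \<Rightarrow> ennreal) J.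
       Lqnorm p lebesgue (majorant d nu J) \<le> ennreal (C * 2 powr (- (s / 2 * real J))) * b_enorm s p q nu"
    using majorant_bound[OF p q s d] by metis
  have "Lqnorm p lebesgue (\<lambda>x. ennreal (norm (f x))) \<le> ennreal C * besov_qnorm K d s p q f"
    unfolding besov_qnorm_def atomic_qnorm_def
  proof (rule le_cmult_Inf[OF C(1)])
    fix x assume "x \<in> {b_qnorm s p q lam |lam. \<exists>a. atomic_rep s p q (smooth_atom K d) f lam a}"
    then obtain lam a where x: "x = b_qnorm s p q lam" and rep: "atomic_rep s p q (smooth_atom K d) f lam a" by blast
    have a: "\<And>j m. smooth_atom K d j m (a j m)" using rep by (simp add: atomic_rep_def)
    have "AE x in lebesgue. ((\<lambda>(j, m). lam j m * a j m x) has_sum f x) UNIV"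
      using rep by (subst Lp_sums_atoms_iff[OF p q s d _ a f, symmetric]) (auto simp: atomic_rep_def)
    then have "AE x in lebesgue. ennreal (norm (f x)) \<le> majorant d (\<lambda>j m. ennreal (norm (lam j m))) 0 x"
      by eventually_elim (rule atom_sum_norm_le_majorant[OF a])
    then have "Lqnorm p lebesgue (\<lambda>x. ennreal (norm (f x))) \<le> Lqnorm p lebesgue (majorant d (\<lambda>j m. ennreal (norm (lam j m))) 0)"
      using f by (intro Lqnorm_mono_AE[OF p]) auto
    also have "\<dots> \<le> ennreal C * x"
      using C(2)[of "\<lambda>j m. ennreal (norm (lam j m))" 0] by (simp add: x b_qnorm_eq)
    finally show "Lqnorm p lebesgue (\<lambda>x. ennreal (norm (f x))) \<le> ennreal C * x" .
  qed
  then have "Lqnorm p lebesgue (\<lambda>x. ennreal (norm (f x))) = 0" using 0 by simp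
  then have "AE x in lebesgue. ennreal (norm (f x)) = 0"
    using f by (intro Lqnorm_eq_0_AE[OF p]) auto
  then show ?thesis by (simp add: ennreal_eq_0_iff)
qed

text \<open>For \<open>f = \<Sum> \<lambda> a\<close> and \<open>g = \<Sum> \<mu> b\<close> the function \<open>(\<lambda> a + \<mu> b) / (|\<lambda>| + |\<mu>|)\<close> is again a smooth atom, so \<open>f + g\<close>
has a representation with coefficients \<open>|\<lambda>| + |\<mu>|\<close>. For non-smooth atoms the same quotient would
be an atom only up to a constant.\<close>

lemma besov_qnorm_triangle:
  assumes p: "0 < p" and q: "0 < q" and s: "0 < s" and d: "0 \<le> d"
  obtains C :: real where "0 < C"
    "\<And>f g :: real ^ 'n \<Rightarrow> complex. f \<in> borel_measurable lebesgue \<Longrightarrow> g \<in> borel_measurable lebesgue \<Longrightarrow>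
       besov_qnorm K d s p q (\<lambda>x. f x + g x) \<le> ennreal C * (besov_qnorm K d s p q f + besov_qnorm K d s p q g)"
proof -
  obtain C :: real where C: "0 < C"
    "\<And>nu mu :: nat \<Rightarrow> int ^ 'n \<Rightarrow> ennreal. b_enorm s p q (\<lambda>j m. nu j m + mu j m) \<le> ennreal C * (b_enorm s p q nu + b_enorm s p q mu)"
    using b_enorm_add[OF p q] by metis
  show thesis
  proof (rule that[OF C(1)])
    fix f g :: "real ^ 'n \<Rightarrow> complex"
    assume f: "f \<in> borel_measurable lebesgue" and g: "g \<in> borel_measurable lebesgue"
    have rep_add: "besov_qnorm K d s p q (\<lambda>x. f x + g x) \<le> ennreal C * (b_qnorm s p q lam + b_qnorm s p q mu)"
      if F: "atomic_rep s p q (smooth_atom K d) f lam a" and G: "atomic_rep s p q (smooth_atom K d) g mu b" for lam a mu b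
    proof -
      have at: "\<And>j m. smooth_atom K d j m (a j m)" "\<And>j m. smooth_atom K d j m (b j m)"
        and fin: "b_qnorm s p q lam < \<infinity>" "b_qnorm s p q mu < \<infinity>"
        using F G by (auto simp: atomic_rep_def)
      define nr where "nr j m = norm (lam j m) + norm (mu j m)" for j m
      define c where "c j m x = (\<Sum>i\<in>UNIV. (if i then lam j m else mu j m) * (if i then a j m else b j m) x) / of_real (nr j m)" for j m x
      have cat: "smooth_atom K d j m (c j m)" for j m
        unfolding c_def by (rule smooth_atom_convex_combination) (auto simp: at UNIV_bool nr_def add.commute)
      have nu_le: "b_qnorm s p q (\<lambda>j m. of_real (nr j m)) \<le> ennreal C * (b_qnorm s p q lam + b_qnorm s p q mu)"
      proof -
        have "ennreal (norm (complex_of_real (nr j m))) = ennreal (norm (lam j m)) + ennreal (norm (mu j m))" for j m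
          unfolding norm_of_real by (simp add: nr_def)
        then show ?thesis unfolding b_qnorm_eq using C(2) by simp
      qed
      then have nu_fin: "b_qnorm s p q (\<lambda>j m. of_real (nr j m)) < \<infinity>"
        by (rule le_less_trans) (use fin in \<open>simp add: ennreal_mult_less_top\<close>)
      have eq: "of_real (nr j m) * c j m x = lam j m * a j m x + mu j m * b j m x" for j m x
      proof (cases "nr j m = 0")
        case True
        then have "lam j m = 0" "mu j m = 0" unfolding nr_def by (smt (verit) norm_ge_zero norm_eq_zero)+
        then show ?thesis using True by simp
      next
        case False
        then show ?thesis by (simp add: c_def UNIV_bool add.commute)
      qed
      have "AE x in lebesgue. ((\<lambda>(j, m). lam j m * a j m x) has_sum f x) UNIV"
        using F fin by (subst Lp_sums_atoms_iff[OF p q s d _ at(1) f, symmetric]) (auto simp: atomic_rep_def)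
      moreover have "AE x in lebesgue. ((\<lambda>(j, m). mu j m * b j m x) has_sum g x) UNIV"
        using G fin by (subst Lp_sums_atoms_iff[OF p q s d _ at(2) g, symmetric]) (auto simp: atomic_rep_def)
      ultimately have "AE x in lebesgue. ((\<lambda>(j, m). of_real (nr j m) * c j m x) has_sum (f x + g x)) UNIV"
      proof eventually_elim
        case (elim x)
        from has_sum_add[OF this] show ?case by (simp add: eq case_prod_unfold)
      qed
      then have "Lp_sums p (\<lambda>j m x. of_real (nr j m) * c j m x) (\<lambda>x. f x + g x)"
        using f g by (subst Lp_sums_atoms_iff[OF p q s d nu_fin cat]) auto
      then have "atomic_rep s p q (smooth_atom K d) (\<lambda>x. f x + g x) (\<lambda>j m. of_real (nr j m)) c"
        using nu_fin cat by (simp add: atomic_rep_def)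
      from order_trans[OF besov_qnorm_le[OF this] nu_le] show ?thesis .
    qed
    show "besov_qnorm K d s p q (\<lambda>x. f x + g x) \<le> ennreal C * (besov_qnorm K d s p q f + besov_qnorm K d s p q g)"
    proof (rule ennreal_le_epsilon)
      fix e :: real
      assume top: "ennreal C * (besov_qnorm K d s p q f + besov_qnorm K d s p q g) < top" and e: "0 < e"
      define e' where "e' = e / (2 * C)"
      have e': "0 < e'" using e C by (simp add: e'_def)
      have fing: "besov_qnorm K d s p q f < top" "besov_qnorm K d s p q g < top"
        using top C(1) by (auto simp: ennreal_mult_less_top)
      have "besov_qnorm K d s p q f < besov_qnorm K d s p q f + ennreal e'" "besov_qnorm K d s p q g < besov_qnorm K d s p q g + ennreal e'"
      proof -
        have "x < x + ennreal e'" if "x < top" for x :: ennreal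
          using that e' by (cases x) (auto simp: ennreal_less_iff simp flip: ennreal_plus)
        then show "besov_qnorm K d s p q f < besov_qnorm K d s p q f + ennreal e'" "besov_qnorm K d s p q g < besov_qnorm K d s p q g + ennreal e'"
          using fing by blast+
      qed
      then obtain lam a mu b where
        1: "atomic_rep s p q (smooth_atom K d) f lam a" "b_qnorm s p q lam < besov_qnorm K d s p q f + ennreal e'" and
        2: "atomic_rep s p q (smooth_atom K d) g mu b" "b_qnorm s p q mu < besov_qnorm K d s p q g + ennreal e'"
        using besov_qnorm_lessD by metis
      have "besov_qnorm K d s p q (\<lambda>x. f x + g x) \<le> ennreal C * (b_qnorm s p q lam + b_qnorm s p q mu)"
        by (rule rep_add[OF 1(1) 2(1)])
      also have "\<dots> \<le> ennreal C * ((besov_qnorm K d s p q f + ennreal e') + (besov_qnorm K d s p q g + ennreal e'))"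
        using 1(2) 2(2) by (intro mult_left_mono add_mono) auto
      also have "\<dots> = ennreal C * (besov_qnorm K d s p q f + besov_qnorm K d s p q g) + ennreal C * (ennreal e' + ennreal e')"
        by (simp add: distrib_left add_ac)
      also have "ennreal C * (ennreal e' + ennreal e') = ennreal e"
        using C e' by (simp add: ennreal_plus[symmetric] ennreal_mult[symmetric] e'_def del: ennreal_plus)
      finally show "besov_qnorm K d s p q (\<lambda>x. f x + g x)
          \<le> ennreal C * (besov_qnorm K d s p q f + besov_qnorm K d s p q g) + ennreal e" .
    qed
  qed
qed

text \<open>Since \<open>M > s\<close>, atoms with \<open>M\<close> derivatives are molecules of admissible order. This is the
independence of the Besov spaces of the smoothness \<open>K\<close> and the dilation parameter \<open>d\<close> of the atoms.\<close>

lemma smooth_atoms_refine: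
  assumes p: "0 < p" and q: "0 < q" and s: "0 < s" "s < real M" and d: "0 \<le> d"
  obtains C :: real where "0 < C"
    "refines s p q (smooth_atom M d) (smooth_atom K 1 :: nat \<Rightarrow> int ^ 'n \<Rightarrow> _ \<Rightarrow> bool) C"
proof -
  have M: "1 \<le> M" using s by (cases M) auto
  obtain B D :: real where B: "0 \<le> B" "0 \<le> D"
    "\<And>j m (u :: real ^ 'n \<Rightarrow> complex). smooth_atom M d j m u \<Longrightarrow> molecule K 1 (real M) p D B j m u"
    using smooth_atom_molecule[OF p M d, where K=K and 'n='n] by blast
  obtain C where C: "0 < C"
    "refines s p q (molecule K 1 (real M) p D B) (smooth_atom K 1 :: nat \<Rightarrow> int ^ 'n \<Rightarrow> _ \<Rightarrow> bool) C"
    by (rule molecular_synthesis[OF p q s zero_le_one B(2,1), where K=K and 'n='n]) blast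
  have "refines s p q (smooth_atom M d) (smooth_atom K 1 :: nat \<Rightarrow> int ^ 'n \<Rightarrow> _ \<Rightarrow> bool) C"
    by (rule refines_mono[OF C(2)]) (rule B(3))
  then show thesis by (rule that[OF C(1)])
qed

section \<open>The characterization by non-smooth atoms\<close>

theorem theorem2p6:
  fixes p q :: ennreal and s \<sigma> d d\<^sub>s d\<^sub>\<sigma> :: real and K\<^sub>s K\<^sub>\<sigma> :: nat
  assumes "0 < p" and "0 < q"
    and "0 < s" and "s < \<sigma>"
    and "1 < d"
    and "1 < d\<^sub>s" and "1 + \<lfloor>s\<rfloor> \<le> int K\<^sub>s"
    and "1 < d\<^sub>\<sigma>" and "1 + \<lfloor>\<sigma>\<rfloor> \<le> int K\<^sub>\<sigma>"
  shows "(\<forall>f :: real ^ 'n \<Rightarrow> complex. f \<in> Lp_space p \<longrightarrow>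
            (f \<in> besov_space K\<^sub>s d\<^sub>s s p q \<longleftrightarrow>
             (\<exists>lam a. atomic_rep s p q (nonsmooth_atom K\<^sub>\<sigma> d\<^sub>\<sigma> \<sigma> p d) f lam a))) \<and>
         quasi_norm_on (besov_space K\<^sub>s d\<^sub>s s p q :: (real ^ 'n \<Rightarrow> complex) set)
           (atomic_qnorm s p q (nonsmooth_atom K\<^sub>\<sigma> d\<^sub>\<sigma> \<sigma> p d)) \<and>
         equivalent_on (besov_space K\<^sub>s d\<^sub>s s p q :: (real ^ 'n \<Rightarrow> complex) set)
           (besov_qnorm K\<^sub>s d\<^sub>s s p q)
           (atomic_qnorm s p q (nonsmooth_atom K\<^sub>\<sigma> d\<^sub>\<sigma> \<sigma> p d))"
proof -
  note p = assms(1) and q = assms(2) and s = assms(3)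
  have \<sigma>: "0 < \<sigma>" using assms by simp
  have d0: "0 \<le> d" "0 \<le> d\<^sub>s" "0 \<le> d\<^sub>\<sigma>" using assms by auto
  have Ks: "s < real K\<^sub>s" and Ksig: "\<sigma> < real K\<^sub>\<sigma>"
    using assms(7,9) by linarith+
  let ?NA = "nonsmooth_atom K\<^sub>\<sigma> d\<^sub>\<sigma> \<sigma> p d :: nat \<Rightarrow> int ^ 'n \<Rightarrow> (real ^ 'n \<Rightarrow> complex) \<Rightarrow> bool"
  let ?SA = "smooth_atom K\<^sub>s d\<^sub>s :: nat \<Rightarrow> int ^ 'n \<Rightarrow> (real ^ 'n \<Rightarrow> complex) \<Rightarrow> bool"
  let ?V = "besov_space K\<^sub>s d\<^sub>s s p q :: (real ^ 'n \<Rightarrow> complex) set"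
  let ?N = "atomic_qnorm s p q ?NA" and ?B = "besov_qnorm K\<^sub>s d\<^sub>s s p q :: (real ^ 'n \<Rightarrow> complex) \<Rightarrow> ennreal"
  \<comment> \<open>Pass to \<open>K\<^sub>\<sigma>\<close> derivatives and supports in \<open>Q\<^sub>j\<^sub>,\<^sub>m\<close>; such atoms are \<open>(\<sigma>,p)\<close>-atoms.\<close>
  obtain C1 where C1: "0 < C1" and to_nonsmooth: "refines s p q ?SA ?NA C1"
  proof -
    obtain C where C: "0 < C" "refines s p q ?SA (smooth_atom K\<^sub>\<sigma> 1) C"
      by (rule smooth_atoms_refine[OF p q s Ks d0(2)])
    have "refines s p q ?SA ?NA C"
      by (rule refines_mono[OF C(2)], assumption, rule smooth_atom_imp_nonsmooth_atom[OF p \<sigma>])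
         (use assms in auto)
    then show thesis by (rule that[OF C(1)])
  qed
  obtain B D :: real where B: "0 \<le> B" "0 \<le> D"
    "\<And>j m (u :: real ^ 'n \<Rightarrow> complex). ?NA j m u \<Longrightarrow> molecule K\<^sub>\<sigma> d\<^sub>\<sigma> \<sigma> p D B j m u"
    using nonsmooth_atom_molecule[OF p \<sigma> d0(1,3), where K=K\<^sub>\<sigma> and 'n='n] by blast
  obtain C0 :: real where C0: "0 < C0"
    and R0: "refines s p q (molecule K\<^sub>\<sigma> d\<^sub>\<sigma> \<sigma> p D B) (smooth_atom K\<^sub>\<sigma> d\<^sub>\<sigma> :: nat \<Rightarrow> int ^ 'n \<Rightarrow> _ \<Rightarrow> bool) C0"
    and sums_iff: "\<And>lam u (f :: real ^ 'n \<Rightarrow> complex). f \<in> borel_measurable lebesgue \<Longrightarrow> b_qnorm s p q lam < \<infinity> \<Longrightarrow>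
       (\<And>j m. molecule K\<^sub>\<sigma> d\<^sub>\<sigma> \<sigma> p D B j m (u j m)) \<Longrightarrow>
       Lp_sums p (\<lambda>j m x. lam j m * u j m x) f \<longleftrightarrow>
         (AE x in lebesgue. ((\<lambda>(j, m). lam j m * u j m x) has_sum f x) UNIV)"
    by (rule molecular_synthesis[OF p q s assms(4) d0(3) B(2,1), where K=K\<^sub>\<sigma> and 'n='n]) blast
  \<comment> \<open>Synthesis yields atoms with the parameters \<open>K\<^sub>\<sigma>\<close>, \<open>d\<^sub>\<sigma>\<close>; since \<open>K\<^sub>\<sigma> > s\<close>, they can be exchanged for atoms
    with \<open>K\<^sub>s\<close> derivatives and support in \<open>Q\<^sub>j\<^sub>,\<^sub>m\<close>, which lies in \<open>d\<^sub>s Q\<^sub>j\<^sub>,\<^sub>m\<close>.\<close>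
  obtain C2 where C2: "0 < C2" and to_smooth: "refines s p q ?NA ?SA C2"
  proof -
    have "s < real K\<^sub>\<sigma>" using Ksig assms(4) by simp
    then obtain C where C: "0 < C"
        "refines s p q (smooth_atom K\<^sub>\<sigma> d\<^sub>\<sigma>) (smooth_atom K\<^sub>s 1 :: nat \<Rightarrow> int ^ 'n \<Rightarrow> _ \<Rightarrow> bool) C"
      by (rule smooth_atoms_refine[OF p q s _ d0(3)])
    have R1: "refines s p q (molecule K\<^sub>\<sigma> d\<^sub>\<sigma> \<sigma> p D B) (smooth_atom K\<^sub>s 1 :: nat \<Rightarrow> int ^ 'n \<Rightarrow> _ \<Rightarrow> bool) (C * C0)"
      by (rule refines_trans[OF R0 C(2)]) (use C C0 in auto)
    have "refines s p q ?NA ?SA (C * C0)"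
    proof (rule refines_mono[OF R1])
      show "smooth_atom K\<^sub>s d\<^sub>s j m a" if "smooth_atom K\<^sub>s 1 j m a" for j m and a :: "real ^ 'n \<Rightarrow> complex"
        by (rule smooth_atom_mono[OF that]) (use assms in simp)
    qed (rule B(3))
    then show thesis using that[of "C * C0"] C C0 by simp
  qed
  have meas: "f \<in> borel_measurable lebesgue" if "f \<in> ?V" for f
    using that by (simp add: besov_space_def Lp_space_def)
  have N_le: "?N f \<le> ennreal C1 * ?B f" if "f \<in> borel_measurable lebesgue" for f
    unfolding besov_qnorm_def by (rule refines_atomic_qnorm_le[OF C1 to_nonsmooth that])
  have B_le: "?B f \<le> ennreal C2 * ?N f" if "f \<in> borel_measurable lebesgue" for f
    unfolding besov_qnorm_def by (rule refines_atomic_qnorm_le[OF C2 to_smooth that])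
  have part1: "f \<in> ?V \<longleftrightarrow> (\<exists>lam a. atomic_rep s p q ?NA f lam a)" if f: "f \<in> Lp_space p" for f
  proof -
    have fm: "f \<in> borel_measurable lebesgue" using f by (simp add: Lp_space_def)
    show ?thesis
      using f fm to_nonsmooth to_smooth unfolding besov_space_def refines_def by blast
  qed
  have part3: "equivalent_on ?V ?B ?N"
    unfolding equivalent_on_def
  proof (intro exI conjI ballI)
    fix f assume "f \<in> ?V"
    then have fm: "f \<in> borel_measurable lebesgue" by (rule meas)
    have "ennreal (1 / C2) * ?B f \<le> ennreal (1 / C2) * (ennreal C2 * ?N f)"
      by (intro mult_left_mono B_le fm) simp
    also have "\<dots> = ?N f"
      using C2 by (simp add: mult.assoc[symmetric] ennreal_mult[symmetric])
    finally show "ennreal (1 / C2) * ?B f \<le> ?N f" .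
    show "?N f \<le> ennreal C1 * ?B f" by (rule N_le[OF fm])
  qed (use C1 C2 in auto)
  \<comment> \<open>Multiplying a representation by \<open>c\<close> is done on almost everywhere sums, where it is immediate.\<close>
  have scale: "?N (\<lambda>x. c * f x) \<le> ennreal (norm c) * ?N f" if c: "c \<noteq> 0" and f: "f \<in> borel_measurable lebesgue" for c f
    unfolding atomic_qnorm_def
  proof (rule le_cmult_Inf)
    fix x assume "x \<in> {b_qnorm s p q lam |lam. \<exists>a. atomic_rep s p q ?NA f lam a}"
    then obtain lam a where x: "x = b_qnorm s p q lam" and rep: "atomic_rep s p q ?NA f lam a" by blast
    have fin: "b_qnorm s p q lam < \<infinity>" and mol: "molecule K\<^sub>\<sigma> d\<^sub>\<sigma> \<sigma> p D B j m (a j m)" for j m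
      using rep B(3) by (auto simp: atomic_rep_def)
    have fin': "b_qnorm s p q (\<lambda>j m. c * lam j m) < \<infinity>"
      using fin by (simp add: b_qnorm_cmult[OF p q c] ennreal_mult_less_top)
    have cf: "(\<lambda>x. c * f x) \<in> borel_measurable lebesgue" using f by simp
    have "AE x in lebesgue. ((\<lambda>(j, m). lam j m * a j m x) has_sum f x) UNIV"
      using rep sums_iff[OF f fin mol] by (simp add: atomic_rep_def)
    then have "AE x in lebesgue. ((\<lambda>(j, m). (c * lam j m) * a j m x) has_sum (c * f x)) UNIV"
    proof eventually_elim
      case (elim x)
      from has_sum_cmult_right[OF this, of c] show ?case by (simp add: case_prod_unfold mult.assoc)
    qed
    then have "Lp_sums p (\<lambda>j m x. (c * lam j m) * a j m x) (\<lambda>x. c * f x)"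
      using sums_iff[OF cf fin' mol] by blast
    then have "atomic_rep s p q ?NA (\<lambda>x. c * f x) (\<lambda>j m. c * lam j m) a"
      using rep fin' by (simp add: atomic_rep_def)
    then have "Inf {b_qnorm s p q lam |lam. \<exists>a. atomic_rep s p q ?NA (\<lambda>x. c * f x) lam a} \<le> b_qnorm s p q (\<lambda>j m. c * lam j m)"
      by (intro Inf_lower) blast
    then show "Inf {b_qnorm s p q lam |lam. \<exists>a. atomic_rep s p q ?NA (\<lambda>x. c * f x) lam a} \<le> ennreal (norm c) * x"
      by (simp add: x b_qnorm_cmult[OF p q c])
  qed (use c in simp)
  have N_zero: "?N f = 0" if "f \<in> borel_measurable lebesgue" "AE x in lebesgue. f x = 0" for f
    using N_le[OF that(1)] smooth_rep_zero[OF p q s d0(2) that] by simp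
  \<comment> \<open>Definiteness and the triangle inequality are transferred from the smooth atomic quasi-norm.\<close>
  have part2: "quasi_norm_on ?V ?N"
    unfolding quasi_norm_on_def
  proof (intro conjI ballI allI)
    fix f assume fV: "f \<in> ?V"
    note fm = meas[OF fV]
    show "?N f < \<infinity>"
    proof -
      have fL: "f \<in> Lp_space p" using fV by (simp add: besov_space_def)
      obtain lam a where rep: "atomic_rep s p q ?NA f lam a"
        using fV part1[OF fL] by blast
      then have "?N f \<le> b_qnorm s p q lam" unfolding atomic_qnorm_def by (intro Inf_lower) blast
      also have "\<dots> < \<infinity>" using rep by (simp add: atomic_rep_def)
      finally show ?thesis .
    qed
    show "?N f = 0 \<longleftrightarrow> (AE x in lebesgue. f x = 0)"
    proof
      assume "?N f = 0"
      then have "?B f = 0" using B_le[OF fm] by simp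
      then show "AE x in lebesgue. f x = 0" by (rule besov_qnorm_zeroD[OF p q s d0(2) fm])
    qed (rule N_zero[OF fm])
    fix c :: complex
    show "?N (\<lambda>x. c * f x) = ennreal (norm c) * ?N f"
    proof (cases "c = 0")
      case True then show ?thesis using N_zero[of "\<lambda>x. 0"] by simp
    next
      case False
      have cf: "(\<lambda>x. c * f x) \<in> borel_measurable lebesgue" using fm by simp
      have "?N f \<le> ennreal (norm (1 / c)) * ?N (\<lambda>x. c * f x)"
        using scale[of "1 / c" "\<lambda>x. c * f x"] cf False by simp
      then have "ennreal (norm c) * ?N f \<le> ennreal (norm c) * (ennreal (norm (1 / c)) * ?N (\<lambda>x. c * f x))"
        by (rule mult_left_mono) simp
      also have "\<dots> = ?N (\<lambda>x. c * f x)"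
        using False by (simp add: mult.assoc[symmetric] ennreal_mult[symmetric] norm_divide)
      finally show ?thesis using scale[OF False fm] by (intro antisym)
    qed
  next
    obtain C :: real where C: "0 < C"
      "\<And>f g :: real ^ 'n \<Rightarrow> complex. f \<in> borel_measurable lebesgue \<Longrightarrow> g \<in> borel_measurable lebesgue \<Longrightarrow>
         ?B (\<lambda>x. f x + g x) \<le> ennreal C * (?B f + ?B g)"
      using besov_qnorm_triangle[OF p q s d0(2), where K=K\<^sub>s and 'n='n] by metis
    have "?N (\<lambda>x. f x + g x) \<le> ennreal (C1 * C * C2) * (?N f + ?N g)" if "f \<in> ?V" "g \<in> ?V" for f g
    proof -
      have fm: "f \<in> borel_measurable lebesgue" and gm: "g \<in> borel_measurable lebesgue" using that meas by auto
      have "?N (\<lambda>x. f x + g x) \<le> ennreal C1 * ?B (\<lambda>x. f x + g x)" by (rule N_le) (use fm gm in simp)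
      also have "\<dots> \<le> ennreal C1 * (ennreal C * (?B f + ?B g))" by (intro mult_left_mono C fm gm) simp
      also have "\<dots> \<le> ennreal C1 * (ennreal C * (ennreal C2 * ?N f + ennreal C2 * ?N g))"
        by (intro mult_left_mono add_mono B_le fm gm) auto
      also have "\<dots> = ennreal (C1 * C * C2) * (?N f + ?N g)"
        using C C1 C2 by (simp add: ennreal_mult distrib_left[symmetric] mult.assoc)
      finally show ?thesis .
    qed
    then show "\<exists>C. \<forall>f\<in>?V. \<forall>g\<in>?V. ?N (\<lambda>x. f x + g x) \<le> ennreal C * (?N f + ?N g)" by blast
  qed
  show ?thesis using part1 part2 part3 by blast
qed

end
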